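(* We have $S_{\square}(14)=15$, $S_{\square}(15)=17$, $S_{\square}(16)=20$, and $S_{\square}(17)=22$.
   Context: For a finite set $P\subset\mathbb{R}^2$, $S_{\square}(P)$ denotes the number of squares contained in $P$, i.e. the number of $4$-element subsets of $P$ that are the vertex set of a (non-degenerate, arbitrarily oriented) square. $S_{\square}(n)$ denotes the maximum of $S_{\square}(P)$ over all subsets $P\subset\mathbb{R}^2$ of cardinality $n$. *)

theory Defs
  imports "HOL-Analysis.Analysis"
begin

(* a, b, c, d are the consecutive vertices of a non-degenerate square:
   a parallelogram with a right angle and two equal adjacent sides at a. *)
definition is_square :: "real^2 \<Rightarrow> real^2 \<Rightarrow> real^2 \<Rightarrow> real^2 \<Rightarrow> bool" where
  "is_square a b c d \<longleftrightarrow>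
     a \<noteq> b \<and> b - a = c - d \<and> (b - a) \<bullet> (d - a) = 0 \<and> dist a b = dist a d"

definition squares_in :: "(real^2) set \<Rightarrow> (real^2) set set" where
  "squares_in P =
     {Q. Q \<subseteq> P \<and> card Q = 4 \<and> (\<exists>a b c d. Q = {a, b, c, d} \<and> is_square a b c d)}"

definition num_squares :: "(real^2) set \<Rightarrow> nat" where
  "num_squares P = card (squares_in P)"

definition max_squares :: "nat \<Rightarrow> nat" where
  "max_squares n = Max {num_squares P | P. finite P \<and> card P = n}"

(* The set whose maximum is taken is finite and non-empty, so Max is meaningful. *)
lemma max_squares_well_defined:
  "finite {num_squares P | P. finite P \<and> card P = n}"
  "{num_squares P | P. finite P \<and> card P = n} \<noteq> {}"
proof -
  have "num_squares P \<le> 2 ^ n" if "finite P" "card P = n" for P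
  proof -
    have "card (squares_in P) \<le> card (Pow P)"
      using that by (intro card_mono) (auto simp: squares_in_def)
    then show ?thesis
      using that by (simp add: num_squares_def card_Pow)
  qed
  then have "{num_squares P | P. finite P \<and> card P = n} \<subseteq> {..2 ^ n}"
    by auto
  then show "finite {num_squares P | P. finite P \<and> card P = n}"
    by (rule finite_subset) simp
  have "infinite (UNIV :: (real^2) set)"
    using not_bounded_UNIV finite_imp_bounded by blast
  then obtain P :: "(real^2) set" where "finite P" "card P = n"
    using infinite_arbitrarily_large by blast
  then show "{num_squares P | P. finite P \<and> card P = n} \<noteq> {}"
    by blast
qed

end

theory Submission imports Defs "HOL-Analysis.Analysis" begin

text \<open>
  Work in the complex plane. A \<open>\<rat>\<close>-linear functional, applied coordinatewise, and division by a power of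
  \<open>1 + \<i>\<close> give every finite \<open>P\<close> a \<open>\<int>[\<i>]\<close>-affine map to \<open>\<int>[\<i>]\<close> taking values of both parities
  modulo \<open>1 + \<i>\<close>. Let \<open>U\<close> and \<open>V\<close> be the two parity classes. A square lies inside \<open>U\<close>, inside \<open>V\<close>,
  or has one diagonal in \<open>U\<close> and the other in \<open>V\<close>; in the last case the ends of each diagonal lie in different
  parity classes \<open>A\<close>, \<open>B\<close> of \<open>U\<close> at the next level, so there are at most \<open>|A| |B|\<close> mixed squares.
  By induction this bounds the number of squares, except when \<open>|U|\<close> and \<open>|V|\<close> are nearly equal.

  In these cases \<open>U\<close> or \<open>V\<close> must itself be nearly extremal. The same splitting then identifies it
  as the \<open>3 \<times> 3\<close> grid with few points removed or added, for which the pairs in \<open>A \<times> B\<close> whose square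
  closes up inside \<open>k\<close> further points are counted directly; otherwise the graph of these pairs is almost complete
  bipartite and contains a square, which forces too many points into the other class.
\<close>

section \<open>Squares in the complex plane\<close>

text \<open>The map to the Gaussian integers need not be injective on \<open>P\<close>: squares are
  always counted in the original plane, and the map only distributes points over two classes, so it
  may collapse a square. The plain recursion adds the table values at both class sizes to a quarter
  of the square of the smaller size. It overshoots the table at exactly seven pairs of sizes: 4+4,
  5+5, 7+7, 8+7, 8+8, 9+7, 9+8; for 8+8 it gives 4 + 4 + 16 = 24 instead of 20. A trade-off saves
  these cases: many squares inside one class leave room for fewer mixed squares. Each exceptional
  pair needs this at several thresholds, hence the separate bounds for various numbers of points and
  squares. The trade-off has two sources. The vertices completing pairs over the 3 by 3 grid are
  spread over twelve points, more than the other class offers. And a complete graph between the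
  subclasses, once it contains a square, needs at least nine points for these vertices (3 by 4) or
  ten (4 by 4).\<close>

definition sq :: "complex \<Rightarrow> complex \<Rightarrow> complex set" where
  "sq c e = {c + e, c - e, c + \<i> * e, c - \<i> * e}"

definition sqs :: "complex set \<Rightarrow> complex set set" where
  "sqs P = {Q. Q \<subseteq> P \<and> (\<exists>c e. e \<noteq> 0 \<and> Q = sq c e)}"

definition nsq :: "complex set \<Rightarrow> nat" where
  "nsq P = card (sqs P)"

definition mixed :: "complex set \<Rightarrow> complex set \<Rightarrow> complex set set" where
  "mixed U V = {Q. \<exists>c e. e \<noteq> 0 \<and> Q = sq c e \<and> c + e \<in> U \<and> c - e \<in> U \<and> c + \<i> * e \<in> V \<and> c - \<i> * e \<in> V}"

text \<open>For the diagonal from \<open>c + e\<close> to \<open>c - e\<close> this is the vertex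
  \<open>c + \<i> * e\<close>; exchanging the arguments gives the fourth vertex of the
  square.\<close>

definition apex :: "complex \<Rightarrow> complex \<Rightarrow> complex" where
  "apex x y = (y + \<i> * x) / (1 + \<i>)"

text \<open>A bipartite graph: its pairs are candidate diagonals, joined when \<open>V\<close> holds
  both remaining vertices of the square.\<close>

definition edges :: "complex set \<Rightarrow> complex set \<Rightarrow> complex set \<Rightarrow> (complex \<times> complex) set" where
  "edges A B V = {(x, y). x \<in> A \<and> y \<in> B \<and> apex x y \<in> V \<and> apex y x \<in> V}"

lemma one_plus_i_nonzero [simp]: "1 + \<i> \<noteq> 0"
  by (simp add: complex_eq_iff)

lemma sq_rotate: "sq c (\<i> * e) = sq c e"
  by (auto simp: sq_def)

lemma finite_sq [simp]: "finite (sq c e)"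
  by (simp add: sq_def)

lemma card_sq: "e \<noteq> 0 \<Longrightarrow> card (sq c e) = 4"
proof -
  assume e: "e \<noteq> 0"
  have 1: "c + e \<noteq> c - e" "c + \<i> * e \<noteq> c - \<i> * e"
    using e by (auto simp: eq_diff_eq add.assoc simp flip: mult_2)
  have "e \<noteq> \<i> * e" "e \<noteq> - \<i> * e"
    using e by (auto simp: complex_eq_iff)
  then have 2: "c + e \<noteq> c + \<i> * e" "c + e \<noteq> c - \<i> * e" "c - e \<noteq> c + \<i> * e" "c - e \<noteq> c - \<i> * e"
    by (auto simp: eq_diff_eq diff_eq_eq eq_neg_iff_add_eq_0 add.assoc add.commute)
  show ?thesis
    unfolding sq_def using 1 2 by auto
qed

lemma finite_sqs: "finite P \<Longrightarrow> finite (sqs P)"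
  by (rule finite_subset[of _ "Pow P"]) (auto simp: sqs_def)

lemma mixed_subset: "mixed U V \<subseteq> Pow (U \<union> V)"
  by (auto simp: mixed_def sq_def)

lemma finite_mixed: "finite U \<Longrightarrow> finite V \<Longrightarrow> finite (mixed U V)"
  by (rule finite_subset[OF mixed_subset]) simp

lemma mixed_sym: "mixed U V = mixed V U"
proof -
  have "mixed U V \<subseteq> mixed V U" for U V
  proof
    fix Q assume "Q \<in> mixed U V"
    then obtain c e where *: "e \<noteq> 0" "Q = sq c e" "c + e \<in> U" "c - e \<in> U" "c + \<i> * e \<in> V" "c - \<i> * e \<in> V"
      by (auto simp: mixed_def)
    have "c + \<i> * (\<i> * e) = c - e" "c - \<i> * (\<i> * e) = c + e" by simp_all
    then have "\<i> * e \<noteq> 0 \<and> Q = sq c (\<i> * e) \<and> c + \<i> * e \<in> V \<and> c - \<i> * e \<in> V \<and>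
        c + \<i> * (\<i> * e) \<in> U \<and> c - \<i> * (\<i> * e) \<in> U"
      using * sq_rotate[of c e] by (metis complex_i_not_zero mult_eq_0_iff)
    then show "Q \<in> mixed V U"
      unfolding mixed_def by blast
  qed
  then show ?thesis by blast
qed

lemma edges_subset: "edges A B V \<subseteq> A \<times> B"
  by (auto simp: edges_def)

lemma finite_edges: "finite A \<Longrightarrow> finite B \<Longrightarrow> finite (edges A B V)"
  by (rule finite_subset[OF edges_subset]) simp

lemma card_edges_le: "finite A \<Longrightarrow> finite B \<Longrightarrow> card (edges A B V) \<le> card A * card B"
  using card_mono[OF _ edges_subset[of A B V]] by (simp add: card_cartesian_product)

lemma card_edges_swap: "card (edges B A V) = card (edges A B V)"
proof -
  have "edges B A V = prod.swap ` edges A B V"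
    by (auto simp: edges_def)
  then show ?thesis
    by (simp add: card_image)
qed

lemma nsq_small: "finite P \<Longrightarrow> card P < 4 \<Longrightarrow> nsq P = 0"
proof -
  assume P: "finite P" "card P < 4"
  have "Q \<notin> sqs P" for Q
  proof
    assume "Q \<in> sqs P"
    then obtain c e where "e \<noteq> 0" "Q = sq c e" "Q \<subseteq> P" by (auto simp: sqs_def)
    then show False using card_mono[OF P(1), of Q] card_sq[of e c] P(2) by simp
  qed
  then show ?thesis by (auto simp: nsq_def card_eq_0_iff)
qed

section \<open>Parity classes\<close>

definition gauss :: "complex set" where
  "gauss = {z. Re z \<in> \<int> \<and> Im z \<in> \<int>}"

text \<open>The ideal generated by \<open>1 + \<i>\<close>, of index two in the Gaussian integers. A
  Gaussian integer lies in it iff its coordinates have an even sum.\<close>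

definition evens :: "complex set" where
  "evens = {z. z / (1 + \<i>) \<in> gauss}"

lemma gauss_add: "x \<in> gauss \<Longrightarrow> y \<in> gauss \<Longrightarrow> x + y \<in> gauss"
  and gauss_diff: "x \<in> gauss \<Longrightarrow> y \<in> gauss \<Longrightarrow> x - y \<in> gauss"
  and gauss_mult: "x \<in> gauss \<Longrightarrow> y \<in> gauss \<Longrightarrow> x * y \<in> gauss"
  by (auto simp: gauss_def)

lemma gauss_const [simp]: "1 \<in> gauss" "\<i> \<in> gauss" "0 \<in> gauss"
  by (auto simp: gauss_def)

lemma evens_add: "x \<in> evens \<Longrightarrow> y \<in> evens \<Longrightarrow> x + y \<in> evens"
  and evens_diff: "x \<in> evens \<Longrightarrow> y \<in> evens \<Longrightarrow> x - y \<in> evens"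
  by (auto simp: evens_def add_divide_distrib diff_divide_distrib gauss_add gauss_diff)

lemma evens_mult: "x \<in> gauss \<Longrightarrow> (1 + \<i>) * x \<in> evens"
  by (simp add: evens_def)

lemma div_one_plus_i: "z / (1 + \<i>) = Complex ((Re z + Im z) / 2) ((Im z - Re z) / 2)"
  by (simp add: complex_eq_iff Re_divide Im_divide power2_eq_square)

lemma one_not_even: "1 \<notin> evens"
proof
  assume "1 \<in> evens"
  then have "(1/2::real) \<in> \<int>"
    by (simp add: evens_def div_one_plus_i gauss_def)
  then obtain k :: int where "(1/2::real) = of_int k"
    by (auto elim: Ints_cases)
  then have "of_int (2 * k) = (1::real)" by simp
  then have "2 * k = 1" by linarith
  then show False by presburger
qed

lemma even_or_odd: "x \<in> gauss \<Longrightarrow> x \<in> evens \<or> x - 1 \<in> evens"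
proof -
  assume "x \<in> gauss"
  then obtain a b where ab: "Re x = of_int a" "Im x = of_int b"
    by (auto simp: gauss_def elim!: Ints_cases)
  consider "even (a + b)" | "odd (a + b)" by blast
  then show ?thesis
  proof cases
    case 1
    then obtain k where k: "a + b = 2 * k" by (rule evenE)
    then have "a = 2 * k - b" by simp
    then have "(Re x + Im x) / 2 = of_int k" "(Im x - Re x) / 2 = of_int (b - k)"
      using ab by (auto simp: field_simps)
    then have "x \<in> evens"
      unfolding evens_def div_one_plus_i gauss_def by (simp del: of_int_diff)
    then show ?thesis ..
  next
    case 2
    then obtain k where k: "a + b = 2 * k + 1" by (rule oddE)
    then have "a = 2 * k + 1 - b" by simp
    then have "(Re (x - 1) + Im (x - 1)) / 2 = of_int k" "(Im (x - 1) - Re (x - 1)) / 2 = of_int (b - k)"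
      using ab by (auto simp: field_simps)
    then have "x - 1 \<in> evens"
      unfolding evens_def div_one_plus_i gauss_def by (simp del: of_int_diff minus_complex.sel)
    then show ?thesis ..
  qed
qed

lemma odd_iff: "x \<in> gauss \<Longrightarrow> x - 1 \<in> evens \<longleftrightarrow> x \<notin> evens"
  using even_or_odd[of x] evens_diff[of x "x - 1"] one_not_even by auto

lemma odd_diff: "x \<in> gauss \<Longrightarrow> y \<in> gauss \<Longrightarrow> x \<notin> evens \<Longrightarrow> y \<notin> evens \<Longrightarrow> x - y \<in> evens"
  using evens_diff[of "x - 1" "y - 1"] odd_iff[of x] odd_iff[of y] by simp

text \<open>The forms will come from a functional that is linear over the rationals only, so real
  scalars are absent here. The first law already makes \<open>l\<close> additive; the second makes
  it respect quarter turns, so that squares go to possibly degenerate squares.\<close>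

definition affine_form :: "(complex \<Rightarrow> complex) \<Rightarrow> (complex \<Rightarrow> complex) \<Rightarrow> bool" where
  "affine_form f l \<longleftrightarrow> (\<forall>a v. f (a + v) = f a + l v) \<and> (\<forall>v. l (\<i> * v) = \<i> * l v)"

definition parity_split :: "complex set \<Rightarrow> complex set \<Rightarrow> complex set \<Rightarrow> bool" where
  "parity_split P U V \<longleftrightarrow> (\<exists>f l. affine_form f l \<and> f ` P \<subseteq> gauss \<and>
     U = {p \<in> P. f p \<in> evens} \<and> V = {p \<in> P. f p \<notin> evens})"

lemma parity_split_sets: "parity_split P U V \<Longrightarrow> P = U \<union> V" "parity_split P U V \<Longrightarrow> U \<inter> V = {}"
  by (auto simp: parity_split_def)

lemma parity_split_finite: "parity_split P U V \<Longrightarrow> finite P \<Longrightarrow> finite U \<and> finite V"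
  by (auto simp: parity_split_def)

lemma parity_split_card: "parity_split P U V \<Longrightarrow> finite P \<Longrightarrow> card U + card V = card P"
  using parity_split_sets[of P U V] parity_split_finite[of P U V] card_Un_disjoint[of U V] by simp

text \<open>Subtracting 1 from the form exchanges the two residues.\<close>

lemma parity_split_sym:
  assumes "parity_split P U V"
  shows "parity_split P V U"
proof -
  obtain f l where f: "affine_form f l" "f ` P \<subseteq> gauss" "U = {p \<in> P. f p \<in> evens}" "V = {p \<in> P. f p \<notin> evens}"
    using assms by (auto simp: parity_split_def)
  let ?g = "\<lambda>z. f z - 1"
  have "affine_form ?g l" using f(1) by (auto simp: affine_form_def)
  moreover have "?g ` P \<subseteq> gauss" using f(2) by (auto intro!: gauss_diff)
  moreover have "?g p \<in> evens \<longleftrightarrow> f p \<notin> evens" if "p \<in> P" for p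
    using odd_iff[of "f p"] f(2) that by auto
  ultimately show ?thesis
    unfolding parity_split_def using f(3,4) by (intro exI[of _ ?g] exI[of _ l]) auto
qed

text \<open>The vertices of \<^term>\<open>sq c e\<close>, starting from \<^term>\<open>a = c + e\<close> with side \<^term>\<open>v = (\<i> - 1) * e\<close>.\<close>

lemma affine_form_sq:
  assumes "affine_form f l"
  defines "u \<equiv> \<lambda>e. l ((\<i> - 1) * e)"
  shows "f (c + \<i> * e) = f (c + e) + u e" "f (c - e) = f (c + e) + (1 + \<i>) * u e"
    "f (c - \<i> * e) = f (c + e) + \<i> * u e"
proof -
  have ad: "f (a + v) = f a + l v" and li: "l (\<i> * v) = \<i> * l v" for a v
    using assms(1) by (auto simp: affine_form_def)
  have 1: "c + \<i> * e = (c + e) + (\<i> - 1) * e" "c - \<i> * e = (c + e) + \<i> * ((\<i> - 1) * e)"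
    "c - e = (c + e) + (\<i> - 1) * e + \<i> * ((\<i> - 1) * e)"
    by (simp_all add: algebra_simps)
  show "f (c + \<i> * e) = f (c + e) + u e" "f (c - \<i> * e) = f (c + e) + \<i> * u e"
    "f (c - e) = f (c + e) + (1 + \<i>) * u e"
    unfolding u_def 1 ad li by (simp_all add: algebra_simps)
qed

text \<open>Up to a power of \<open>\<i>\<close>, a diagonal is a side times
  \<open>1 + \<i>\<close>, so the values at its two ends differ by an even number.\<close>

lemma split_diag:
  assumes sp: "parity_split P U V" and Q: "sq c e \<subseteq> P"
  shows "c + e \<in> U \<longleftrightarrow> c - e \<in> U" "c + \<i> * e \<in> U \<longleftrightarrow> c - \<i> * e \<in> U"
proof -
  obtain f l where f: "affine_form f l" "f ` P \<subseteq> gauss" "U = {p \<in> P. f p \<in> evens}" "V = {p \<in> P. f p \<notin> evens}"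
    using sp by (auto simp: parity_split_def)
  define u where "u = l ((\<i> - 1) * e)"
  note eqs = affine_form_sq[OF f(1), of c e, folded u_def]
  have mem: "c + e \<in> P" "c - e \<in> P" "c + \<i> * e \<in> P" "c - \<i> * e \<in> P"
    using Q by (auto simp: sq_def)
  then have g: "f (c + e) \<in> gauss" "f (c - e) \<in> gauss" "f (c + \<i> * e) \<in> gauss" "f (c - \<i> * e) \<in> gauss"
    using f(2) by auto
  have u: "u \<in> gauss" using gauss_diff[OF g(3) g(1)] eqs by simp
  have d1: "f (c - e) - f (c + e) \<in> evens" using eqs evens_mult[OF u] by simp
  have "f (c - \<i> * e) - f (c + \<i> * e) = (1 + \<i>) * (\<i> * u)" using eqs by (simp add: algebra_simps)
  then have d2: "f (c - \<i> * e) - f (c + \<i> * e) \<in> evens" using evens_mult[of "\<i> * u"] u gauss_mult[of \<i> u] by simp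
  show "c + e \<in> U \<longleftrightarrow> c - e \<in> U"
    using evens_add[OF d1, of "f (c + e)"] evens_diff[OF _ d1, of "f (c - e)"] mem f(3) by auto
  show "c + \<i> * e \<in> U \<longleftrightarrow> c - \<i> * e \<in> U"
    using evens_add[OF d2, of "f (c + \<i> * e)"] evens_diff[OF _ d2, of "f (c - \<i> * e)"] mem f(3) by auto
qed

lemma nsq_split:
  assumes sp: "parity_split P U V" and fin: "finite P"
  shows "nsq P \<le> nsq U + nsq V + card (mixed U V)"
proof -
  obtain f l where f: "affine_form f l" "f ` P \<subseteq> gauss" "U = {p \<in> P. f p \<in> evens}" "V = {p \<in> P. f p \<notin> evens}"
    using sp by (auto simp: parity_split_def)
  have "sqs P \<subseteq> sqs U \<union> sqs V \<union> mixed U V"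
  proof
    fix Q assume "Q \<in> sqs P"
    then obtain c e where Q: "Q \<subseteq> P" "e \<noteq> 0" "Q = sq c e" by (auto simp: sqs_def)
    have mem: "c + e \<in> P" "c - e \<in> P" "c + \<i> * e \<in> P" "c - \<i> * e \<in> P"
      using Q by (auto simp: sq_def)
    have "sq c e \<subseteq> P" using Q(1,3) by simp
    note diag = split_diag[OF sp this]
    have e1: "f (c - e) \<in> evens \<longleftrightarrow> f (c + e) \<in> evens"
      and e2: "f (c - \<i> * e) \<in> evens \<longleftrightarrow> f (c + \<i> * e) \<in> evens"
      using diag mem f(3) by auto
    show "Q \<in> sqs U \<union> sqs V \<union> mixed U V"
    proof (cases "f (c + e) \<in> evens"; cases "f (c + \<i> * e) \<in> evens")
      assume "f (c + e) \<in> evens" "f (c + \<i> * e) \<in> evens"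
      then have "Q \<subseteq> U" using e1 e2 mem Q f(3) by (auto simp: sq_def)
      then show ?thesis using Q by (auto simp: sqs_def)
    next
      assume "f (c + e) \<notin> evens" "f (c + \<i> * e) \<notin> evens"
      then have "Q \<subseteq> V" using e1 e2 mem Q f(4) by (auto simp: sq_def)
      then show ?thesis using Q by (auto simp: sqs_def)
    next
      assume "f (c + e) \<in> evens" "f (c + \<i> * e) \<notin> evens"
      then have "Q \<in> mixed U V" using e1 e2 mem Q f(3,4) by (auto simp: mixed_def)
      then show ?thesis by simp
    next
      assume "f (c + e) \<notin> evens" "f (c + \<i> * e) \<in> evens"
      then have "Q \<in> mixed V U" using e1 e2 mem Q f(3,4) by (auto simp: mixed_def)
      then show ?thesis by (simp add: mixed_sym)
    qed
  qed
  moreover have "finite (sqs U \<union> sqs V \<union> mixed U V)"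
    using parity_split_finite[OF sp fin] by (simp add: finite_sqs finite_mixed)
  ultimately have "card (sqs P) \<le> card (sqs U \<union> sqs V \<union> mixed U V)"
    by (simp add: card_mono)
  also have "\<dots> \<le> card (sqs U) + card (sqs V) + card (mixed U V)"
    by (meson add_le_mono card_Un_le le_refl order_trans)
  finally show ?thesis by (simp add: nsq_def)
qed

lemma apex_sq: "apex (c + e) (c - e) = c + \<i> * e" "apex (c - e) (c + e) = c - \<i> * e"
  by (simp_all add: apex_def divide_eq_eq) (simp_all add: algebra_simps)

text \<open>The form is divided by \<open>1 + \<i>\<close>, which is possible on the even class. The
  side of a mixed square has an odd value \<open>u\<close>, and the diagonal in \<open>U\<close> has
  value \<open>(1 + \<i>) * u\<close>; after the division its ends differ by \<open>u\<close> and so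
  have different parity.\<close>

lemma next_split:
  assumes sp: "parity_split P U V" and fin: "finite P"
  obtains A B where "parity_split U A B" "card (mixed U V) \<le> card (edges A B V)"
proof -
  obtain f l where f: "affine_form f l" "f ` P \<subseteq> gauss" "U = {p \<in> P. f p \<in> evens}" "V = {p \<in> P. f p \<notin> evens}"
    using sp by (auto simp: parity_split_def)
  define g where "g = (\<lambda>z. f z / (1 + \<i>))"
  define k where "k = (\<lambda>z. l z / (1 + \<i>))"
  define A where "A = {p \<in> U. g p \<in> evens}"
  define B where "B = {p \<in> U. g p \<notin> evens}"
  have gk: "affine_form g k"
    using f(1) by (simp add: affine_form_def g_def k_def add_divide_distrib)
  have gU: "g ` U \<subseteq> gauss"
    using f(3) by (auto simp: g_def evens_def)
  have AB: "parity_split U A B"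
    unfolding parity_split_def A_def B_def using gk gU by blast
  have finU: "finite U" "finite V" using parity_split_finite[OF sp fin] by auto
  have finE: "finite (edges A B V)"
    using finU by (intro finite_edges) (auto simp: A_def B_def)
  have "mixed U V \<subseteq> (\<lambda>(x, y). {x, y, apex x y, apex y x}) ` edges A B V"
  proof
    fix Q assume "Q \<in> mixed U V"
    then obtain c e where *: "e \<noteq> 0" "Q = sq c e" "c + e \<in> U" "c - e \<in> U" "c + \<i> * e \<in> V" "c - \<i> * e \<in> V"
      by (auto simp: mixed_def)
    define u where "u = l ((\<i> - 1) * e)"
    note eqs = affine_form_sq[OF f(1), of c e, folded u_def]
    have fg: "f (c + e) \<in> gauss" "f (c + \<i> * e) \<in> gauss" using * f by auto
    have u: "u \<in> gauss" using gauss_diff[OF fg(2) fg(1)] eqs by simp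
    have uo: "u \<notin> evens"
    proof
      assume "u \<in> evens"
      then have "f (c + \<i> * e) \<in> evens" using eqs evens_add[of "f (c + e)" u] * f(3) by simp
      then show False using * f(4) by simp
    qed
    have geq: "g (c - e) = g (c + e) + u" using eqs by (simp add: g_def add_divide_distrib)
    have gg: "g (c + e) \<in> gauss" "g (c - e) \<in> gauss" using gU * by auto
    have "g (c + e) \<in> evens \<longleftrightarrow> g (c - e) \<notin> evens"
      using geq uo evens_diff[of "g (c - e)" "g (c + e)"] odd_diff[OF gg(2) gg(1)] by auto
    then consider "c + e \<in> A" "c - e \<in> B" | "c + e \<in> B" "c - e \<in> A"
      using * by (auto simp: A_def B_def)
    then show "Q \<in> (\<lambda>(x, y). {x, y, apex x y, apex y x}) ` edges A B V"
    proof cases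
      case 1
      then show ?thesis using * 
        by (intro image_eqI[of _ _ "(c + e, c - e)"]) (auto simp: edges_def apex_sq sq_def)
    next
      case 2
      then show ?thesis using * 
        by (intro image_eqI[of _ _ "(c - e, c + e)"]) (auto simp: edges_def apex_sq sq_def)
    qed
  qed
  then have "card (mixed U V) \<le> card (edges A B V)"
    by (rule surj_card_le[OF finE])
  then show ?thesis using AB that by blast
qed

section \<open>Integral forms on finite sets of complex numbers\<close>

lemma rational_functional:
  fixes r :: real
  assumes "r \<noteq> 0"
  obtains g :: "real \<Rightarrow> rat" where "\<And>x y. g (x + y) = g x + g y" "g r = 1"
proof -
  interpret vector_space_pair "\<lambda>(q::rat) (x::real). of_rat q * x" "\<lambda>(q::rat) (x::rat). q * x"
    by unfold_locales (simp_all add: of_rat_add of_rat_mult algebra_simps)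
  have "vs1.independent {r}"
    using assms vs1.dependent_single by auto
  then obtain g where g: "Vector_Spaces.linear (\<lambda>(q::rat) (x::real). of_rat q * x) (\<lambda>(q::rat) (x::rat). q * x) g"
      "\<forall>x\<in>{r}. g x = (\<lambda>_. 1) x"
    using linear_independent_extend[of "{r}" "\<lambda>_. 1"] by blast
  have "g (x + y) = g x + g y" for x y
    using g(1) by (simp add: Vector_Spaces.linear_iff)
  then show ?thesis using that g(2) by auto
qed

lemma common_denominator:
  fixes X :: "rat set"
  assumes "finite X"
  obtains N :: int where "N > 0" "\<And>x. x \<in> X \<Longrightarrow> of_int N * x \<in> \<int>"
proof -
  have "\<exists>N::int. N > 0 \<and> (\<forall>x\<in>X. of_int N * x \<in> \<int>)" using assms
  proof (induction rule: finite_induct)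
    case empty
    show ?case by (rule exI[of _ 1]) simp
  next
    case (insert x X)
    then obtain N :: int where N: "N > 0" "\<forall>x\<in>X. of_int N * x \<in> \<int>" by blast
    obtain a b where ab: "b > 0" "x = Fract a b" by (cases x) auto
    have "of_int (N * b) * x = of_int (N * a)"
      using ab by (simp add: Fract_of_int_quotient)
    then have "of_int (N * b) * x \<in> \<int>" by (metis Ints_of_int)
    moreover have "of_int (N * b) * y \<in> \<int>" if "y \<in> X" for y
    proof -
      have "of_int (N * b) * y = of_int b * (of_int N * y)" by simp
      then show ?thesis using N(2) that by (metis Ints_mult Ints_of_int)
    qed
    ultimately show ?case using N(1) ab(1) by (intro exI[of _ "N * b"]) auto
  qed
  then show ?thesis using that by blast
qed

lemma gauss_norm: "x \<in> gauss \<Longrightarrow> \<exists>n. (cmod x)\<^sup>2 = of_nat n"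
proof -
  assume "x \<in> gauss"
  then obtain a b where ab: "Re x = of_int a" "Im x = of_int b"
    by (auto simp: gauss_def elim!: Ints_cases)
  have "(cmod x)\<^sup>2 = of_nat (nat (a\<^sup>2 + b\<^sup>2))"
    by (simp add: cmod_power2 ab)
  then show ?thesis by blast
qed

lemma affine_form_scale: "affine_form f l \<Longrightarrow> affine_form (\<lambda>z. f z / k) (\<lambda>z. l z / k)"
  by (simp add: affine_form_def add_divide_distrib)

text \<open>One functional acts on real and imaginary parts alike, which makes the form commute with
  \<open>\<i>\<close>. It takes the value 1 on a nonzero coordinate of \<open>q - p\<close>, so
  \<open>p\<close> and \<open>q\<close> stay separated, and a common denominator clears the finitely
  many values.\<close>

lemma integral_form_exists:
  assumes fin: "finite P" and pq: "p \<in> P" "q \<in> P" "p \<noteq> q"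
  obtains f l where "affine_form f l" "f ` P \<subseteq> gauss" "f p = 0" "f q \<noteq> 0"
proof -
  obtain r where r: "r \<noteq> 0" "r = Re (q - p) \<or> r = Im (q - p)"
    using pq(3) by (metis complex_eq_iff minus_complex.sel right_minus_eq)
  obtain g where g: "\<And>x y. g (x + y) = g x + g y" "g r = (1::rat)"
    using rational_functional[OF r(1)] by blast
  have g0: "g 0 = 0" using g(1)[of 0 0] by simp
  have gm: "g (- x) = - g x" for x using g(1)[of x "- x"] g0 by (simp add: eq_neg_iff_add_eq_0 add.commute)
  define X where "X = (\<lambda>z. g (Re (z - p))) ` P \<union> (\<lambda>z. g (Im (z - p))) ` P"
  have "finite X" using fin by (simp add: X_def)
  then obtain N :: int where N: "N > 0" "\<And>x. x \<in> X \<Longrightarrow> of_int N * x \<in> \<int>"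
    using common_denominator by blast
  define l where "l = (\<lambda>z. of_int N * Complex (of_rat (g (Re z))) (of_rat (g (Im z))))"
  define f where "f = (\<lambda>z. l (z - p))"
  have la: "l (a + b) = l a + l b" for a b
    by (simp add: l_def g(1) of_rat_add complex_eq_iff algebra_simps)
  have li: "l (\<i> * a) = \<i> * l a" for a
    by (simp add: l_def gm complex_eq_iff of_rat_minus)
  have "f (a + b) = f a + l b" for a b
    using la[of "a - p" b] by (simp add: f_def algebra_simps)
  then have aff: "affine_form f l" using li by (simp add: affine_form_def)
  have int: "of_int N * (of_rat x :: real) \<in> \<int>" if xX: "x \<in> X" for x
  proof -
    obtain k where "of_int N * x = of_int k" using N(2)[OF xX] by (auto elim: Ints_cases)
    then have "(of_rat (of_int N * x) :: real) = of_int k" by simp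
    then show ?thesis by (simp add: of_rat_mult)
  qed
  have "f ` P \<subseteq> gauss"
    using int by (auto simp: f_def l_def gauss_def X_def)
  moreover have "f p = 0" by (simp add: f_def l_def g0 complex_eq_iff)
  moreover have "f q \<noteq> 0"
    using r(2) g(2) N(1) by (auto simp: f_def l_def complex_eq_iff)
  ultimately show ?thesis using that aff by blast
qed

text \<open>A form with only even values can be divided by \<open>1 + \<i>\<close>. Each division
  halves the squared modulus at \<open>q\<close>, a positive integer, so an odd value finally
  appears; \<open>p\<close> has value 0 and stays even throughout.\<close>

lemma parity_split_exists:
  assumes fin: "finite P" and card: "card P \<ge> 2"
  obtains U V where "parity_split P U V" "U \<noteq> {}" "V \<noteq> {}"
proof -
  have "\<not> is_singleton P" "P \<noteq> {}" using card by (auto simp: is_singleton_altdef)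
  then obtain p q where pq: "p \<in> P" "q \<in> P" "p \<noteq> q"
    by (metis is_singletonI' )
  have step: "\<exists>f l. affine_form f l \<and> f ` P \<subseteq> gauss \<and> f p = 0 \<and> \<not> f ` P \<subseteq> evens"
    if "affine_form f l" "f ` P \<subseteq> gauss" "f p = 0" "f q \<noteq> 0" "(cmod (f q))\<^sup>2 = of_nat n" for f l n
    using that
  proof (induction n arbitrary: f l rule: less_induct)
    case (less n)
    show ?case
    proof (cases "f ` P \<subseteq> evens")
      case False
      then show ?thesis using less.prems by blast
    next
      case True
      define g where "g = (\<lambda>z. f z / (1 + \<i>))"
      have g: "affine_form g (\<lambda>z. l z / (1 + \<i>))" "g ` P \<subseteq> gauss" "g p = 0" "g q \<noteq> 0"
        using less.prems True affine_form_scale[OF less.prems(1), of "1 + \<i>"]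
        by (auto simp: g_def evens_def image_subset_iff)
      obtain m where m: "(cmod (g q))\<^sup>2 = of_nat m"
        using gauss_norm[of "g q"] g(2) pq by auto
      have "(cmod (1 + \<i>))\<^sup>2 = 2" by (simp add: cmod_power2)
      then have "2 * (cmod (g q))\<^sup>2 = (cmod (f q))\<^sup>2"
        by (simp add: g_def norm_divide power_divide)
      then have "real (2 * m) = real n" using m less.prems(5) by simp
      then have "n = 2 * m" by linarith
      moreover have "m > 0" using m g(4) by (cases m) auto
      ultimately show ?thesis using less.IH[OF _ g m] by simp
    qed
  qed
  obtain f0 l0 where f0: "affine_form f0 l0" "f0 ` P \<subseteq> gauss" "f0 p = 0" "f0 q \<noteq> 0"
    using integral_form_exists[OF fin pq] by blast
  obtain n where n: "(cmod (f0 q))\<^sup>2 = of_nat n"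
    using gauss_norm[of "f0 q"] f0(2) pq by auto
  obtain f l where f: "affine_form f l" "f ` P \<subseteq> gauss" "f p = 0" "\<not> f ` P \<subseteq> evens"
    using step[OF f0 n] by blast
  define U where "U = {x \<in> P. f x \<in> evens}"
  define V where "V = {x \<in> P. f x \<notin> evens}"
  have "parity_split P U V" unfolding parity_split_def U_def V_def using f by blast
  moreover have "p \<in> U" using pq f by (simp add: U_def evens_def)
  moreover have "V \<noteq> {}" using f(4) by (auto simp: V_def)
  ultimately show ?thesis using that by blast
qed

section \<open>Edge graphs in coordinates\<close>

definition lk :: "complex \<Rightarrow> complex \<Rightarrow> complex" where
  "lk x y = y + \<i> * x"

definition ledges :: "complex set \<Rightarrow> complex set \<Rightarrow> complex set \<Rightarrow> (complex \<times> complex) set" where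
  "ledges A B Z = {(x, y). x \<in> A \<and> y \<in> B \<and> lk x y \<in> Z \<and> lk y x \<in> Z}"

definition coords :: "complex \<Rightarrow> complex \<Rightarrow> complex set \<Rightarrow> complex set" where
  "coords c e A = {t. c + e * t \<in> A}"

text \<open>Coordinates are scaled by \<open>1 + \<i>\<close> here, so that \<^const>\<open>lk\<close> records the apices without denominators.\<close>

definition acoords :: "complex \<Rightarrow> complex \<Rightarrow> complex set \<Rightarrow> complex set" where
  "acoords c e V = {t. c + e * (t / (1 + \<i>)) \<in> V}"

lemma coords_eq_image: "e \<noteq> 0 \<Longrightarrow> coords c e A = (\<lambda>z. (z - c) / e) ` A"
proof (intro set_eqI iffI)
  fix t assume "e \<noteq> 0" "t \<in> coords c e A"
  then show "t \<in> (\<lambda>z. (z - c) / e) ` A"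
    by (intro image_eqI[of _ _ "c + e * t"]) (auto simp: coords_def)
qed (auto simp: coords_def)

lemma card_coords: "e \<noteq> 0 \<Longrightarrow> card (coords c e A) = card A"
  and finite_coords: "e \<noteq> 0 \<Longrightarrow> finite A \<Longrightarrow> finite (coords c e A)"
proof -
  assume e: "e \<noteq> 0"
  have "inj_on (\<lambda>z. (z - c) / e) A" using e by (auto simp: inj_on_def)
  then show "card (coords c e A) = card A"
    by (simp add: coords_eq_image[OF e] card_image)
  show "finite A \<Longrightarrow> finite (coords c e A)"
    by (simp add: coords_eq_image[OF e])
qed

lemma acoords_eq: "acoords c e V = (\<lambda>t. (1 + \<i>) * t) ` coords c e V"
proof (intro set_eqI iffI)
  fix t assume "t \<in> acoords c e V"
  then show "t \<in> (\<lambda>t. (1 + \<i>) * t) ` coords c e V"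
    by (intro image_eqI[of _ _ "t / (1 + \<i>)"]) (auto simp: acoords_def coords_def)
qed (auto simp: acoords_def coords_def)

lemma card_acoords: "e \<noteq> 0 \<Longrightarrow> card (acoords c e V) = card V"
  and finite_acoords: "e \<noteq> 0 \<Longrightarrow> finite V \<Longrightarrow> finite (acoords c e V)"
  by (auto simp: acoords_eq card_image inj_on_def card_coords finite_coords)

lemma apex_coords: "apex (c + e * s) (c + e * t) = c + e * (lk s t / (1 + \<i>))"
proof -
  have "apex (c + e * s) (c + e * t) = ((1 + \<i>) * c + e * lk s t) / (1 + \<i>)"
    by (simp add: apex_def lk_def algebra_simps)
  also have "\<dots> = c + e * (lk s t / (1 + \<i>))" by (simp add: add_divide_distrib)
  finally show ?thesis .
qed

lemma card_ledges:
  assumes "e \<noteq> 0"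
  shows "card (edges A B V) = card (ledges (coords c e A) (coords c e B) (acoords c e V))"
proof -
  let ?h = "\<lambda>z. (z - c) / e"
  have eq: "c + e * ?h z = z" for z using assms by simp
  have ap: "apex x y \<in> V \<longleftrightarrow> lk (?h x) (?h y) \<in> acoords c e V" for x y
    using apex_coords[of c e "?h x" "?h y"] unfolding eq by (simp add: acoords_def)
  have "ledges (coords c e A) (coords c e B) (acoords c e V) = (\<lambda>(x, y). (?h x, ?h y)) ` edges A B V"
    unfolding coords_eq_image[OF assms] edges_def ledges_def using ap by auto
  moreover have "inj_on (\<lambda>(x, y). (?h x, ?h y)) (edges A B V)"
    using assms by (auto simp: inj_on_def)
  ultimately show ?thesis by (simp add: card_image)
qed

lemma edges_coords_iff:
  "(c + e * s, c + e * t) \<in> edges A B V \<longleftrightarrow> (s, t) \<in> ledges (coords c e A) (coords c e B) (acoords c e V)"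
  by (auto simp: edges_def ledges_def coords_def acoords_def apex_coords)

definition ind :: "complex set \<Rightarrow> complex \<Rightarrow> int" where
  "ind Z z = (if z \<in> Z then 1 else 0)"

lemma ind_cases: "ind Z z = 0 \<or> ind Z z = 1"
  by (simp add: ind_def)

lemma ind_le: "0 \<le> ind Z z" "ind Z z \<le> 1"
  by (simp_all add: ind_def)

text \<open>Edge counting becomes a quadratic polynomial in 0/1 unknowns, to be bounded under the
  linear constraint of \<open>sum_ind_le_card\<close>.\<close>

lemma card_ledges_sum:
  assumes "finite A" "finite B"
  shows "int (card (ledges A B Z)) = (\<Sum>x\<in>A. \<Sum>y\<in>B. ind Z (lk x y) * ind Z (lk y x))"
proof -
  have "ledges A B Z = {p \<in> A \<times> B. lk (fst p) (snd p) \<in> Z \<and> lk (snd p) (fst p) \<in> Z}"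
    by (auto simp: ledges_def)
  then have "int (card (ledges A B Z)) =
      (\<Sum>p\<in>A \<times> B. if lk (fst p) (snd p) \<in> Z \<and> lk (snd p) (fst p) \<in> Z then 1 else 0)"
    using assms by (simp add: sum.If_cases Int_def)
  also have "\<dots> = (\<Sum>p\<in>A \<times> B. ind Z (lk (fst p) (snd p)) * ind Z (lk (snd p) (fst p)))"
    by (intro sum.cong) (auto simp: ind_def)
  finally show ?thesis by (simp add: sum.cartesian_product case_prod_beta)
qed

lemma sum_ind_le_card:
  assumes "finite Z" "finite L"
  shows "(\<Sum>z\<in>L. ind Z z) \<le> int (card Z)"
proof -
  have "(\<Sum>z\<in>L. ind Z z) = int (card (L \<inter> Z))"
    using assms(2) by (simp add: ind_def sum.If_cases Int_def)
  also have "\<dots> \<le> int (card Z)" using assms(1) by (intro of_nat_mono card_mono) auto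
  finally show ?thesis .
qed

lemma lk_Complex [simp]: "lk (Complex a b) (Complex c d) = Complex (c - b) (d + a)"
  by (simp add: lk_def complex_eq_iff)

section \<open>Closing pairs over the 3 by 3 grid and its relatives\<close>

abbreviation unit_sq :: "complex set" where
  "unit_sq \<equiv> {Complex 1 0, Complex (-1) 0, Complex 0 1, Complex 0 (-1)}"

text \<open>The digits in the names of this family count the points of the class and the squares
  inside it. Here the class is \<open>unit_sq\<close> with its centre and two adjacent corners. Once
  the four indicators on \<open>unit_sq\<close> are fixed, every product in the edge count has a
  constant factor, and each of the sixteen cases is linear arithmetic.\<close>

lemma bound_73a:
  assumes Z: "finite Z" "card Z \<le> k" "k \<in> {7, 8}"
  shows "card (ledges {Complex 0 0, Complex 1 1, Complex 1 (-1)} unit_sq Z) \<le> k + 2"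
proof -
  define w where "w a b = ind Z (Complex a b)" for a b
  note c = ind_cases[of Z "Complex _ _", folded w_def] and le = ind_le[of Z "Complex _ _", folded w_def]
  \<comment> \<open>The sum runs over all points that occur as a scaled apex in this graph.\<close>
  have s: "w 1 0 + w (-1) 0 + w 0 1 + w 0 (-1) + w (-2) 1 + w (-1) 2 + w 1 (-2) + w 1 2 + w 2 (-1) + w 2 1 \<le> int k"
    using sum_ind_le_card[OF Z(1), of "unit_sq \<union> {Complex (-2) 1, Complex (-1) 2, Complex 1 (-2), Complex 1 2, Complex 2 (-1), Complex 2 1}"] Z(2)
    by (simp add: w_def)
  have "int (card (ledges {Complex 0 0, Complex 1 1, Complex 1 (-1)} unit_sq Z)) \<le> int k + 2"
    using s Z(3) c[of 1 0] c[of "-1" 0] c[of 0 1] c[of 0 "-1"]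
      le[of "-2" 1] le[of "-1" 2] le[of 1 "-2"] le[of 1 2] le[of 2 "-1"] le[of 2 1]
    by (simp add: card_ledges_sum flip: w_def) (elim disjE; simp)
  then show ?thesis by linarith
qed

lemma bound_73b:
  assumes Z: "finite Z" "card Z \<le> k" "k \<in> {7, 8}"
  shows "card (ledges {Complex 0 0, Complex 1 1, Complex (-1) (-1)} unit_sq Z) \<le> k + 2"
proof -
  define w where "w a b = ind Z (Complex a b)" for a b
  note c = ind_cases[of Z "Complex _ _", folded w_def] and le = ind_le[of Z "Complex _ _", folded w_def]
  have s: "w 1 0 + w (-1) 0 + w 0 1 + w 0 (-1) + w (-2) (-1) + w (-2) 1 + w (-1) (-2) + w (-1) 2 + w 1 (-2) + w 1 2 + w 2 (-1) + w 2 1 \<le> int k"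
    using sum_ind_le_card[OF Z(1), of "unit_sq \<union> {Complex (-2) (-1), Complex (-2) 1, Complex (-1) (-2), Complex (-1) 2, Complex 1 (-2), Complex 1 2, Complex 2 (-1), Complex 2 1}"] Z(2)
    by (simp add: w_def)
  have "int (card (ledges {Complex 0 0, Complex 1 1, Complex (-1) (-1)} unit_sq Z)) \<le> int k + 2"
    using s Z(3) c[of 1 0] c[of "-1" 0] c[of 0 1] c[of 0 "-1"]
      le[of "-2" "-1"] le[of "-2" 1] le[of "-1" "-2"] le[of "-1" 2] le[of 1 "-2"] le[of 1 2] le[of 2 "-1"] le[of 2 1]
    by (simp add: card_ledges_sum flip: w_def) (elim disjE; simp)
  then show ?thesis by linarith
qed

lemma bound_84a:
  assumes Z: "finite Z" "card Z \<le> k" "k \<in> {7, 8, 9}"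
  shows "card (ledges {Complex 0 0, Complex 1 1, Complex 1 (-1), Complex (-1) 1} unit_sq Z) \<le> k + 4"
proof -
  define w where "w a b = ind Z (Complex a b)" for a b
  note c = ind_cases[of Z "Complex _ _", folded w_def] and le = ind_le[of Z "Complex _ _", folded w_def]
  have s: "w 1 0 + w (-1) 0 + w 0 1 + w 0 (-1) + w (-2) (-1) + w (-2) 1 + w (-1) (-2) + w (-1) 2 + w 1 (-2) + w 1 2 + w 2 (-1) + w 2 1 \<le> int k"
    using sum_ind_le_card[OF Z(1), of "unit_sq \<union> {Complex (-2) (-1), Complex (-2) 1, Complex (-1) (-2), Complex (-1) 2, Complex 1 (-2), Complex 1 2, Complex 2 (-1), Complex 2 1}"] Z(2)
    by (simp add: w_def)
  have "int (card (ledges {Complex 0 0, Complex 1 1, Complex 1 (-1), Complex (-1) 1} unit_sq Z)) \<le> int k + 4"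
    using s Z(3) c[of 1 0] c[of "-1" 0] c[of 0 1] c[of 0 "-1"]
      le[of "-2" "-1"] le[of "-2" 1] le[of "-1" "-2"] le[of "-1" 2] le[of 1 "-2"] le[of 1 2] le[of 2 "-1"] le[of 2 1]
    by (simp add: card_ledges_sum flip: w_def) (elim disjE; simp)
  then show ?thesis by linarith
qed

lemma bound_84b:
  assumes Z: "finite Z" "card Z \<le> k" "k \<in> {7, 8, 9}"
  shows "card (ledges {Complex 0 0, Complex 1 1, Complex 1 (-1), Complex 2 0} unit_sq Z) \<le> k + 4"
proof -
  define w where "w a b = ind Z (Complex a b)" for a b
  note c = ind_cases[of Z "Complex _ _", folded w_def] and le = ind_le[of Z "Complex _ _", folded w_def]
  have s: "w 1 0 + w (-1) 0 + w 0 1 + w 0 (-1) + w (-2) 1 + w (-1) 2 + w 0 3 + w 1 (-2) + w 1 2 + w 2 (-1) + w 2 1 + w 3 0 \<le> int k"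
    using sum_ind_le_card[OF Z(1), of "unit_sq \<union> {Complex (-2) 1, Complex (-1) 2, Complex 0 3, Complex 1 (-2), Complex 1 2, Complex 2 (-1), Complex 2 1, Complex 3 0}"] Z(2)
    by (simp add: w_def)
  \<comment> \<open>The point \<open>Complex 2 0\<close> brings in two products without a factor on
    \<open>unit_sq\<close>. Fixing the indicators at \<open>Complex 1 2\<close> and
    \<open>Complex (-1) 2\<close> as well makes these linear.\<close>
  have "int (card (ledges {Complex 0 0, Complex 1 1, Complex 1 (-1), Complex 2 0} unit_sq Z)) \<le> int k + 4"
    using s Z(3) c[of 1 0] c[of "-1" 0] c[of 0 1] c[of 0 "-1"] c[of 1 2] c[of "-1" 2]
      le[of "-2" 1] le[of 0 3] le[of 1 "-2"] le[of 2 "-1"] le[of 2 1] le[of 3 0]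
    by (simp add: card_ledges_sum flip: w_def) (elim disjE; simp)
  then show ?thesis by linarith
qed

text \<open>The full grid. If \<open>Z\<close> contains \<open>unit_sq\<close>, the centre
  contributes 4 edges and each further point of \<open>Z\<close> at most 2, which makes 12 for
  \<open>k = 8\<close>.\<close>

lemma bound_96:
  assumes Z: "finite Z" "card Z \<le> k" "k \<in> {7, 8}"
  shows "card (ledges {Complex 0 0, Complex 1 1, Complex 1 (-1), Complex (-1) 1, Complex (-1) (-1)} unit_sq Z) \<le> k + 4"
proof -
  define w where "w a b = ind Z (Complex a b)" for a b
  note c = ind_cases[of Z "Complex _ _", folded w_def] and le = ind_le[of Z "Complex _ _", folded w_def]
  have s: "w 1 0 + w (-1) 0 + w 0 1 + w 0 (-1) + w (-2) (-1) + w (-2) 1 + w (-1) (-2) + w (-1) 2 + w 1 (-2) + w 1 2 + w 2 (-1) + w 2 1 \<le> int k"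
    using sum_ind_le_card[OF Z(1), of "unit_sq \<union> {Complex (-2) (-1), Complex (-2) 1, Complex (-1) (-2), Complex (-1) 2, Complex 1 (-2), Complex 1 2, Complex 2 (-1), Complex 2 1}"] Z(2)
    by (simp add: w_def)
  have "int (card (ledges {Complex 0 0, Complex 1 1, Complex 1 (-1), Complex (-1) 1, Complex (-1) (-1)} unit_sq Z)) \<le> int k + 4"
    using s Z(3) c[of 1 0] c[of "-1" 0] c[of 0 1] c[of 0 "-1"]
      le[of "-2" "-1"] le[of "-2" 1] le[of "-1" "-2"] le[of "-1" 2] le[of 1 "-2"] le[of 1 2] le[of 2 "-1"] le[of 2 1]
    by (simp add: card_ledges_sum flip: w_def) (elim disjE; simp)
  then show ?thesis by linarith
qed

text \<open>The grid with one corner moved to a point that forms a square with the centre and two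
  other corners. The values 11 and 13 of \<open>2 * k - 3\<close> are what the class sizes 9+7 and
  9+8 can afford.\<close>

lemma bound_95a:
  assumes Z: "finite Z" "card Z \<le> k" "k \<in> {7, 8}"
  shows "card (ledges {Complex 0 0, Complex 1 1, Complex 1 (-1), Complex (-1) 1, Complex 2 0} unit_sq Z) \<le> 2 * k - 3"
proof -
  define w where "w a b = ind Z (Complex a b)" for a b
  note c = ind_cases[of Z "Complex _ _", folded w_def] and le = ind_le[of Z "Complex _ _", folded w_def]
  have s: "w 1 0 + w (-1) 0 + w 0 1 + w 0 (-1) + w (-2) (-1) + w (-2) 1 + w (-1) (-2) + w (-1) 2 + w 0 3 + w 1 (-2) + w 1 2 + w 2 (-1) + w 2 1 + w 3 0 \<le> int k"
    using sum_ind_le_card[OF Z(1), of "unit_sq \<union> {Complex (-2) (-1), Complex (-2) 1, Complex (-1) (-2), Complex (-1) 2, Complex 0 3, Complex 1 (-2), Complex 1 2, Complex 2 (-1), Complex 2 1, Complex 3 0}"] Z(2)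
    by (simp add: w_def)
  have "int (card (ledges {Complex 0 0, Complex 1 1, Complex 1 (-1), Complex (-1) 1, Complex 2 0} unit_sq Z)) \<le> 2 * int k - 3"
    using s Z(3) c[of 1 0] c[of "-1" 0] c[of 0 1] c[of 0 "-1"] c[of 1 2] c[of "-1" 2]
      le[of "-2" "-1"] le[of "-2" 1] le[of "-1" "-2"] le[of 0 3] le[of 1 "-2"] le[of 2 "-1"] le[of 2 1] le[of 3 0]
    by (simp add: card_ledges_sum flip: w_def) (elim disjE; simp)
  then show ?thesis by linarith
qed

lemma bound_95b:
  assumes Z: "finite Z" "card Z \<le> k" "k \<in> {7, 8}"
  shows "card (ledges {Complex 0 0, Complex 1 1, Complex 1 (-1), Complex (-1) 1, Complex 0 2} unit_sq Z) \<le> 2 * k - 3"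
proof -
  define w where "w a b = ind Z (Complex a b)" for a b
  note c = ind_cases[of Z "Complex _ _", folded w_def] and le = ind_le[of Z "Complex _ _", folded w_def]
  have s: "w 1 0 + w (-1) 0 + w 0 1 + w 0 (-1) + w (-3) 0 + w (-2) (-1) + w (-2) 1 + w (-1) (-2) + w (-1) 2 + w 0 3 + w 1 (-2) + w 1 2 + w 2 (-1) + w 2 1 \<le> int k"
    using sum_ind_le_card[OF Z(1), of "unit_sq \<union> {Complex (-3) 0, Complex (-2) (-1), Complex (-2) 1, Complex (-1) (-2), Complex (-1) 2, Complex 0 3, Complex 1 (-2), Complex 1 2, Complex 2 (-1), Complex 2 1}"] Z(2)
    by (simp add: w_def)
  have "int (card (ledges {Complex 0 0, Complex 1 1, Complex 1 (-1), Complex (-1) 1, Complex 0 2} unit_sq Z)) \<le> 2 * int k - 3"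
    using s Z(3) c[of 1 0] c[of "-1" 0] c[of 0 1] c[of 0 "-1"] c[of 1 2] c[of "-1" 2]
      le[of "-3" 0] le[of "-2" "-1"] le[of "-2" 1] le[of "-1" "-2"] le[of 0 3] le[of 1 "-2"] le[of 2 "-1"] le[of 2 1]
    by (simp add: card_ledges_sum flip: w_def) (elim disjE; simp)
  then show ?thesis by linarith
qed

section \<open>Complete bipartite edge graphs containing a square\<close>

definition core :: "complex set" where
  "core = {Complex 0 0, Complex 2 0, Complex (-2) 0, Complex 0 2, Complex 0 (-2)}"

text \<open>The apices forced by joining \<open>y\<close> to \<open>\<plusminus>1\<close>, or \<open>x\<close> to \<open>\<plusminus>\<i>\<close>. They avoid
  \<^const>\<open>core\<close>, the apices of the pairs of \<open>\<plusminus>1\<close> and \<open>\<plusminus>\<i>\<close>, unless the point is one of six.\<close>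

definition ynbrs :: "complex \<Rightarrow> complex set" where
  "ynbrs y = {lk (Complex 1 0) y, lk (Complex (-1) 0) y, lk y (Complex 1 0), lk y (Complex (-1) 0)}"

definition xnbrs :: "complex \<Rightarrow> complex set" where
  "xnbrs x = {lk x (Complex 0 1), lk x (Complex 0 (-1)), lk (Complex 0 1) x, lk (Complex 0 (-1)) x}"

definition yspecial :: "complex set" where
  "yspecial = {Complex 2 1, Complex 2 (-1), Complex (-2) 1, Complex (-2) (-1), Complex 0 3, Complex 0 (-3)}"

definition xspecial :: "complex set" where
  "xspecial = {Complex 1 2, Complex 1 (-2), Complex (-1) 2, Complex (-1) (-2), Complex 3 0, Complex (-3) 0}"

text \<open>The sum recovers \<open>y\<close> from the bare set of its four apices; this is how
  points are told apart later.\<close>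

lemma ynbrs_props:
  assumes "y \<notin> unit_sq"
  shows "card (ynbrs y) = 4" "(\<Sum>z\<in>ynbrs y. z) = Complex 2 2 * y" "Complex 0 0 \<notin> ynbrs y"
    "y \<notin> yspecial \<Longrightarrow> ynbrs y \<inter> core = {}"
proof -
  obtain a b where y: "y = Complex a b" by (cases y)
  have ynbrs: "ynbrs y = {Complex a (b + 1), Complex a (b - 1), Complex (1 - b) a, Complex (- 1 - b) a}"
    by (simp add: ynbrs_def y insert_commute)
  have n: "\<not> (a = 1 \<and> b = 0)" "\<not> (a = -1 \<and> b = 0)" "\<not> (a = 0 \<and> b = 1)" "\<not> (a = 0 \<and> b = -1)"
    using assms unfolding y by simp_all
  have d: "Complex a (b + 1) \<noteq> Complex a (b - 1)" "Complex (1 - b) a \<noteq> Complex (- 1 - b) a" by simp_all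
  have d': "Complex a (b + 1) \<noteq> Complex (1 - b) a" "Complex a (b + 1) \<noteq> Complex (- 1 - b) a"
    "Complex a (b - 1) \<noteq> Complex (1 - b) a" "Complex a (b - 1) \<noteq> Complex (- 1 - b) a"
    using n by (simp, argo)+
  show "card (ynbrs y) = 4" unfolding ynbrs using d d' by simp
  show "(\<Sum>z\<in>ynbrs y. z) = Complex 2 2 * y" unfolding ynbrs using d d' by (simp add: y complex_eq_iff)
  show "Complex 0 0 \<notin> ynbrs y" unfolding ynbrs using n by auto
  show "y \<notin> yspecial \<Longrightarrow> ynbrs y \<inter> core = {}"
    unfolding ynbrs yspecial_def core_def unfolding y using n by (simp, smt (verit))
qed

lemma xnbrs_props:
  assumes "x \<notin> unit_sq"
  shows "card (xnbrs x) = 4" "(\<Sum>z\<in>xnbrs x. z) = Complex 2 2 * x" 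
    "x \<notin> xspecial \<Longrightarrow> xnbrs x \<inter> core = {}"
proof -
  obtain a b where x: "x = Complex a b" by (cases x)
  have xnbrs: "xnbrs x = {Complex (a + 1) b, Complex (a - 1) b, Complex (- b) (1 + a), Complex (- b) (a - 1)}"
    by (simp add: xnbrs_def x insert_commute)
  have n: "\<not> (a = 1 \<and> b = 0)" "\<not> (a = -1 \<and> b = 0)" "\<not> (a = 0 \<and> b = 1)" "\<not> (a = 0 \<and> b = -1)"
    using assms unfolding x by simp_all
  have d: "Complex (a + 1) b \<noteq> Complex (a - 1) b" "Complex (- b) (1 + a) \<noteq> Complex (- b) (a - 1)" by simp_all
  have d': "Complex (a + 1) b \<noteq> Complex (- b) (1 + a)" "Complex (a + 1) b \<noteq> Complex (- b) (a - 1)"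
    "Complex (a - 1) b \<noteq> Complex (- b) (1 + a)" "Complex (a - 1) b \<noteq> Complex (- b) (a - 1)"
    using n by (simp, argo)+
  show "card (xnbrs x) = 4" unfolding xnbrs using d d' by simp
  show "(\<Sum>z\<in>xnbrs x. z) = Complex 2 2 * x" unfolding xnbrs using d d' by (simp add: x complex_eq_iff)
  show "x \<notin> xspecial \<Longrightarrow> xnbrs x \<inter> core = {}"
    unfolding xnbrs xspecial_def core_def unfolding x using n by (simp, smt (verit))
qed

lemma card_core: "card core = 5" and finite_core: "finite core"
  by (simp_all add: core_def)

lemma core_disjoint_card:
  assumes "finite Z" "core \<subseteq> Z" "N \<subseteq> Z" "N \<inter> core = {}" "card N = 4"
  shows "9 \<le> card Z" "card Z \<le> 9 \<Longrightarrow> Z - core = N"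
proof -
  have "card (core \<union> N) = 9"
    using assms card_Un_disjoint[of core N] card_core finite_core finite_subset[OF assms(3,1)] by (simp add: Int_commute)
  then show 9: "9 \<le> card Z"
    using card_mono[of Z "core \<union> N"] assms by simp
  assume "card Z \<le> 9"
  then have "card Z = 9" using 9 by simp
  then have "core \<union> N = Z"
    using \<open>card (core \<union> N) = 9\<close> assms by (intro card_subset_eq) auto
  then show "Z - core = N" using assms(4) by blast
qed

text \<open>Each four-point set has to fill what \<open>core\<close> leaves of nine points, so the
  two are equal and their sums give \<open>p = q\<close>. The sum formula is the same on both sides
  of the graph, so a point of one side can also be compared with a point of the other.\<close>

lemma two_generic:
  assumes "finite Z" "card Z \<le> 9" "core \<subseteq> Z"
    and "N \<subseteq> Z" "N \<inter> core = {}" "card N = 4" "(\<Sum>z\<in>N. z) = Complex 2 2 * p"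
    and "N' \<subseteq> Z" "N' \<inter> core = {}" "card N' = 4" "(\<Sum>z\<in>N'. z) = Complex 2 2 * q"
  shows "p = q"
proof -
  have "N = N'"
    using core_disjoint_card(2)[OF assms(1,3,4,5,6,2)] core_disjoint_card(2)[OF assms(1,3,8,9,10,2)] by simp
  then have "Complex 2 2 * p = Complex 2 2 * q" using assms(7,11) by metis
  moreover have "Complex 2 2 \<noteq> 0" by (simp add: complex_eq_iff)
  ultimately show ?thesis by simp
qed

text \<open>All scaled apices of the complete bipartite graph between \<open>{1, -1, x}\<close> and
  \<open>{\<i>, -\<i>, y, y'}\<close>.\<close>

definition seed_set :: "complex \<Rightarrow> complex \<Rightarrow> complex \<Rightarrow> complex set" where
  "seed_set x y y' = core \<union> ynbrs y \<union> ynbrs y' \<union> xnbrs x \<union> {lk x y, lk y x, lk x y', lk y' x}"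

lemma seed_set_card: "\<forall>x\<in>xspecial. \<forall>y\<in>yspecial. \<forall>y'\<in>yspecial. y \<noteq> y' \<longrightarrow> 10 \<le> card (seed_set x y y')"
  by (simp add: xspecial_def yspecial_def seed_set_def core_def ynbrs_def xnbrs_def card_insert_if)

text \<open>If one of the three points is not special, its four apices together with
  \<open>core\<close> make nine. Otherwise only 6 * 6 * 5 triples remain, and the explicit check in
  \<open>seed_set_card\<close> gives ten.\<close>

lemma seed_K34:
  assumes Z: "finite Z" "seed_set x y y' \<subseteq> Z"
    and "x \<notin> unit_sq" "y \<notin> unit_sq" "y' \<notin> unit_sq" "y \<noteq> y'"
  shows "9 \<le> card Z" "x \<in> xspecial \<Longrightarrow> y \<in> yspecial \<Longrightarrow> y' \<in> yspecial \<Longrightarrow> 10 \<le> card Z"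
proof -
  have sub: "core \<subseteq> Z" "ynbrs y \<subseteq> Z" "ynbrs y' \<subseteq> Z" "xnbrs x \<subseteq> Z"
    using Z(2) by (auto simp: seed_set_def)
  show 10: "10 \<le> card Z" if "x \<in> xspecial" "y \<in> yspecial" "y' \<in> yspecial"
    using seed_set_card that assms(6) card_mono[OF Z] by (meson order_trans)
  show "9 \<le> card Z"
  proof (cases "x \<in> xspecial \<and> y \<in> yspecial \<and> y' \<in> yspecial")
    case True
    then show ?thesis using 10 by simp
  next
    case False
    then show ?thesis
      using core_disjoint_card(1)[OF Z(1) sub(1)] sub ynbrs_props[of y] ynbrs_props[of y'] xnbrs_props[of x] assms(3-5) by blast
  qed
qed

text \<open>Multiplication by \<open>\<i>\<close> exchanges the roles of the two vertex classes.\<close>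

lemma seed_set_rotate:
  "(\<lambda>z. \<i> * z) ` (core \<union> xnbrs x \<union> xnbrs x' \<union> ynbrs y \<union> {lk x y, lk y x, lk x' y, lk y x'}) = seed_set (\<i> * y) (\<i> * x) (\<i> * x')"
proof -
  have "\<i> * lk s t = lk (\<i> * s) (\<i> * t)" for s t by (simp add: lk_def algebra_simps)
  moreover have "\<i> * Complex p q = Complex (- q) p" for p q by (simp add: complex_eq_iff)
  ultimately show ?thesis
    by (simp add: seed_set_def core_def ynbrs_def xnbrs_def image_Un insert_commute Un_ac del: lk_Complex)
qed

lemma unit_sq_rotate: "\<i> * t \<in> unit_sq \<longleftrightarrow> t \<in> unit_sq"
  and xspecial_rotate: "y \<in> yspecial \<Longrightarrow> \<i> * y \<in> xspecial"
  and yspecial_rotate: "x \<in> xspecial \<Longrightarrow> \<i> * x \<in> yspecial"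
  by (cases t; force simp: complex_eq_iff) (auto simp: xspecial_def yspecial_def complex_eq_iff)

definition seed_set' :: "complex \<Rightarrow> complex \<Rightarrow> complex \<Rightarrow> complex set" where
  "seed_set' x x' y = core \<union> xnbrs x \<union> xnbrs x' \<union> ynbrs y \<union> {lk x y, lk y x, lk x' y, lk y x'}"

lemma seed_K43:
  assumes Z: "finite Z" "seed_set' x x' y \<subseteq> Z"
    and "x \<notin> unit_sq" "x' \<notin> unit_sq" "y \<notin> unit_sq" "x \<noteq> x'"
  shows "9 \<le> card Z" "x \<in> xspecial \<Longrightarrow> x' \<in> xspecial \<Longrightarrow> y \<in> yspecial \<Longrightarrow> 10 \<le> card Z"
proof -
  let ?Z = "(\<lambda>z. \<i> * z) ` Z"
  have c: "card ?Z = card Z" by (rule card_image) (simp add: inj_on_def)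
  have "seed_set (\<i> * y) (\<i> * x) (\<i> * x') \<subseteq> ?Z"
    using Z(2) unfolding seed_set_rotate[symmetric] seed_set'_def by (rule image_mono)
  note * = seed_K34[OF _ this]
  show "9 \<le> card Z" using *(1) assms by (simp add: c unit_sq_rotate del: insert_iff)
  show "10 \<le> card Z" if "x \<in> xspecial" "x' \<in> xspecial" "y \<in> yspecial"
    using *(2) that assms by (simp add: c unit_sq_rotate xspecial_rotate yspecial_rotate del: insert_iff)
qed

text \<open>With at most nine points in \<open>Z\<close>, two nonspecial points among the four would
  coincide by \<open>two_generic\<close>. So three are special, and the graph on them already forces
  ten points.\<close>

lemma seed_K44:
  assumes Z: "finite Z" "seed_set x y y' \<subseteq> Z" "seed_set x' y y' \<subseteq> Z"
    and u: "x \<notin> unit_sq" "x' \<notin> unit_sq" "y \<notin> unit_sq" "y' \<notin> unit_sq"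
    and d: "x \<noteq> x'" "y \<noteq> y'" "x \<noteq> y" "x \<noteq> y'" "x' \<noteq> y" "x' \<noteq> y'"
  shows "10 \<le> card Z"
proof (rule ccontr)
  assume "\<not> 10 \<le> card Z"
  then have k: "card Z \<le> 9" by simp
  have sub: "core \<subseteq> Z" "ynbrs y \<subseteq> Z" "ynbrs y' \<subseteq> Z" "xnbrs x \<subseteq> Z" "xnbrs x' \<subseteq> Z"
    using Z(2,3) by (auto simp: seed_set_def)
  have sub': "seed_set' x x' y \<subseteq> Z" "seed_set' x x' y' \<subseteq> Z"
    using Z(2,3) by (auto simp: seed_set_def seed_set'_def)
  note g = two_generic[OF Z(1) k sub(1)]
  have "y \<in> yspecial \<or> y' \<in> yspecial" "x \<in> xspecial \<or> x' \<in> xspecial"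
    "x \<in> xspecial \<or> y \<in> yspecial" "x \<in> xspecial \<or> y' \<in> yspecial" "x' \<in> xspecial \<or> y \<in> yspecial" "x' \<in> xspecial \<or> y' \<in> yspecial"
    using g[OF sub(2) _ _ _ sub(3)] g[OF sub(4) _ _ _ sub(5)] g[OF sub(4) _ _ _ sub(2)] g[OF sub(4) _ _ _ sub(3)]
      g[OF sub(5) _ _ _ sub(2)] g[OF sub(5) _ _ _ sub(3)]
      ynbrs_props[OF u(3)] ynbrs_props[OF u(4)] xnbrs_props[OF u(1)] xnbrs_props[OF u(2)] d by blast+
  then consider "y \<in> yspecial" "y' \<in> yspecial" "x \<in> xspecial" | "y \<in> yspecial" "y' \<in> yspecial" "x' \<in> xspecial"
    | "x \<in> xspecial" "x' \<in> xspecial" "y \<in> yspecial" | "x \<in> xspecial" "x' \<in> xspecial" "y' \<in> yspecial" by blast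
  then have "10 \<le> card Z"
    using seed_K34(2)[OF Z(1,2) u(1,3,4) d(2)] seed_K34(2)[OF Z(1,3) u(2,3,4) d(2)]
      seed_K43(2)[OF Z(1) sub'(1) u(1,2,3) d(1)] seed_K43(2)[OF Z(1) sub'(2) u(1,2,4) d(1)]
    by cases auto
  then show False using k by simp
qed

lemma mult_units: "e * Complex 1 0 = e" "e * Complex (-1) 0 = - e" "e * Complex 0 1 = \<i> * e" "e * Complex 0 (-1) = - (\<i> * e)"
  "e * Complex 0 0 = 0"
  by (simp_all add: complex_eq_iff)

lemma complex_units: "Complex 1 0 = 1" "Complex (-1) 0 = -1" "Complex 0 1 = \<i>" "Complex 0 (-1) = - \<i>"
  by (simp_all add: complex_eq_iff)

lemma coords_sq: "e \<noteq> 0 \<Longrightarrow> coords c e (sq c e) = unit_sq"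
  by (simp add: coords_eq_image sq_def complex_units insert_commute)

lemma card_ge_2E:
  assumes "2 \<le> card S"
  obtains x y where "x \<in> S" "y \<in> S" "x \<noteq> y"
proof -
  have "finite S" using assms by (metis card.infinite not_numeral_le_zero)
  then show ?thesis using assms card_le_Suc0_iff_eq[of S] that by (metis One_nat_def Suc_1 not_less_eq_eq)
qed

text \<open>Normal form of a complete graph around a square: the square becomes
  \<open>unit_sq\<close>, and \<open>S\<close> and \<open>T\<close> collect the remaining points of
  the two sides.\<close>

lemma complete_seed:
  assumes e: "e \<noteq> 0" and AB: "A \<inter> B = {}" and full: "A \<times> B \<subseteq> edges A B V"
    and mem: "c + e \<in> A" "c - e \<in> A" "c + \<i> * e \<in> B" "c - \<i> * e \<in> B"
  defines "S \<equiv> coords c e A - {Complex 1 0, Complex (-1) 0}" and "T \<equiv> coords c e B - {Complex 0 1, Complex 0 (-1)}"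
  shows "finite A \<Longrightarrow> card S + 2 = card A" "finite B \<Longrightarrow> card T + 2 = card B"
    "x \<in> S \<Longrightarrow> x \<notin> unit_sq" "y \<in> T \<Longrightarrow> y \<notin> unit_sq" "S \<inter> T = {}"
    "x \<in> S \<Longrightarrow> y \<in> T \<Longrightarrow> y' \<in> T \<Longrightarrow> seed_set x y y' \<subseteq> acoords c e V"
proof -
  have A: "Complex 1 0 \<in> coords c e A" "Complex (-1) 0 \<in> coords c e A"
    and B: "Complex 0 1 \<in> coords c e B" "Complex 0 (-1) \<in> coords c e B"
    using mem by (simp_all add: coords_def mult_units)
  have disj: "coords c e A \<inter> coords c e B = {}" using AB by (auto simp: coords_def)
  have lk: "lk s t \<in> acoords c e V \<and> lk t s \<in> acoords c e V" if "s \<in> coords c e A" "t \<in> coords c e B" for s t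
  proof -
    have "(c + e * s, c + e * t) \<in> edges A B V" using that full by (auto simp: coords_def)
    then show ?thesis unfolding edges_coords_iff by (simp add: ledges_def)
  qed
  show "finite A \<Longrightarrow> card S + 2 = card A"
    using A card_coords[OF e, of c A] card_mono[of "coords c e A" "{Complex 1 0, Complex (-1) 0}"] finite_coords[OF e, of A c]
    by (simp add: S_def card_Diff_subset)
  show "finite B \<Longrightarrow> card T + 2 = card B"
    using B card_coords[OF e, of c B] card_mono[of "coords c e B" "{Complex 0 1, Complex 0 (-1)}"] finite_coords[OF e, of B c]
    by (simp add: T_def card_Diff_subset)
  show "x \<in> S \<Longrightarrow> x \<notin> unit_sq" "y \<in> T \<Longrightarrow> y \<notin> unit_sq" "S \<inter> T = {}"
    using A B disj by (auto simp: S_def T_def)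
  show "seed_set x y y' \<subseteq> acoords c e V" if "x \<in> S" "y \<in> T" "y' \<in> T"
  proof -
    have x: "x \<in> coords c e A" and y: "y \<in> coords c e B" "y' \<in> coords c e B"
      using that by (auto simp: S_def T_def)
    show ?thesis
      using lk[OF A(1) B(1)] lk[OF A(1) B(2)] lk[OF A(2) B(1)] lk[OF A(2) B(2)]
        lk[OF A(1) y(1)] lk[OF A(2) y(1)] lk[OF A(1) y(2)] lk[OF A(2) y(2)] lk[OF x B(1)] lk[OF x B(2)] lk[OF x y(1)] lk[OF x y(2)]
      by (simp add: seed_set_def core_def ynbrs_def xnbrs_def)
  qed
qed

lemma complete_K34:
  assumes "e \<noteq> 0" "A \<inter> B = {}" "A \<times> B \<subseteq> edges A B V"
    and "c + e \<in> A" "c - e \<in> A" "c + \<i> * e \<in> B" "c - \<i> * e \<in> B"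
    and fin: "finite A" "finite B" "finite V" and card: "3 \<le> card A" "4 \<le> card B"
  shows "9 \<le> card V"
proof -
  note * = complete_seed[OF assms(1-7)]
  obtain x where x: "x \<in> coords c e A - {Complex 1 0, Complex (-1) 0}"
    using *(1)[OF fin(1)] card by (metis One_nat_def Suc_eq_plus1 add_2_eq_Suc' all_not_in_conv card.empty le_antisym not_less_eq_eq numeral_2_eq_2 numeral_3_eq_3 zero_le)
  have "2 \<le> card (coords c e B - {Complex 0 1, Complex 0 (-1)})" using *(2)[OF fin(2)] card by linarith
  then obtain y y' where y: "y \<in> coords c e B - {Complex 0 1, Complex 0 (-1)}" "y' \<in> coords c e B - {Complex 0 1, Complex 0 (-1)}" "y \<noteq> y'"
    by (rule card_ge_2E)
  have "9 \<le> card (acoords c e V)"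
    by (rule seed_K34(1)[OF finite_acoords[OF assms(1) fin(3)] *(6)[OF x y(1,2)] *(3)[OF x] *(4)[OF y(1)] *(4)[OF y(2)] y(3)])
  then show ?thesis by (simp add: card_acoords[OF assms(1)])
qed

lemma complete_K44:
  assumes "e \<noteq> 0" "A \<inter> B = {}" "A \<times> B \<subseteq> edges A B V"
    and "c + e \<in> A" "c - e \<in> A" "c + \<i> * e \<in> B" "c - \<i> * e \<in> B"
    and fin: "finite A" "finite B" "finite V" and card: "4 \<le> card A" "4 \<le> card B"
  shows "10 \<le> card V"
proof -
  note * = complete_seed[OF assms(1-7)]
  let ?S = "coords c e A - {Complex 1 0, Complex (-1) 0}" and ?T = "coords c e B - {Complex 0 1, Complex 0 (-1)}"
  have "2 \<le> card ?S" "2 \<le> card ?T" using *(1)[OF fin(1)] *(2)[OF fin(2)] card by linarith+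
  then obtain x x' y y' where x: "x \<in> ?S" "x' \<in> ?S" "x \<noteq> x'" and y: "y \<in> ?T" "y' \<in> ?T" "y \<noteq> y'"
    by (metis card_ge_2E)
  have "x \<noteq> y" "x \<noteq> y'" "x' \<noteq> y" "x' \<noteq> y'" using x y *(5) by blast+
  then have "10 \<le> card (acoords c e V)"
    by (intro seed_K44[OF finite_acoords[OF assms(1) fin(3)] *(6)[OF x(1) y(1,2)] *(6)[OF x(2) y(1,2)]
        *(3)[OF x(1)] *(3)[OF x(2)] *(4)[OF y(1)] *(4)[OF y(2)] x(3) y(3)])
  then show ?thesis by (simp add: card_acoords[OF assms(1)])
qed

section \<open>Classes that consist of the four vertices of a square\<close>

abbreviation corners :: "complex set" where
  "corners \<equiv> {Complex 1 1, Complex 1 (-1), Complex (-1) 1, Complex (-1) (-1)}"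

text \<open>A side of \<open>unit_sq\<close>, taken as a diagonal, has the centre as one apex and a
  corner of the surrounding grid as the other. Scaling by \<open>1 + \<i>\<close> moves the corners
  to the points with one coordinate 2 or -2 and the other 0.\<close>

lemma side_edges:
  "int (card (ledges {Complex 1 0, Complex (-1) 0} {Complex 0 1, Complex 0 (-1)} Z)) =
    ind Z (Complex 0 0) * (ind Z (Complex 0 2) + ind Z (Complex 2 0) + ind Z (Complex (-2) 0) + ind Z (Complex 0 (-2)))"
  by (simp add: card_ledges_sum algebra_simps)

lemma ind_acoords:
  "ind (acoords c e A) (Complex 0 0) = ind (coords c e A) (Complex 0 0)"
  "ind (acoords c e A) (Complex 0 2) = ind (coords c e A) (Complex 1 1)"
  "ind (acoords c e A) (Complex 2 0) = ind (coords c e A) (Complex 1 (-1))"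
  "ind (acoords c e A) (Complex (-2) 0) = ind (coords c e A) (Complex (-1) 1)"
  "ind (acoords c e A) (Complex 0 (-2)) = ind (coords c e A) (Complex (-1) (-1))"
  by (simp_all add: ind_def acoords_def coords_def div_one_plus_i)

lemma card_corners:
  "int (card (X \<inter> corners)) = ind X (Complex 1 1) + ind X (Complex 1 (-1)) + ind X (Complex (-1) 1) + ind X (Complex (-1) (-1))"
proof -
  have "int (card (X \<inter> corners)) = (\<Sum>z\<in>corners. ind X z)"
    unfolding ind_def by (subst sum.If_cases) (auto simp: Int_def conj_commute intro!: arg_cong[of _ _ card])
  then show ?thesis by simp
qed

lemma four_partition:
  assumes "X \<union> Y = {p, q, r, s}" "X \<inter> Y = {}" "Y \<noteq> {}" "p \<in> X \<longleftrightarrow> q \<in> X" "r \<in> X \<longleftrightarrow> s \<in> X" "p \<in> X"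
  shows "X = {p, q} \<and> Y = {r, s}"
proof -
  have q: "q \<in> X" using assms(4,6) by simp
  have "r \<notin> X"
  proof
    assume "r \<in> X"
    then have "Y \<subseteq> X" using assms(1,4,5,6) by blast
    then show False using assms(2,3) by blast
  qed
  then show ?thesis using assms(1,2,5,6) q by blast
qed

text \<open>By \<open>split_diag\<close> the parity classes of the square \<open>B\<close> are its
  two diagonals, so the graph consists of the four sides of \<open>B\<close>. By
  \<open>side_edges\<close> a mixed square needs the centre of \<open>B\<close> in \<open>A\<close>,
  and each one uses a corner of its own.\<close>

lemma square_class:
  assumes sp: "parity_split U A B" and fin: "finite U" and B: "card B = 4" "1 \<le> nsq B" and m: "1 \<le> card (mixed A B)"
  obtains c e where "e \<noteq> 0" "coords c e B = unit_sq" "Complex 0 0 \<in> coords c e A"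
    "card (mixed A B) \<le> card (coords c e A \<inter> corners)"
proof -
  note result = that
  have finAB: "finite A" "finite B" using parity_split_finite[OF sp fin] by auto
  have "sqs B \<noteq> {}" using B(2) by (auto simp: nsq_def)
  then obtain c e where e: "e \<noteq> 0" "sq c e \<subseteq> B" by (auto simp: sqs_def)
  have Bsq: "B = sq c e"
    using card_subset_eq[OF finAB(2) e(2)] card_sq[OF e(1)] B(1) by simp
  obtain B1 B2 where B12: "parity_split B B1 B2" "card (mixed B A) \<le> card (edges B1 B2 A)"
    using next_split[OF parity_split_sym[OF sp] fin] by blast
  have E: "card (mixed A B) \<le> card (edges B1 B2 A)" using B12(2) by (simp add: mixed_sym)
  then have "edges B1 B2 A \<noteq> {}" using m by auto
  then have ne: "B1 \<noteq> {}" "B2 \<noteq> {}" by (auto simp: edges_def)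
  note BU = parity_split_sets[OF B12(1)]
  note diag = split_diag[OF B12(1) e(2)]
  have goal: thesis if g: "g \<noteq> 0" "sq c g = B" "B1 = {c + g, c - g}" "B2 = {c + \<i> * g, c - \<i> * g}" for g
  proof -
    let ?X = "coords c g A"
    have "coords c g B1 = {Complex 1 0, Complex (-1) 0}" "coords c g B2 = {Complex 0 1, Complex 0 (-1)}"
      using g(1) by (simp_all add: coords_eq_image g(3,4) complex_units)
    then have "int (card (edges B1 B2 A)) = ind ?X (Complex 0 0) * int (card (?X \<inter> corners))"
      unfolding card_ledges[OF g(1), of B1 B2 A c] card_corners by (simp add: side_edges ind_acoords)
    then have "Complex 0 0 \<in> ?X" "card (mixed A B) \<le> card (?X \<inter> corners)"
      using m E by (auto simp: ind_def split: if_splits)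
    moreover have "coords c g B = unit_sq" using coords_sq[OF g(1), of c] g(2) by simp
    ultimately show thesis using result g(1) by blast
  qed
  have e': "sq c (\<i> * e) = sq c e" "\<i> * e \<noteq> 0" using e(1) by (simp_all add: sq_rotate)
  have ii: "c + \<i> * (\<i> * e) = c - e" "c - \<i> * (\<i> * e) = c + e" by simp_all
  have part: "B1 \<union> B2 = {c + e, c - e, c + \<i> * e, c - \<i> * e}"
    using BU(1) Bsq by (simp add: sq_def)
  show thesis
  proof (cases "c + e \<in> B1")
    case True
    then have "B1 = {c + e, c - e} \<and> B2 = {c + \<i> * e, c - \<i> * e}"
      by (rule four_partition[OF part BU(2) ne(2) diag])
    then show ?thesis using goal[OF e(1)] Bsq by simp
  next
    case False
    then have "c + e \<in> B2" using part by blast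
    moreover have "c + e \<in> B2 \<longleftrightarrow> c - e \<in> B2" "c + \<i> * e \<in> B2 \<longleftrightarrow> c - \<i> * e \<in> B2"
      using split_diag[OF parity_split_sym[OF B12(1)] e(2)] by blast+
    moreover have "B2 \<union> B1 = {c + e, c - e, c + \<i> * e, c - \<i> * e}" "B2 \<inter> B1 = {}"
      using part BU(2) by (simp_all add: Un_commute Int_commute)
    ultimately have "B2 = {c + e, c - e} \<and> B1 = {c + \<i> * e, c - \<i> * e}"
      using four_partition[of B2 B1] ne(1) by blast
    then have "B1 = {c + \<i> * e, c - \<i> * e}" "B2 = {c + \<i> * (\<i> * e), c - \<i> * (\<i> * e)}"
      unfolding ii by (simp_all add: insert_commute)
    then show ?thesis using goal[OF e'(2)] e'(1) Bsq by simp
  qed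
qed

lemma coords_rotate: "Complex a b \<in> coords c (\<i> * e) A \<longleftrightarrow> Complex (- b) a \<in> coords c e A"
proof -
  have "\<i> * e * Complex a b = e * Complex (- b) a" by (simp add: complex_eq_iff)
  then show ?thesis by (simp only: coords_def mem_Collect_eq)
qed

lemma coords_rotate_unit: "coords c e B = unit_sq \<Longrightarrow> coords c (\<i> * e) B = unit_sq"
proof -
  assume B: "coords c e B = unit_sq"
  have "t \<in> coords c (\<i> * e) B \<longleftrightarrow> t \<in> unit_sq" for t
    by (cases t; simp only: coords_rotate B) auto
  then show ?thesis by blast
qed

text \<open>The disjuncts are successive quarter turns of one pattern, in the order of the rotations
  tried in \<open>normal_corners\<close>.\<close>

lemma two_of_four:
  "2 \<le> of_bool p + of_bool q + of_bool r + (of_bool s :: int) \<Longrightarrow> p \<and> (q \<or> s) \<or> r \<and> (p \<or> q) \<or> s \<and> (r \<or> p) \<or> q \<and> (s \<or> r)"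
  by (cases p; cases q; cases r; cases s) simp_all

lemma three_of_four:
  "3 \<le> of_bool p + of_bool q + of_bool r + (of_bool s :: int) \<Longrightarrow> p \<and> q \<and> r \<or> r \<and> p \<and> s \<or> s \<and> r \<and> q \<or> q \<and> s \<and> p"
  by (cases p; cases q; cases r; cases s) simp_all

text \<open>Turning \<open>e\<close> by a quarter preserves \<open>B\<close> and the centre and
  permutes the corners cyclically. Two corners are adjacent or opposite; any three are
  equivalent.\<close>

lemma normal_corners:
  assumes e: "e \<noteq> 0" "coords c e B = unit_sq" "Complex 0 0 \<in> coords c e A"
  shows "2 \<le> card (coords c e A \<inter> corners) \<Longrightarrow> \<exists>g. g \<noteq> 0 \<and> coords c g B = unit_sq \<and> Complex 0 0 \<in> coords c g A \<and>
      Complex 1 1 \<in> coords c g A \<and> (Complex 1 (-1) \<in> coords c g A \<or> Complex (-1) (-1) \<in> coords c g A)"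
    and "3 \<le> card (coords c e A \<inter> corners) \<Longrightarrow> \<exists>g. g \<noteq> 0 \<and> coords c g B = unit_sq \<and> Complex 0 0 \<in> coords c g A \<and>
      Complex 1 1 \<in> coords c g A \<and> Complex 1 (-1) \<in> coords c g A \<and> Complex (-1) 1 \<in> coords c g A"
proof -
  let ?ok = "\<lambda>g. g \<noteq> 0 \<and> coords c g B = unit_sq \<and> Complex 0 0 \<in> coords c g A"
  have step: "?ok (\<i> * g)" if "?ok g" for g
    using that coords_rotate[of 0 0 c g A] coords_rotate_unit[of c g B] by simp
  have ok1: "?ok e" using e by blast
  note ok2 = step[OF ok1]
  note ok3 = step[OF ok2]
  note ok = ok1 ok2 ok3 step[OF ok3]
  let ?K = "\<lambda>a b. Complex a b \<in> coords c e A"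
  note rot = coords_rotate[of _ _ c _ A]
  show "\<exists>g. g \<noteq> 0 \<and> coords c g B = unit_sq \<and> Complex 0 0 \<in> coords c g A \<and>
      Complex 1 1 \<in> coords c g A \<and> (Complex 1 (-1) \<in> coords c g A \<or> Complex (-1) (-1) \<in> coords c g A)"
    if "2 \<le> card (coords c e A \<inter> corners)"
  proof -
    have "2 \<le> int (card (coords c e A \<inter> corners))" using that by simp
    note this[unfolded card_corners ind_def of_bool_def[symmetric]]
    from two_of_four[OF this] consider "?K 1 1" "?K 1 (-1) \<or> ?K (-1) (-1)" | "?K (-1) 1" "?K 1 1 \<or> ?K 1 (-1)"
      | "?K (-1) (-1)" "?K (-1) 1 \<or> ?K 1 1" | "?K 1 (-1)" "?K (-1) (-1) \<or> ?K (-1) 1"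
      by blast
    then show ?thesis
    proof cases
      case 1 then show ?thesis using ok(1) by blast
    next
      case 2 then show ?thesis using ok(2) rot by (intro exI[of _ "\<i> * e"]) simp
    next
      case 3 then show ?thesis using ok(3) rot by (intro exI[of _ "\<i> * (\<i> * e)"]) (simp only: rot minus_minus minus_zero simp_thms)
    next
      case 4 then show ?thesis using ok(4) rot by (intro exI[of _ "\<i> * (\<i> * (\<i> * e))"]) (simp only: rot minus_minus minus_zero simp_thms)
    qed
  qed
  show "\<exists>g. g \<noteq> 0 \<and> coords c g B = unit_sq \<and> Complex 0 0 \<in> coords c g A \<and>
      Complex 1 1 \<in> coords c g A \<and> Complex 1 (-1) \<in> coords c g A \<and> Complex (-1) 1 \<in> coords c g A"
    if "3 \<le> card (coords c e A \<inter> corners)"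
  proof -
    have "3 \<le> int (card (coords c e A \<inter> corners))" using that by simp
    note this[unfolded card_corners ind_def of_bool_def[symmetric]]
    from three_of_four[OF this] consider "?K 1 1" "?K 1 (-1)" "?K (-1) 1" | "?K (-1) 1" "?K 1 1" "?K (-1) (-1)"
      | "?K (-1) (-1)" "?K (-1) 1" "?K 1 (-1)" | "?K 1 (-1)" "?K (-1) (-1)" "?K 1 1"
      by blast
    then show ?thesis
    proof cases
      case 1 then show ?thesis using ok(1) by blast
    next
      case 2 then show ?thesis using ok(2) rot by (intro exI[of _ "\<i> * e"]) simp
    next
      case 3 then show ?thesis using ok(3) rot by (intro exI[of _ "\<i> * (\<i> * e)"]) (simp only: rot minus_minus minus_zero simp_thms)
    next
      case 4 then show ?thesis using ok(4) rot by (intro exI[of _ "\<i> * (\<i> * (\<i> * e))"]) (simp only: rot minus_minus minus_zero simp_thms)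
    qed
  qed
qed

section \<open>Extremal configurations\<close>

lemma card4_nsq:
  assumes "finite P" "card P = 4"
  shows "nsq P \<le> 1" "nsq P \<ge> 1 \<Longrightarrow> \<exists>c e. e \<noteq> 0 \<and> P = sq c e"
proof -
  have eq: "Q = P" if "Q \<in> sqs P" for Q
    using that card_subset_eq[OF assms(1), of Q] assms(2) by (auto simp: sqs_def card_sq)
  then have "sqs P \<subseteq> {P}" by blast
  then show "nsq P \<le> 1" unfolding nsq_def using card_mono[of "{P}" "sqs P"] by simp
  assume "nsq P \<ge> 1"
  then have "sqs P \<noteq> {}" by (auto simp: nsq_def)
  then have "P \<in> sqs P" using eq by blast
  then show "\<exists>c e. e \<noteq> 0 \<and> P = sq c e" by (simp add: sqs_def)
qed

lemma four_prod_le: "4 * (a * b) \<le> (a + b) * (a + (b::nat))"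
proof -
  have "int (4 * (a * b)) \<le> int ((a + b) * (a + b))"
    using zero_le_square[of "int a - int b"] by (simp add: algebra_simps)
  then show ?thesis by linarith
qed

text \<open>The number of edges is at most \<open>card A * card B\<close>, where the factors add up
  to \<open>card U\<close>. Counting by the other diagonal gives the bound in
  \<open>V\<close>.\<close>

lemma mixed_le:
  assumes "parity_split P U V" "finite P"
  shows "4 * card (mixed U V) \<le> card U * card U" "4 * card (mixed U V) \<le> card V * card V"
proof -
  have *: "4 * card (mixed U V) \<le> card U * card U" if sp: "parity_split P U V" for U V
  proof -
    obtain A B where AB: "parity_split U A B" "card (mixed U V) \<le> card (edges A B V)"
      using next_split[OF sp assms(2)] by blast
    have fin: "finite U" using parity_split_finite[OF sp assms(2)] by simp
    have "card (edges A B V) \<le> card A * card B"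
      using parity_split_finite[OF AB(1) fin] by (simp add: card_edges_le)
    then have "4 * card (mixed U V) \<le> 4 * (card A * card B)" using AB(2) by simp
    also have "\<dots> \<le> card U * card U"
      using four_prod_le[of "card A" "card B"] parity_split_card[OF AB(1) fin] by simp
    finally show ?thesis .
  qed
  show "4 * card (mixed U V) \<le> card U * card U" by (rule *[OF assms(1)])
  show "4 * card (mixed U V) \<le> card V * card V" using *[OF parity_split_sym[OF assms(1)]] by (simp add: mixed_sym)
qed

lemma ordered_split:
  assumes "finite P" "card P \<ge> 2"
  obtains U V where "parity_split P U V" "1 \<le> card V" "card V \<le> card U" "card U + card V = card P"
proof -
  obtain U V where UV: "parity_split P U V" "U \<noteq> {}" "V \<noteq> {}" using parity_split_exists[OF assms] by blast
  have pos: "1 \<le> card U" "1 \<le> card V"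
    using UV parity_split_finite[OF UV(1) assms(1)] by (simp_all add: Suc_le_eq card_gt_0_iff)
  have sum: "card U + card V = card P" by (rule parity_split_card[OF UV(1) assms(1)])
  show ?thesis
  proof (cases "card V \<le> card U")
    case True
    then show ?thesis using that[OF UV(1)] pos sum by simp
  next
    case False
    then show ?thesis using that[OF parity_split_sym[OF UV(1)]] pos sum by simp
  qed
qed

text \<open>An inductive invariant, chosen so that the recursion closes; only the last four entries
  are matched by constructions below.\<close>

definition square_bound :: "nat \<Rightarrow> nat" where
  "square_bound n = [0, 0, 0, 0, 1, 1, 2, 3, 4, 6, 7, 9, 13, 14, 15, 17, 20, 22] ! n"

text \<open>Here the smaller class has at most three points and hence at most two mixed squares
  arise, so the plain recursion suffices. The analysis of larger classes uses these values for their
  subclasses.\<close>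

lemma nsq_le_square_bound_7: "finite P \<Longrightarrow> card P \<le> 7 \<Longrightarrow> nsq P \<le> square_bound (card P)"
proof (induction "card P" arbitrary: P rule: less_induct)
  case less
  show ?case
  proof (cases "card P < 4")
    case True
    then show ?thesis using nsq_small[OF less.prems(1)] by simp
  next
    case False
    then obtain U V where UV: "parity_split P U V" "1 \<le> card V" "card V \<le> card U" "card U + card V = card P"
      using ordered_split[OF less.prems(1)] by auto
    have fin: "finite U" "finite V" using parity_split_finite[OF UV(1) less.prems(1)] by auto
    have IH: "nsq U \<le> square_bound (card U)" "nsq V \<le> square_bound (card V)"
      using less.hyps[of U] less.hyps[of V] fin UV less.prems(2) by auto
    have n: "nsq P \<le> nsq U + nsq V + card (mixed U V)" by (rule nsq_split[OF UV(1) less.prems(1)])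
    have m: "4 * card (mixed U V) \<le> card V * card V" by (rule mixed_le(2)[OF UV(1) less.prems(1)])
    have "card P = 4 \<or> card P = 5 \<or> card P = 6 \<or> card P = 7" using False less.prems(2) by linarith
    moreover have "card V = 1 \<or> card V = 2 \<or> card V = 3" using UV less.prems(2) by linarith
    ultimately have "square_bound (card U) + square_bound (card V) + card V * card V div 4 \<le> square_bound (card P)"
      using UV(3,4) by (elim disjE) (simp_all add: square_bound_def eq_diff_eq' flip: UV(4))
    then show ?thesis using n m IH by linarith
  qed
qed

section \<open>Classes of seven, eight and nine points with many squares\<close>

lemma coords_eqI:
  assumes "e \<noteq> 0" "finite A" "X \<subseteq> coords c e A" "card X = card A"
  shows "coords c e A = X"
  using card_subset_eq[OF finite_coords[OF assms(1,2)] assms(3)] card_coords[OF assms(1)] assms(4) by metis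

lemma coords_sq_gen:
  assumes "g \<noteq> 0"
  shows "coords c g (sq d e) = sq ((d - c) / g) (e / g)"
  using assms by (simp add: coords_eq_image sq_def diff_divide_distrib add_divide_distrib algebra_simps)

lemma edges_fit:
  assumes "e \<noteq> 0" "coords c e B = unit_sq" "coords c e A = X"
  shows "card (edges A B V) = card (ledges X unit_sq (acoords c e V))"
  by (simp only: card_ledges[OF assms(1), of A B V c] assms(2,3))

text \<open>\<open>A\<close> has no square, \<open>B\<close> at most one, and there are at most two
  mixed ones, so three squares force all these maxima. Then \<open>B\<close> is a square and
  \<open>A\<close> is its centre with two corners.\<close>

lemma bound_73:
  assumes sp: "parity_split U A B" and fin: "finite U" "finite V" and A: "card A = 3" and B: "card B = 4"
    and S: "3 \<le> nsq U" and k: "card V \<le> k" "k \<in> {7, 8}"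
  shows "card (edges A B V) \<le> k + 2"
proof -
  have finAB: "finite A" "finite B" using parity_split_finite[OF sp fin(1)] by auto
  have "nsq A = 0" using nsq_small[OF finAB(1)] A by simp
  moreover have "nsq B \<le> 1" using card4_nsq(1)[OF finAB(2) B] .
  moreover have "4 * card (mixed A B) \<le> 9" using mixed_le(1)[OF sp fin(1)] A by simp
  moreover have "3 \<le> nsq A + nsq B + card (mixed A B)" using nsq_split[OF sp fin(1)] S by simp
  ultimately have m: "1 \<le> nsq B" "2 \<le> card (mixed A B)" by linarith+
  have "1 \<le> card (mixed A B)" using m(2) by simp
  then obtain c e where e: "e \<noteq> 0" "coords c e B = unit_sq" "Complex 0 0 \<in> coords c e A"
    "card (mixed A B) \<le> card (coords c e A \<inter> corners)"
    by (rule square_class[OF sp fin(1) B m(1)])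
  then obtain g where g: "g \<noteq> 0" "coords c g B = unit_sq" "Complex 0 0 \<in> coords c g A"
      "Complex 1 1 \<in> coords c g A" "Complex 1 (-1) \<in> coords c g A \<or> Complex (-1) (-1) \<in> coords c g A"
    using normal_corners(1)[OF e(1-3)] m(2) by (meson order_trans)
  have Z: "finite (acoords c g V)" "card (acoords c g V) \<le> k"
    using fin(2) k(1) g(1) by (simp_all add: finite_acoords card_acoords)
  from g(5) show ?thesis
  proof
    assume "Complex 1 (-1) \<in> coords c g A"
    then have "coords c g A = {Complex 0 0, Complex 1 1, Complex 1 (-1)}"
      using g A by (intro coords_eqI[OF g(1) finAB(1)]) auto
    then show ?thesis
      using edges_fit[OF g(1,2)] bound_73a[OF Z k(2)] by metis
  next
    assume "Complex (-1) (-1) \<in> coords c g A"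
    then have "coords c g A = {Complex 0 0, Complex 1 1, Complex (-1) (-1)}"
      using g A by (intro coords_eqI[OF g(1) finAB(1)]) auto
    then show ?thesis
      using edges_fit[OF g(1,2)] bound_73b[OF Z k(2)] by metis
  qed
qed

lemma ledges_Un: "card (ledges (X \<union> Y) B Z) \<le> card (ledges X B Z) + card Y * card B" if "finite X" "finite Y" "finite B"
proof -
  have sub: "ledges Y B Z \<subseteq> Y \<times> B" by (auto simp: ledges_def)
  have "ledges (X \<union> Y) B Z = ledges X B Z \<union> ledges Y B Z" by (auto simp: ledges_def)
  then have "card (ledges (X \<union> Y) B Z) \<le> card (ledges X B Z) + card (ledges Y B Z)" by (simp add: card_Un_le)
  also have "card (ledges Y B Z) \<le> card Y * card B"
    using card_mono[OF _ sub] that by (simp add: card_cartesian_product)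
  finally show ?thesis by simp
qed

text \<open>\<open>u\<close> and \<open>v\<close> are the neighbours of the missing vertex
  \<open>w\<close>, and \<open>t\<close> is opposite to it; the equation for \<open>t\<close> also
  fixes which neighbour is called \<open>u\<close>.\<close>

lemma fourth_vertex:
  assumes e: "e \<noteq> 0" and Q: "sq c e = insert w X" "w \<notin> X"
  obtains u v t where "X = {u, v, t}" "u \<noteq> v" "2 * t = u + v + \<i> * (u - v)" "w = u + v - t"
proof -
  have ii: "c + \<i> * (\<i> * g) = c - g" "c - \<i> * (\<i> * g) = c + g" for g by simp_all
  have "\<exists>g. sq c g = sq c e \<and> g \<noteq> 0 \<and> w = c - \<i> * g"
  proof -
    have "w \<in> sq c e" using Q(1) by simp
    then consider "w = c - \<i> * e" | "w = c + e" | "w = c + \<i> * e" | "w = c - e" by (auto simp: sq_def)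
    then show ?thesis
    proof cases
      case 1 then show ?thesis using e by blast
    next
      case 2 then show ?thesis using e ii(2)[of e] sq_rotate[of c e] by (intro exI[of _ "\<i> * e"]) simp
    next
      case 3 then show ?thesis using e sq_rotate[of c e] sq_rotate[of c "\<i> * e"] by (intro exI[of _ "- e"]) simp
    next
      case 4 then show ?thesis using e sq_rotate[of c e] sq_rotate[of c "\<i> * e"] sq_rotate[of c "- e"]
        by (intro exI[of _ "- (\<i> * e)"]) simp
    qed
  qed
  then obtain g where g: "sq c g = sq c e" "g \<noteq> 0" "w = c - \<i> * g" by blast
  have "card {c + g, c - g, c + \<i> * g, w} = 4" using card_sq[OF g(2), of c] g(3) by (simp add: sq_def)
  then have d: "w \<notin> {c + g, c - g, c + \<i> * g}" "c + g \<noteq> c - g"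
    by (auto simp: card_insert_if split: if_splits)
  have "insert w X = insert w {c + g, c - g, c + \<i> * g}"
    using Q(1) g(1,3) by (auto simp: sq_def)
  then have "X = {c + g, c - g, c + \<i> * g}" using Q(2) d(1) by (metis Diff_insert_absorb)
  then show ?thesis using that[of "c + g" "c - g" "c + \<i> * g"] d(2) g(3) by (simp add: algebra_simps)
qed

text \<open>Three vertices of a square form an isosceles right triangle, which determines the
  fourth; the two excluded triples are collinear.\<close>

lemma fourth_vertex_cases:
  assumes e: "e \<noteq> 0" and Q: "sq c e = insert w X" "w \<notin> X"
  shows "X = {Complex 0 0, Complex 1 1, Complex 1 (-1)} \<Longrightarrow> w = Complex 2 0"
    "X = {Complex 0 0, Complex 1 1, Complex (-1) 1} \<Longrightarrow> w = Complex 0 2"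
    "X = {Complex 1 1, Complex 1 (-1), Complex (-1) 1} \<Longrightarrow> w = Complex (-1) (-1)"
    "X \<noteq> {Complex 0 0, Complex 1 1, Complex (-1) (-1)}"
    "X \<noteq> {Complex 0 0, Complex 1 (-1), Complex (-1) 1}"
proof -
  obtain u v t where X: "X = {u, v, t}" "u \<noteq> v" "2 * t = u + v + \<i> * (u - v)" "w = u + v - t"
    using fourth_vertex[OF e Q] by blast
  have t: "2 * Re t = Re u + Re v - (Im u - Im v)" "2 * Im t = Im u + Im v + (Re u - Re v)"
    using arg_cong[OF X(3), of Re] arg_cong[OF X(3), of Im] by simp_all
  have perm: "(u = p \<or> u = q \<or> u = r) \<and> (v = p \<or> v = q \<or> v = r) \<and> (t = p \<or> t = q \<or> t = r)" if "X = {p, q, r}" for p q r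
    using that X(1) by blast
  show "w = Complex 2 0" if *: "X = {Complex 0 0, Complex 1 1, Complex 1 (-1)}"
    using perm[OF *] t X(2) unfolding X(4) by (elim conjE disjE) (simp_all add: complex_eq_iff)
  show "w = Complex 0 2" if *: "X = {Complex 0 0, Complex 1 1, Complex (-1) 1}"
    using perm[OF *] t X(2) unfolding X(4) by (elim conjE disjE) (simp_all add: complex_eq_iff)
  show "w = Complex (-1) (-1)" if *: "X = {Complex 1 1, Complex 1 (-1), Complex (-1) 1}"
    using perm[OF *] t X(2) unfolding X(4) by (elim conjE disjE) (simp_all add: complex_eq_iff)
  show "X \<noteq> {Complex 0 0, Complex 1 1, Complex (-1) (-1)}"
  proof
    assume *: "X = {Complex 0 0, Complex 1 1, Complex (-1) (-1)}"
    show False using perm[OF *] t X(2) by (elim conjE disjE) (simp_all add: complex_eq_iff)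
  qed
  show "X \<noteq> {Complex 0 0, Complex 1 (-1), Complex (-1) 1}"
  proof
    assume *: "X = {Complex 0 0, Complex 1 (-1), Complex (-1) 1}"
    show False using perm[OF *] t X(2) by (elim conjE disjE) (simp_all add: complex_eq_iff)
  qed
qed

lemma edges_full:
  assumes "finite A" "finite B" "card A * card B \<le> card (edges A B V)"
  shows "A \<times> B \<subseteq> edges A B V"
proof -
  have "edges A B V = A \<times> B"
    using assms card_edges_le[OF assms(1,2), of V]
    by (intro card_subset_eq edges_subset) (simp_all add: card_cartesian_product)
  then show ?thesis by simp
qed

lemma ynbrs_units: "ynbrs (Complex 0 1) \<union> ynbrs (Complex 0 (-1)) = core" "Complex 0 0 \<in> ynbrs (Complex 0 1)" "Complex 0 0 \<in> ynbrs (Complex 0 (-1))"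
  by (auto simp: ynbrs_def core_def)

lemma two_point_coords:
  assumes "card A = 2"
  obtains c e where "e \<noteq> 0" "coords c e A = {Complex 1 0, Complex (-1) 0}"
proof -
  obtain p q where pq: "A = {p, q}" "p \<noteq> q" using assms by (meson card_2_iff)
  define c where "c = (p + q) / 2"
  define e where "e = (p - q) / 2"
  have "c + e = p" "c - e = q" unfolding c_def e_def by (simp_all add: add_divide_distrib diff_divide_distrib)
  then have A: "A = {c + e, c - e}" using pq(1) by simp
  have e: "e \<noteq> 0" using pq(2) by (simp add: e_def)
  have "coords c e A = {Complex 1 0, Complex (-1) 0}"
    unfolding coords_eq_image[OF e] A using e by (simp add: complex_units)
  then show ?thesis using that e by blast
qed

text \<open>Put \<open>A\<close> at \<open>1\<close> and \<open>-1\<close>. A point of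
  \<open>B\<close> outside \<open>unit_sq\<close> has four apices, which fill \<open>V\<close>,
  avoid the centre and determine the point by their sum; so two such points coincide. A point of
  \<open>B\<close> in \<open>unit_sq\<close> puts the centre into \<open>V\<close>, so both points
  are in \<open>unit_sq\<close>, and \<open>V\<close> would have to contain the five points of
  \<open>core\<close>.\<close>

lemma no_K22:
  assumes fin: "finite A" "finite B" "finite V" and AB: "A \<inter> B = {}" "card A = 2" "card B = 2"
    and full: "A \<times> B \<subseteq> edges A B V" and V: "card V = 4"
  shows False
proof -
  obtain c e where e: "e \<noteq> 0" and A: "coords c e A = {Complex 1 0, Complex (-1) 0}"
    using two_point_coords[OF AB(2)] by blast
  let ?Z = "acoords c e V"
  have Z: "finite ?Z" "card ?Z = 4" using e fin(3) V by (simp_all add: finite_acoords card_acoords)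
  have "card (coords c e B) = 2" using card_coords[OF e] AB(3) by simp
  then obtain p q where pq: "p \<in> coords c e B" "q \<in> coords c e B" "p \<noteq> q" by (metis card_ge_2E order_refl)
  have disj: "coords c e A \<inter> coords c e B = {}" using AB(1) by (auto simp: coords_def)
  have ynbrs: "ynbrs y \<subseteq> ?Z" if "y \<in> coords c e B" for y
  proof -
    have "(x, y) \<in> ledges (coords c e A) (coords c e B) ?Z" if "x \<in> coords c e A" for x
      unfolding edges_coords_iff[symmetric] using full that \<open>y \<in> coords c e B\<close> by (auto simp: coords_def)
    then show ?thesis by (simp add: A ynbrs_def ledges_def)
  qed
  have eq: "ynbrs y = ?Z" if "y \<in> coords c e B" "y \<notin> unit_sq" for y
    using card_subset_eq[OF Z(1) ynbrs[OF that(1)]] ynbrs_props(1)[OF that(2)] Z(2) by simp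
  show False
  proof (cases "p \<in> unit_sq \<or> q \<in> unit_sq")
    case False
    then have "ynbrs p = ynbrs q" using eq pq by simp
    then have "Complex 2 2 * p = Complex 2 2 * q"
      using ynbrs_props(2)[of p] ynbrs_props(2)[of q] False by metis
    then show False using pq(3) by (simp add: complex_eq_iff)
  next
    case True
    have ns: "y \<noteq> Complex 1 0" "y \<noteq> Complex (-1) 0" if "y \<in> coords c e B" for y
      using that disj A by auto
    have "Complex 0 0 \<in> ynbrs y" if "y \<in> coords c e B" "y \<in> unit_sq" for y
      using ns[OF that(1)] that(2) ynbrs_units(2,3) by auto
    then have z: "Complex 0 0 \<in> ?Z" using True pq(1,2) ynbrs[OF pq(1)] ynbrs[OF pq(2)] by (meson subsetD)
    have "y \<in> unit_sq" if "y \<in> coords c e B" for y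
    proof (rule ccontr)
      assume "y \<notin> unit_sq"
      then show False using eq[OF that] ynbrs_props(3)[of y] z by simp
    qed
    then have "p \<in> unit_sq" "q \<in> unit_sq" using pq by blast+
    then have "p = Complex 0 1 \<or> p = Complex 0 (-1)" "q = Complex 0 1 \<or> q = Complex 0 (-1)"
      using ns[OF pq(1)] ns[OF pq(2)] by simp_all
    then have "p = Complex 0 1 \<and> q = Complex 0 (-1) \<or> p = Complex 0 (-1) \<and> q = Complex 0 1"
      using pq(3) by (elim disjE) simp_all
    then have "ynbrs p \<union> ynbrs q = core" using ynbrs_units(1) by (elim disjE) (simp_all add: Un_commute)
    then have "core \<subseteq> ?Z" using ynbrs[OF pq(1)] ynbrs[OF pq(2)] by (metis Un_least)
    then show False using card_mono[OF Z(1), of core] Z(2) card_core by simp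
  qed
qed

text \<open>Three mixed squares put three corners into \<open>A\<close>. With only two,
  \<open>A\<close> is itself a square through the centre and two corners; these are adjacent,
  because opposite corners are collinear with the centre.\<close>

lemma bound_84_aux:
  assumes sp: "parity_split U A B" and fin: "finite U" "finite V" and A: "card A = 4" and B: "card B = 4"
    and SB: "1 \<le> nsq B" and S: "3 \<le> nsq A + card (mixed A B)" and k: "card V \<le> k" "k \<in> {7, 8, 9}"
  shows "card (edges A B V) \<le> k + 4"
proof -
  have finAB: "finite A" "finite B" using parity_split_finite[OF sp fin(1)] by auto
  have SA: "nsq A \<le> 1" by (rule card4_nsq(1)[OF finAB(1) A])
  then have m: "2 \<le> card (mixed A B)" "1 \<le> card (mixed A B)" using S by linarith+
  obtain c e where e: "e \<noteq> 0" "coords c e B = unit_sq" "Complex 0 0 \<in> coords c e A"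
    "card (mixed A B) \<le> card (coords c e A \<inter> corners)"
    by (rule square_class[OF sp fin(1) B SB m(2)])
  show ?thesis
  proof (cases "3 \<le> card (mixed A B)")
    case True
    then obtain g where g: "g \<noteq> 0" "coords c g B = unit_sq" "Complex 0 0 \<in> coords c g A"
      "Complex 1 1 \<in> coords c g A" "Complex 1 (-1) \<in> coords c g A" "Complex (-1) 1 \<in> coords c g A"
      using normal_corners(2)[OF e(1-3)] e(4) by (meson order_trans)
    have Z: "finite (acoords c g V)" "card (acoords c g V) \<le> k"
      using fin(2) k(1) g(1) by (simp_all add: finite_acoords card_acoords)
    have "coords c g A = {Complex 0 0, Complex 1 1, Complex 1 (-1), Complex (-1) 1}"
      using g A by (intro coords_eqI[OF g(1) finAB(1)]) auto
    then show ?thesis using edges_fit[OF g(1,2)] bound_84a[OF Z k(2)] by metis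
  next
    case False
    then have "1 \<le> nsq A" using S by linarith
    then obtain d f where df: "f \<noteq> 0" "A = sq d f" using card4_nsq(2)[OF finAB(1) A] by blast
    obtain g where g: "g \<noteq> 0" "coords c g B = unit_sq" "Complex 0 0 \<in> coords c g A"
      "Complex 1 1 \<in> coords c g A" "Complex 1 (-1) \<in> coords c g A \<or> Complex (-1) (-1) \<in> coords c g A"
      using normal_corners(1)[OF e(1-3)] e(4) m(1) by (meson order_trans)
    have Z: "finite (acoords c g V)" "card (acoords c g V) \<le> k"
      using fin(2) k(1) g(1) by (simp_all add: finite_acoords card_acoords)
    have Asq: "coords c g A = sq ((d - c) / g) (f / g)" "f / g \<noteq> 0"
      using coords_sq_gen[OF g(1)] df g(1) by simp_all
    have split: "\<exists>w. coords c g A = insert w X \<and> w \<notin> X" if X: "X \<subseteq> coords c g A" "card X = 3" for X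
    proof -
      have fA: "finite (coords c g A)" "card (coords c g A) = 4"
        using finite_coords[OF g(1) finAB(1)] card_coords[OF g(1)] A by simp_all
      have "card (coords c g A - X) = 1" using card_Diff_subset[of X "coords c g A"] X fA finite_subset by fastforce
      then obtain w where "coords c g A - X = {w}" by (meson card_1_singletonE)
      then show ?thesis using X(1) by blast
    qed
    from g(5) show ?thesis
    proof
      assume "Complex 1 (-1) \<in> coords c g A"
      then obtain w where w: "coords c g A = insert w {Complex 0 0, Complex 1 1, Complex 1 (-1)}"
          "w \<notin> {Complex 0 0, Complex 1 1, Complex 1 (-1)}"
        using split[of "{Complex 0 0, Complex 1 1, Complex 1 (-1)}"] g by auto
      have "w = Complex 2 0"
        using fourth_vertex_cases(1)[OF Asq(2) _ w(2) refl] w(1) Asq(1) by metis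
      then have "coords c g A = {Complex 0 0, Complex 1 1, Complex 1 (-1), Complex 2 0}" using w(1) by auto
      then show ?thesis using edges_fit[OF g(1,2)] bound_84b[OF Z k(2)] by metis
    next
      assume "Complex (-1) (-1) \<in> coords c g A"
      then obtain w where w: "coords c g A = insert w {Complex 0 0, Complex 1 1, Complex (-1) (-1)}"
          "w \<notin> {Complex 0 0, Complex 1 1, Complex (-1) (-1)}"
        using split[of "{Complex 0 0, Complex 1 1, Complex (-1) (-1)}"] g by auto
      show ?thesis
        using fourth_vertex_cases(4)[OF Asq(2) _ w(2)] w(1) Asq(1) by metis
    qed
  qed
qed

lemma bound_84:
  assumes sp: "parity_split U A B" and fin: "finite U" "finite V" and A: "card A = 4" and B: "card B = 4"
    and S: "4 \<le> nsq U" and k: "card V \<le> k" "k \<in> {7, 8, 9}"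
  shows "card (edges A B V) \<le> k + 4"
proof -
  have finAB: "finite A" "finite B" using parity_split_finite[OF sp fin(1)] by auto
  have SS: "nsq A \<le> 1" "nsq B \<le> 1" using card4_nsq(1) finAB A B by auto
  have S': "4 \<le> nsq A + nsq B + card (mixed A B)" using nsq_split[OF sp fin(1)] S by simp
  consider "1 \<le> nsq B" | "1 \<le> nsq A" | "nsq A = 0" "nsq B = 0" by linarith
  then show ?thesis
  proof cases
    case 1
    then show ?thesis using bound_84_aux[OF sp fin A B _ _ k] S' SS by simp
  next
    case 2
    then show ?thesis
      using bound_84_aux[OF parity_split_sym[OF sp] fin B A _ _ k] S' SS by (simp add: mixed_sym[of B A] card_edges_swap[of A B V])
  next
    case 3
    \<comment> \<open>With no square inside either class all four squares are mixed. They need four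
      edges, so \<open>A\<close> splits as 2 + 2 with a complete graph.\<close>
    obtain C D where CD: "parity_split A C D" "card (mixed A B) \<le> card (edges C D B)"
      by (rule next_split[OF sp fin(1)])
    have finCD: "finite C" "finite D" using parity_split_finite[OF CD(1) finAB(1)] by auto
    have sum: "card C + card D = 4" using parity_split_card[OF CD(1) finAB(1)] A by simp
    have e4: "4 \<le> card (edges C D B)" using S' 3 CD(2) by simp
    then have p: "4 \<le> card C * card D" using card_edges_le[OF finCD, of B] by simp
    have "card C = 2" "card D = 2"
    proof -
      have "card C \<in> {0, 1, 2, 3, 4}" "card D = 4 - card C" using sum by auto
      then show "card C = 2" "card D = 2" using p by auto
    qed
    then have "C \<times> D \<subseteq> edges C D B" using e4 by (intro edges_full finCD) simp
    then show ?thesis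
      using no_K22[OF finCD finAB(2) parity_split_sets(2)[OF CD(1)]] \<open>card C = 2\<close> \<open>card D = 2\<close> B by blast
  qed
qed

lemma apex_image_sq: "apex a ` sq c e = sq ((c + \<i> * a) / (1 + \<i>)) (e / (1 + \<i>))"
  by (simp add: sq_def apex_def add_divide_distrib diff_divide_distrib algebra_simps)

text \<open>Let \<open>A\<close> be at \<open>1\<close> and \<open>-1\<close>, and let
  \<open>y\<close> be the point of \<open>B\<close> off the given square. If \<open>y\<close> is
  joined to both points of \<open>A\<close>, its apices exhaust \<open>V\<close> and miss the
  centre, so the sides of the square give no edges. Otherwise these sides give three edges, all of
  \<open>V\<close> lies in \<open>core\<close>, and an edge at \<open>y\<close> puts
  \<open>y + \<i>\<close> and \<open>y - \<i>\<close> into \<open>core\<close>, which is possible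
  only on \<open>unit_sq\<close>.\<close>

lemma no_five_side:
  assumes fin: "finite A" "finite B" "finite V" and AB: "A \<inter> B = {}" "card A = 2"
    and mem: "mixed A B \<noteq> {}" and B: "card B = 3" and V: "card V \<le> 4"
  shows "card (edges A B V) \<le> 3"
proof (rule ccontr)
  assume "\<not> card (edges A B V) \<le> 3"
  then have E: "4 \<le> card (edges A B V)" by simp
  obtain c e where e: "e \<noteq> 0" "c + e \<in> A" "c - e \<in> A" "c + \<i> * e \<in> B" "c - \<i> * e \<in> B"
    using mem by (auto simp: mixed_def)
  let ?Z = "acoords c e V"
  have Z: "finite ?Z" "card ?Z \<le> 4" using e(1) fin(3) V by (simp_all add: finite_acoords card_acoords)
  have A: "coords c e A = {Complex 1 0, Complex (-1) 0}"
    using e AB(2) by (intro coords_eqI fin) (simp_all add: coords_def mult_units)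
  have f: "finite (coords c e B)" "card (coords c e B) = 3"
    using finite_coords[OF e(1) fin(2)] card_coords[OF e(1)] B by simp_all
  have sub: "{Complex 0 1, Complex 0 (-1)} \<subseteq> coords c e B" using e by (simp add: coords_def mult_units)
  have "card (coords c e B - {Complex 0 1, Complex 0 (-1)}) = 1"
    using card_Diff_subset[OF _ sub] f by simp
  then obtain y where y: "coords c e B - {Complex 0 1, Complex 0 (-1)} = {y}" by (meson card_1_singletonE)
  then have By: "coords c e B = {Complex 0 1, Complex 0 (-1), y}" using sub by blast
  have "coords c e A \<inter> coords c e B = {}" using AB(1) by (auto simp: coords_def)
  then have yu: "y \<notin> unit_sq" using A By y by auto
  then have yu': "Complex 0 1 \<noteq> y" "Complex 0 (-1) \<noteq> y" by auto
  let ?w = "\<lambda>a b. ind ?Z (Complex a b)"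
  let ?p = "ind ?Z (lk (Complex 1 0) y) * ind ?Z (lk y (Complex 1 0))"
  let ?q = "ind ?Z (lk (Complex (-1) 0) y) * ind ?Z (lk y (Complex (-1) 0))"
  have "int (card (edges A B V)) = ?w 0 0 * (?w 0 2 + ?w 2 0 + ?w (-2) 0 + ?w 0 (-2)) + ?p + ?q"
    using yu yu' by (simp add: card_ledges[OF e(1), of A B V c] A By card_ledges_sum algebra_simps)
  then have E': "4 \<le> ?w 0 0 * (?w 0 2 + ?w 2 0 + ?w (-2) 0 + ?w 0 (-2)) + ?p + ?q" using E by simp
  have core_sum: "?w 0 0 + ?w 2 0 + ?w (-2) 0 + ?w 0 2 + ?w 0 (-2) \<le> 4"
    using sum_ind_le_card[OF Z(1), of core] Z(2) by (simp add: core_def)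
  have nn: "y + \<i> \<notin> core \<or> y - \<i> \<notin> core" 
    using yu by (cases y) (auto simp: core_def complex_eq_iff)
  show False
  proof (cases "?p = 1 \<and> ?q = 1")
    case True
    then have "ynbrs y \<subseteq> ?Z" by (auto simp: ynbrs_def ind_def split: if_splits)
    then have "ynbrs y = ?Z" using ynbrs_props(1)[OF yu] Z by (intro card_seteq) simp_all
    then have "?w 0 0 = 0" using ynbrs_props(3)[OF yu] by (auto simp: ind_def)
    then show False using E' True by simp
  next
    case False
    have pq01: "?p = 0 \<or> ?p = 1" "?q = 0 \<or> ?q = 1" by (auto simp: ind_def)
    then have pq: "?p + ?q \<le> 1" using False by linarith
    have w0: "?w 0 0 = 1" using E' pq ind_cases[of ?Z "Complex 0 0"] by auto
    then have c3: "?w 0 2 + ?w 2 0 + ?w (-2) 0 + ?w 0 (-2) = 3" and pq1: "?p + ?q = 1" 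
      using E' pq core_sum by simp_all
    then have "card (?Z \<inter> core) = 4"
    proof -
      have "int (card (core \<inter> ?Z)) = (\<Sum>z\<in>core. ind ?Z z)" unfolding ind_def by (subst sum.If_cases) (simp_all add: finite_core Int_def)
      also have "\<dots> = 4" using c3 w0 by (simp add: core_def)
      finally show ?thesis by (simp add: Int_commute)
    qed
    then have sub: "?Z \<subseteq> core" using Z card_seteq[OF Z(1), of "?Z \<inter> core"] by auto
    have rot: "z \<in> core \<longleftrightarrow> \<i> * z \<in> core" for z by (cases z) (auto simp: core_def complex_eq_iff)
    have "lk (Complex 1 0) y = y + \<i>" "lk y (Complex 1 0) = \<i> * (y - \<i>)"
      "lk (Complex (-1) 0) y = y - \<i>" "lk y (Complex (-1) 0) = \<i> * (y + \<i>)"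
      by (simp_all add: lk_def complex_units algebra_simps)
    then have "?p = 1 \<or> ?q = 1 \<Longrightarrow> y + \<i> \<in> core \<and> y - \<i> \<in> core"
      using sub rot[of "y + \<i>"] rot[of "y - \<i>"] by (auto simp: ind_def split: if_splits)
    then show False using nn pq1 pq01 by auto
  qed
qed

lemma sqs_self: "e \<noteq> 0 \<Longrightarrow> 1 \<le> nsq (sq c e)"
proof -
  assume "e \<noteq> 0"
  then have "sq c e \<in> sqs (sq c e)" by (auto simp: sqs_def)
  then show ?thesis unfolding nsq_def using finite_sqs[of "sq c e"] card_gt_0_iff[of "sqs (sq c e)"] by (auto simp: Suc_le_eq)
qed

text \<open>Four edges force a split of \<open>A\<close> as 1 + 4 or 2 + 3. In the first case the
  larger part is a square, and \<open>apex a\<close>, being a similarity, carries it onto a square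
  in \<open>B\<close>. The second case is \<open>no_five_side\<close>.\<close>

lemma no_K5:
  assumes sp: "parity_split U A B" and fin: "finite U" and A: "card A = 5" and B: "card B = 4"
    and S: "1 \<le> nsq A" "nsq B = 0" and m: "4 \<le> card (mixed A B)"
  shows False
proof -
  have finAB: "finite A" "finite B" using parity_split_finite[OF sp fin] by auto
  obtain C D where CD: "parity_split A C D" "card (mixed A B) \<le> card (edges C D B)"
    by (rule next_split[OF sp fin])
  have E: "4 \<le> card (edges C D B)" using CD(2) m by simp
  have False if CD: "parity_split A C D" and E: "4 \<le> card (edges C D B)" and le: "card C \<le> card D" for C D
  proof -
    have finCD: "finite C" "finite D" using parity_split_finite[OF CD finAB(1)] by auto
    have sum: "card C + card D = 5" using parity_split_card[OF CD finAB(1)] A by simp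
    have prod: "4 \<le> card C * card D" using card_edges_le[OF finCD, of B] E by simp
    have nA: "nsq A \<le> nsq C + nsq D + card (mixed C D)" by (rule nsq_split[OF CD finAB(1)])
    have mCD: "4 * card (mixed C D) \<le> card C * card C" by (rule mixed_le(1)[OF CD finAB(1)])
    have "card C = 1 \<and> card D = 4 \<or> card C = 2 \<and> card D = 3"
    proof -
      have "card C \<in> {0, 1, 2}" "card D = 5 - card C" using sum le by auto
      then show ?thesis using prod by auto
    qed
    then show False
    proof
      assume c: "card C = 2 \<and> card D = 3"
      then have "nsq C = 0" "nsq D = 0" using nsq_small finCD by simp_all
      then have "mixed C D \<noteq> {}" using nA S(1) by auto
      then have "card (edges C D B) \<le> 3"
        using no_five_side[OF finCD finAB(2) parity_split_sets(2)[OF CD]] c B by simp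
      then show False using E by simp
    next
      assume c: "card C = 1 \<and> card D = 4"
      then have "nsq C = 0" using nsq_small finCD by simp
      moreover have "card (mixed C D) = 0" using mCD c by simp
      ultimately have "1 \<le> nsq D" using nA S(1) by simp
      then obtain d f where D: "f \<noteq> 0" "D = sq d f" using card4_nsq(2)[OF finCD(2)] c by blast
      obtain a where a: "C = {a}" using c by (meson card_1_singletonE)
      have "C \<times> D \<subseteq> edges C D B" using c E by (intro edges_full finCD) simp
      then have "apex a ` D \<subseteq> B" by (auto simp: edges_def a)
      moreover have img: "apex a ` D = sq ((d + \<i> * a) / (1 + \<i>)) (f / (1 + \<i>))" by (simp add: D(2) apex_image_sq)
      moreover have f: "f / (1 + \<i>) \<noteq> 0" using D(1) by simp
      ultimately have "B = sq ((d + \<i> * a) / (1 + \<i>)) (f / (1 + \<i>))"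
        using card_subset_eq[OF finAB(2)] card_sq[OF f] B by metis
      then show False using sqs_self[OF f, of "(d + \<i> * a) / (1 + \<i>)"] S(2) by simp
    qed
  qed
  note * = this
  show False
  proof (cases "card C \<le> card D")
    case True
    then show ?thesis using *[OF CD(1) E] by simp
  next
    case False
    then show ?thesis using *[OF parity_split_sym[OF CD(1)]] E by (simp add: card_edges_swap)
  qed
qed

text \<open>\<open>B\<close> is a square because of \<open>no_K5\<close>. Four mixed squares make
  \<open>U\<close> the grid, and \<open>k + 4\<close> is at most \<open>2 * k - 3\<close> as
  \<open>k\<close> is at least 7. With three, \<open>A\<close> has the centre, three corners, a
  fifth point \<open>w\<close>, and a square inside. That square cannot avoid \<open>w\<close>, so
  the point \<open>t\<close> that it omits decides where \<open>w\<close> lies.\<close>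

lemma bound_95:
  assumes sp: "parity_split U A B" and fin: "finite U" "finite V" and A: "card A = 5" and B: "card B = 4"
    and S: "5 \<le> nsq U" and k: "card V \<le> k" "k \<in> {7, 8}"
  shows "card (edges A B V) \<le> 2 * k - 3" "6 \<le> nsq U \<Longrightarrow> card (edges A B V) \<le> k + 4"
proof -
  have finAB: "finite A" "finite B" using parity_split_finite[OF sp fin(1)] by auto
  have SS: "nsq A \<le> 1" "nsq B \<le> 1" using card4_nsq(1) nsq_le_square_bound_7[OF finAB(1)] finAB A B by (auto simp: square_bound_def)
  have S': "nsq U \<le> nsq A + nsq B + card (mixed A B)" by (rule nsq_split[OF sp fin(1)])
  have m4: "card (mixed A B) \<le> 4" using mixed_le(2)[OF sp fin(1)] B by simp
  have SB: "1 \<le> nsq B"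
  proof (rule ccontr)
    assume "\<not> 1 \<le> nsq B"
    then have "nsq B = 0" by simp
    then show False using no_K5[OF sp fin(1) A B] S S' SS m4 by linarith
  qed
  have m: "1 \<le> card (mixed A B)" "3 \<le> card (mixed A B)" using S S' SS by linarith+
  obtain c e where e: "e \<noteq> 0" "coords c e B = unit_sq" "Complex 0 0 \<in> coords c e A"
    "card (mixed A B) \<le> card (coords c e A \<inter> corners)"
    by (rule square_class[OF sp fin(1) B SB m(1)])
  have full: "card (edges A B V) \<le> k + 4"
    if g: "g \<noteq> 0" "coords c g B = unit_sq" "Complex 0 0 \<in> coords c g A" "corners \<subseteq> coords c g A" for g
  proof -
    have Z: "finite (acoords c g V)" "card (acoords c g V) \<le> k"
      using fin(2) k(1) g(1) by (simp_all add: finite_acoords card_acoords)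
    have "coords c g A = {Complex 0 0, Complex 1 1, Complex 1 (-1), Complex (-1) 1, Complex (-1) (-1)}"
      using g A by (intro coords_eqI[OF g(1) finAB(1)]) auto
    then show ?thesis using edges_fit[OF g(1,2)] bound_96[OF Z k(2)] by metis
  qed
  have full4: "card (edges A B V) \<le> k + 4" if "4 \<le> card (mixed A B)"
  proof -
    have "4 \<le> card (coords c e A \<inter> corners)" using that e(4) by simp
    then have "coords c e A \<inter> corners = corners" by (intro card_seteq) simp_all
    then show ?thesis using full[OF e(1-3)] by blast
  qed
  then show "6 \<le> nsq U \<Longrightarrow> card (edges A B V) \<le> k + 4" using S' SS by linarith
  show "card (edges A B V) \<le> 2 * k - 3"
  proof (cases "4 \<le> card (mixed A B)")
    case True
    then show ?thesis using full4 k(2) by auto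
  next
    case False
    then have "1 \<le> nsq A" using S S' SS by linarith
    then have "sqs A \<noteq> {}" by (auto simp: nsq_def)
    then obtain d f where df: "f \<noteq> 0" "sq d f \<subseteq> A" by (auto simp: sqs_def)
    obtain g where g: "g \<noteq> 0" "coords c g B = unit_sq" "Complex 0 0 \<in> coords c g A"
      "Complex 1 1 \<in> coords c g A" "Complex 1 (-1) \<in> coords c g A" "Complex (-1) 1 \<in> coords c g A"
      using normal_corners(2)[OF e(1-3)] e(4) m(2) by (meson order_trans)
    have Z: "finite (acoords c g V)" "card (acoords c g V) \<le> k"
      using fin(2) k(1) g(1) by (simp_all add: finite_acoords card_acoords)
    let ?X = "{Complex 0 0, Complex 1 1, Complex 1 (-1), Complex (-1) 1}" and ?Q = "sq ((d - c) / g) (f / g)"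
    have fg: "f / g \<noteq> 0" using df g(1) by simp
    have fA: "finite (coords c g A)" "card (coords c g A) = 5"
      using finite_coords[OF g(1) finAB(1)] card_coords[OF g(1)] A by simp_all
    have XA: "?X \<subseteq> coords c g A" using g by simp
    have QA: "?Q \<subseteq> coords c g A" using df(2) unfolding coords_sq_gen[OF g(1), symmetric] by (auto simp: coords_def)
    have "card (coords c g A - ?X) = 1" using card_Diff_subset[OF _ XA] fA by simp
    then obtain w where "coords c g A - ?X = {w}" by (meson card_1_singletonE)
    then have w: "coords c g A = insert w ?X" "w \<notin> ?X" using XA by blast+
    have "card (coords c g A - ?Q) = 1" using card_Diff_subset[OF _ QA] fA card_sq[OF fg] by simp
    then obtain t where "coords c g A - ?Q = {t}" by (meson card_1_singletonE)
    then have t: "?Q = coords c g A - {t}" "t \<in> coords c g A" using QA by blast+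
    have Q: "?Q = insert w Y" if "?X - {t} = Y" "t \<noteq> w" for Y
      using t(1) w that by blast
    have "t = w \<or> t = Complex 0 0 \<or> t = Complex 1 1 \<or> t = Complex 1 (-1) \<or> t = Complex (-1) 1"
      using t(2) w(1) by simp
    then consider "w = Complex 2 0" | "w = Complex 0 2" | "w = Complex (-1) (-1)"
    proof (elim disjE)
      assume "t = w"
      then have "?Q = insert (Complex (-1) 1) {Complex 0 0, Complex 1 1, Complex 1 (-1)}"
        using t(1) w by auto
      then have "Complex (-1) 1 = Complex 2 0" by (rule fourth_vertex_cases(1)[OF fg _ _ refl]) simp
      then show ?thesis by simp
    next
      assume *: "t = Complex 0 0"
      have "?Q = insert w {Complex 1 1, Complex 1 (-1), Complex (-1) 1}"
        using w(2) by (intro Q) (auto simp: *)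
      then show ?thesis using fourth_vertex_cases(3)[OF fg _ _ refl] w(2) that(3) by blast
    next
      assume *: "t = Complex 1 1"
      have "?Q = insert w {Complex 0 0, Complex 1 (-1), Complex (-1) 1}"
        using w(2) by (intro Q) (auto simp: *)
      then show ?thesis using fourth_vertex_cases(5)[OF fg] w(2) by blast
    next
      assume *: "t = Complex 1 (-1)"
      have "?Q = insert w {Complex 0 0, Complex 1 1, Complex (-1) 1}"
        using w(2) by (intro Q) (auto simp: *)
      then show ?thesis using fourth_vertex_cases(2)[OF fg _ _ refl] w(2) that(2) by blast
    next
      assume *: "t = Complex (-1) 1"
      have "?Q = insert w {Complex 0 0, Complex 1 1, Complex 1 (-1)}"
        using w(2) by (intro Q) (auto simp: *)
      then show ?thesis using fourth_vertex_cases(1)[OF fg _ _ refl] w(2) that(1) by blast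
    qed
    then show ?thesis
    proof cases
      case 1
      then have "coords c g A = {Complex 0 0, Complex 1 1, Complex 1 (-1), Complex (-1) 1, Complex 2 0}"
        using w(1) by (simp add: insert_commute)
      then show ?thesis using edges_fit[OF g(1,2)] bound_95a[OF Z k(2)] by metis
    next
      case 2
      then have "coords c g A = {Complex 0 0, Complex 1 1, Complex 1 (-1), Complex (-1) 1, Complex 0 2}"
        using w(1) by (simp add: insert_commute)
      then show ?thesis using edges_fit[OF g(1,2)] bound_95b[OF Z k(2)] by metis
    next
      case 3
      then have "card (edges A B V) \<le> k + 4" using full[OF g(1-3)] g w(1) by auto
      then show ?thesis using k(2) by auto
    qed
  qed
qed

section \<open>Mixed squares against the number of squares inside one class\<close>

lemma next_split_ordered:
  assumes "parity_split P U V" "finite P"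
  obtains A B where "parity_split U A B" "card (mixed U V) \<le> card (edges A B V)" "card A \<le> card B"
    "card A + card B = card U"
proof -
  obtain A B where AB: "parity_split U A B" "card (mixed U V) \<le> card (edges A B V)"
    by (rule next_split[OF assms])
  have fin: "finite U" using parity_split_finite[OF assms] by simp
  have sum: "card A + card B = card U" by (rule parity_split_card[OF AB(1) fin])
  show ?thesis
  proof (cases "card A \<le> card B")
    case True then show ?thesis using that AB sum by blast
  next
    case False then show ?thesis
      using that[OF parity_split_sym[OF AB(1)]] AB(2) sum by (simp add: card_edges_swap add.commute)
  qed
qed

lemma class_bounds:
  assumes "parity_split P U V" "finite P"
  obtains A B where "parity_split U A B" "card (mixed U V) \<le> card (edges A B V)"
    "card A + card B = card U" "card A \<le> card B" "card (edges A B V) \<le> card A * card B"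
    "4 * card (mixed A B) \<le> card A * card A" "nsq U \<le> nsq A + nsq B + card (mixed A B)"
    "finite U" "finite V" "finite A" "finite B" "A \<inter> B = {}"
proof -
  obtain A B where AB: "parity_split U A B" "card (mixed U V) \<le> card (edges A B V)" "card A \<le> card B"
    "card A + card B = card U"
    by (rule next_split_ordered[OF assms])
  have fin: "finite U" "finite V" using parity_split_finite[OF assms] by auto
  have fin': "finite A" "finite B" using parity_split_finite[OF AB(1) fin(1)] by auto
  show ?thesis
    by (rule that[OF AB(1,2,4,3) card_edges_le[OF fin'] mixed_le(1)[OF AB(1) fin(1)] nsq_split[OF AB(1) fin(1)] fin fin'
          parity_split_sets(2)[OF AB(1)]])
qed

text \<open>The splits 1 + 6 and 2 + 5 allow at most two squares inside \<open>U\<close>, so only 3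
  + 4 has to be examined.\<close>

lemma side_7:
  assumes sp: "parity_split P U V" "finite P" and U: "card U = 7" "3 \<le> nsq U" and k: "card V \<le> k" "k \<in> {7, 8}"
  shows "card (mixed U V) \<le> k + 2"
proof -
  obtain A B where AB: "parity_split U A B" "card (mixed U V) \<le> card (edges A B V)"
    "card A + card B = card U" "card A \<le> card B" "card (edges A B V) \<le> card A * card B"
    "4 * card (mixed A B) \<le> card A * card A" "nsq U \<le> nsq A + nsq B + card (mixed A B)"
    "finite U" "finite V" "finite A" "finite B" "A \<inter> B = {}"
    by (rule class_bounds[OF sp])
  have "card A \<le> 3" using AB(3,4) U by simp
  then consider "card A = 0" | "card A = 1" "card B = 6" | "card A = 2" "card B = 5" | "card A = 3" "card B = 4"
    using AB(3) U by (auto simp: numeral_eq_Suc le_Suc_eq)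
  then show ?thesis
  proof cases
    case 1 then show ?thesis using AB(2,5) by simp
  next
    case 2 then show ?thesis using AB(2,5,6,7) nsq_small[OF AB(10)] nsq_le_square_bound_7[OF AB(11)] U by (simp add: square_bound_def)
  next
    case 3 then show ?thesis using AB(2,5,6,7) nsq_small[OF AB(10)] nsq_le_square_bound_7[OF AB(11)] U by (simp add: square_bound_def)
  next
    case 4 then show ?thesis using AB(2) bound_73[OF AB(1,8,9) 4 U(2) k] by simp
  qed
qed

lemma side_8:
  assumes sp: "parity_split P U V" "finite P" and U: "card U = 8" "4 \<le> nsq U" and k: "card V \<le> k" "k \<in> {7, 8, 9}"
  shows "card (mixed U V) \<le> k + 4"
proof -
  obtain A B where AB: "parity_split U A B" "card (mixed U V) \<le> card (edges A B V)"
    "card A + card B = card U" "card A \<le> card B" "card (edges A B V) \<le> card A * card B"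
    "4 * card (mixed A B) \<le> card A * card A" "nsq U \<le> nsq A + nsq B + card (mixed A B)"
    "finite U" "finite V" "finite A" "finite B" "A \<inter> B = {}"
    by (rule class_bounds[OF sp])
  have "card A \<le> 4" using AB(3,4) U by simp
  then consider "card A = 0" | "card A = 1" "card B = 7" | "card A = 2" "card B = 6" | "card A = 3" "card B = 5"
    | "card A = 4" "card B = 4"
    using AB(3) U by (auto simp: numeral_eq_Suc le_Suc_eq)
  then show ?thesis
  proof cases
    case 1 then show ?thesis using AB(2,5) by simp
  next
    case 2 then show ?thesis using AB(2,5,6,7) nsq_small[OF AB(10)] nsq_le_square_bound_7[OF AB(11)] U by (simp add: square_bound_def)
  next
    case 3 then show ?thesis using AB(2,5,6,7) nsq_small[OF AB(10)] nsq_le_square_bound_7[OF AB(11)] U by (simp add: square_bound_def)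
  next
    case 4 then show ?thesis using AB(2,5,6,7) nsq_small[OF AB(10)] nsq_le_square_bound_7[OF AB(11)] U by (simp add: square_bound_def)
  next
    case 5 then show ?thesis using AB(2) bound_84[OF AB(1,8,9) 5 U(2) k] by simp
  qed
qed

text \<open>The split 1 + 8 needs the bound for eight points, which only becomes available within
  the final induction and therefore enters as the hypothesis \<open>eight\<close>.\<close>

lemma side_9:
  assumes sp: "parity_split P U V" "finite P" and U: "card U = 9" "5 \<le> nsq U" and k: "card V \<le> k" "k \<in> {7, 8}"
    and eight: "\<And>Q. finite Q \<Longrightarrow> card Q = 8 \<Longrightarrow> nsq Q \<le> 4"
  shows "card (mixed U V) \<le> 2 * k - 3" "6 \<le> nsq U \<Longrightarrow> card (mixed U V) \<le> k + 4"
proof -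
  obtain A B where AB: "parity_split U A B" "card (mixed U V) \<le> card (edges A B V)"
    "card A + card B = card U" "card A \<le> card B" "card (edges A B V) \<le> card A * card B"
    "4 * card (mixed A B) \<le> card A * card A" "nsq U \<le> nsq A + nsq B + card (mixed A B)"
    "finite U" "finite V" "finite A" "finite B" "A \<inter> B = {}"
    by (rule class_bounds[OF sp])
  have "card A \<le> 4" using AB(3,4) U by simp
  then consider "card A = 0" | "card A = 1" "card B = 8" | "card A = 2" "card B = 7" | "card A = 3" "card B = 6"
    | "card A = 4" "card B = 5"
    using AB(3) U by (auto simp: numeral_eq_Suc le_Suc_eq)
  then have "card (mixed U V) \<le> 2 * k - 3 \<and> (6 \<le> nsq U \<longrightarrow> card (mixed U V) \<le> k + 4)"
  proof cases
    case 1 then show ?thesis using AB(2,5) by simp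
  next
    case 2 then show ?thesis using AB(2,5,6,7) nsq_small[OF AB(10)] eight[OF AB(11)] U by simp
  next
    case 3 then show ?thesis using AB(2,5,6,7) nsq_small[OF AB(10)] nsq_le_square_bound_7[OF AB(11)] U by (simp add: square_bound_def)
  next
    case 4 then show ?thesis using AB(2,5,6,7) nsq_small[OF AB(10)] nsq_le_square_bound_7[OF AB(11)] U by (simp add: square_bound_def)
  next
    case 5 then show ?thesis
      using AB(2) bound_95[OF parity_split_sym[OF AB(1)] AB(8,9) 5(2,1) U(2) k, unfolded card_edges_swap[of B A V]]
      by (meson order_trans)
  qed
  then show "card (mixed U V) \<le> 2 * k - 3" "6 \<le> nsq U \<Longrightarrow> card (mixed U V) \<le> k + 4" by simp_all
qed

lemma complete_K43:
  assumes "e \<noteq> 0" "A \<inter> B = {}" "A \<times> B \<subseteq> edges A B V"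
    and "c + e \<in> A" "c - e \<in> A" "c + \<i> * e \<in> B" "c - \<i> * e \<in> B"
    and fin: "finite A" "finite B" "finite V" and card: "4 \<le> card A" "3 \<le> card B"
  shows "9 \<le> card V"
proof -
  have "c + \<i> * (\<i> * e) = c - e" "c - \<i> * (\<i> * e) = c + e" by simp_all
  moreover have "B \<times> A \<subseteq> edges B A V" using assms(3) by (auto simp: edges_def)
  ultimately show ?thesis
    using complete_K34[of "\<i> * e" B A V c] assms by (simp add: Int_commute)
qed

text \<open>Each diagonal of a mixed square lies in one of two disjoint classes, so \<open>x\<close>
  and \<open>y\<close> are adjacent vertices. The two squares lie on either side of their
  segment.\<close>

lemma squares_through_side:
  assumes "A \<inter> B = {}" "finite A" "finite B"
  shows "card {Q \<in> mixed A B. x \<in> Q \<and> y \<in> Q \<and> x \<in> A \<and> y \<in> B} \<le> 2"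
proof -
  define e1 where "e1 = (x - y) / (1 - \<i>)"
  define e2 where "e2 = (x - y) / (1 + \<i>)"
  have nz: "1 - \<i> \<noteq> 0" "1 + \<i> \<noteq> 0" by (simp_all add: complex_eq_iff)
  have "{Q \<in> mixed A B. x \<in> Q \<and> y \<in> Q \<and> x \<in> A \<and> y \<in> B} \<subseteq> {sq (x - e1) e1, sq (x - e2) e2}"
  proof
    fix Q assume "Q \<in> {Q \<in> mixed A B. x \<in> Q \<and> y \<in> Q \<and> x \<in> A \<and> y \<in> B}"
    then obtain c e where Q: "Q = sq c e" "c + e \<in> A" "c - e \<in> A" "c + \<i> * e \<in> B" "c - \<i> * e \<in> B"
      and xy: "x \<in> Q" "y \<in> Q" "x \<in> A" "y \<in> B" by (auto simp: mixed_def)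
    have "x = c + e \<or> x = c - e" "y = c + \<i> * e \<or> y = c - \<i> * e"
      using Q xy assms(1) by (auto simp: sq_def)
    moreover have "sq c (- e) = Q" using Q(1) by (auto simp: sq_def)
    ultimately obtain f where f: "Q = sq c f" "x = c + f" "y = c + \<i> * f \<or> y = c - \<i> * f"
      using Q(1) by (metis add_uminus_conv_diff diff_minus_eq_add mult_minus_right)
    from f(3) have "f = e1 \<or> f = e2"
    proof
      assume "y = c + \<i> * f"
      then have "x - y = f * (1 - \<i>)" using f(2) by (simp add: algebra_simps)
      then show ?thesis using nz by (simp add: e1_def)
    next
      assume "y = c - \<i> * f"
      then have "x - y = f * (1 + \<i>)" using f(2) by (simp add: algebra_simps)
      then show ?thesis using nz by (simp add: e2_def)
    qed
    moreover have "c = x - f" using f(2) by simp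
    ultimately show "Q \<in> {sq (x - e1) e1, sq (x - e2) e2}" using f(1) by blast
  qed
  then have "card {Q \<in> mixed A B. x \<in> Q \<and> y \<in> Q \<and> x \<in> A \<and> y \<in> B} \<le> card {sq (x - e1) e1, sq (x - e2) e2}"
    by (rule card_mono[rotated]) simp
  also have "\<dots> \<le> 2" by (simp add: card_insert_if)
  finally show ?thesis .
qed

lemma mixed_seed:
  assumes "1 \<le> card (mixed A B)"
  obtains c e where "e \<noteq> 0" "c + e \<in> A" "c - e \<in> A" "c + \<i> * e \<in> B" "c - \<i> * e \<in> B"
proof -
  have "mixed A B \<noteq> {}" using assms by auto
  then show ?thesis using that by (auto simp: mixed_def)
qed

text \<open>At most one pair is missing. At most two of the three squares have it as a side, so some
  square avoids one of its ends; deleting that end leaves a complete graph, 3 by 4 or larger, that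
  still contains the square.\<close>

lemma near_complete_K44:
  assumes AB: "A \<inter> B = {}" "finite A" "finite B" "finite V" "card A = 4" "card B = 4"
    and m: "3 \<le> card (mixed A B)" and E: "15 \<le> card (edges A B V)"
  shows "9 \<le> card V"
proof -
  have "finite (A \<times> B - edges A B V)" using AB by simp
  have "card (A \<times> B - edges A B V) \<le> 1"
    using card_Diff_subset[OF finite_edges[OF AB(2,3)] edges_subset, of V] E AB(5,6) by (simp add: card_cartesian_product)
  \<comment> \<open>If no pair is missing, \<open>x\<close> and \<open>y\<close> are arbitrary,
    which is why their membership in \<open>A\<close> and \<open>B\<close> is carried along.\<close>
  then obtain x y where xy: "A \<times> B - edges A B V \<subseteq> {(x, y)}"
    using card_le_Suc0_iff_eq[OF \<open>finite (A \<times> B - edges A B V)\<close>] by (metis One_nat_def empty_subsetI singletonI subsetI surj_pair subset_singletonD ex_in_conv)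
  have "\<exists>Q\<in>mixed A B. \<not> (x \<in> Q \<and> y \<in> Q \<and> x \<in> A \<and> y \<in> B)"
  proof (rule ccontr)
    assume "\<not> ?thesis"
    then have "{Q \<in> mixed A B. x \<in> Q \<and> y \<in> Q \<and> x \<in> A \<and> y \<in> B} = mixed A B" by blast
    then show False using squares_through_side[OF AB(1-3), of x y] m by simp
  qed
  then obtain c e where e: "e \<noteq> 0" "c + e \<in> A" "c - e \<in> A" "c + \<i> * e \<in> B" "c - \<i> * e \<in> B"
    and bad: "\<not> (x \<in> sq c e \<and> y \<in> sq c e \<and> x \<in> A \<and> y \<in> B)"
    by (auto simp: mixed_def)
  show ?thesis
  proof (cases "x \<in> A - sq c e")
    case True
    then have mem: "c + e \<in> A - {x}" "c - e \<in> A - {x}" using e by (auto simp: sq_def)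
    have "(A - {x}) \<times> B \<subseteq> edges (A - {x}) B V" using xy by (auto simp: edges_def)
    moreover have "(A - {x}) \<inter> B = {}" using AB(1) by blast
    moreover have "3 \<le> card (A - {x})" using AB(2,5) True by simp
    ultimately show ?thesis
      using complete_K34[OF e(1) _ _ mem e(4,5)] AB by simp
  next
    case False
    then have mem: "c + \<i> * e \<in> B - {y}" "c - \<i> * e \<in> B - {y}" if "x \<in> A" using e bad that by (auto simp: sq_def)
    show ?thesis
    proof (cases "x \<in> A")
      case True
      have "A \<times> (B - {y}) \<subseteq> edges A (B - {y}) V" using xy by (auto simp: edges_def)
      moreover have "A \<inter> (B - {y}) = {}" using AB(1) by blast
      moreover have "3 \<le> card (B - {y})" using AB(3,6) by (simp add: card_Diff_singleton_if)
      ultimately show ?thesis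
        using complete_K43[OF e(1) _ _ e(2,3) mem[OF True]] AB by simp
    next
      case False
      then have "A \<times> B \<subseteq> edges A B V" using xy by (auto simp: edges_def)
      then show ?thesis using complete_K34[OF e(1) AB(1) _ e(2-5)] AB by simp
    qed
  qed
qed

lemma sq_containing_zero:
  assumes "0 \<in> sq d h"
  shows "sq d h = {0, 2 * d, d + \<i> * d, d - \<i> * d}"
proof -
  consider "d = - h" | "d = h" | "d = - (\<i> * h)" | "d = \<i> * h"
    using assms by (auto simp: sq_def eq_neg_iff_add_eq_0)
  then show ?thesis
  proof cases
    case 3
    then have "h = \<i> * d" by simp
    then show ?thesis by (auto simp: sq_def)
  next
    case 4
    then have "h = - (\<i> * d)" by simp
    then show ?thesis by (auto simp: sq_def)
  qed (auto simp: sq_def)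
qed

text \<open>In the square \<open>A\<close> the corner \<open>k\<close> is opposite to the centre or
  next to it. If opposite, \<open>(1 - \<i>) * k / 2\<close> is a vertex as well, but it lies in
  \<open>unit_sq\<close>. If next to it, the other neighbour of the centre is \<open>k\<close> after
  a quarter turn, again a corner.\<close>

lemma two_corners:
  assumes e: "e \<noteq> 0" "coords c e B = unit_sq" "Complex 0 0 \<in> coords c e A" and AB: "A \<inter> B = {}"
    and A: "A = sq d f" "f \<noteq> 0" and k: "1 \<le> card (coords c e A \<inter> corners)"
  shows "2 \<le> card (coords c e A \<inter> corners)"
proof -
  obtain k where k: "k \<in> coords c e A" "k \<in> corners"
    using assms(7) by (metis IntE One_nat_def card.empty ex_in_conv not_one_le_zero)
  have disj: "coords c e A \<inter> unit_sq = {}" using AB unfolding e(2)[symmetric] by (auto simp: coords_def)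
  have Asq: "coords c e A = sq ((d - c) / e) (f / e)" unfolding A(1) by (rule coords_sq_gen[OF e(1)])
  have "0 \<in> sq ((d - c) / e) (f / e)" using e(3) Asq by (simp add: zero_complex.code)
  then obtain g where g: "coords c e A = {0, 2 * g, g + \<i> * g, g - \<i> * g}"
    using sq_containing_zero Asq by metis
  have i: "\<i> * k \<in> corners" "- (\<i> * k) \<in> corners" "(1 - \<i>) * k / 2 \<in> unit_sq" "k \<noteq> 0"
    "\<i> * k \<noteq> k" "- (\<i> * k) \<noteq> k"
    using k(2) by (auto simp: complex_eq_iff)
  have "\<exists>k'\<in>coords c e A \<inter> corners. k' \<noteq> k"
  proof -
    have "k = 2 * g \<or> k = g + \<i> * g \<or> k = g - \<i> * g" using k(1) i(4) g by auto
    then show ?thesis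
    proof (elim disjE)
      assume "k = 2 * g"
      then have "g - \<i> * g = (1 - \<i>) * k / 2" by (simp add: algebra_simps)
      then have "g - \<i> * g \<in> unit_sq" using i(3) by (simp only:)
      moreover have "g - \<i> * g \<in> coords c e A" by (simp add: g)
      ultimately show ?thesis using disj by (meson disjoint_iff)
    next
      assume "k = g + \<i> * g"
      then have "g - \<i> * g = - (\<i> * k)" by (simp only:) (simp add: algebra_simps)
      moreover have "g - \<i> * g \<in> coords c e A" by (simp add: g)
      ultimately show ?thesis using i(2,6) by (metis IntI)
    next
      assume "k = g - \<i> * g"
      then have "g + \<i> * g = \<i> * k" by (simp only:) (simp add: algebra_simps)
      moreover have "g + \<i> * g \<in> coords c e A" by (simp add: g)
      ultimately show ?thesis using i(1,5) by (metis IntI)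
    qed
  qed
  then obtain k' where k': "k' \<in> coords c e A" "k' \<in> corners" "k' \<noteq> k" by blast
  have "{k, k'} \<subseteq> coords c e A \<inter> corners" using k k' by blast
  then have "card {k, k'} \<le> card (coords c e A \<inter> corners)" by (intro card_mono) simp_all
  then show ?thesis using k'(3) by simp
qed


text \<open>The centre and two corners account for at most 8 + 2 edges; the fourth point of
  \<open>A\<close> adds at most four.\<close>

lemma bound_73_corners:
  assumes fin: "finite A" "finite V" and A: "card A = 4" and k: "card V \<le> 8"
    and e: "e \<noteq> 0" "coords c e B = unit_sq" "Complex 0 0 \<in> coords c e A" "2 \<le> card (coords c e A \<inter> corners)"
  shows "card (edges A B V) \<le> 14"
proof -
  obtain g where g: "g \<noteq> 0" "coords c g B = unit_sq" "Complex 0 0 \<in> coords c g A"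
      "Complex 1 1 \<in> coords c g A" "Complex 1 (-1) \<in> coords c g A \<or> Complex (-1) (-1) \<in> coords c g A"
    using normal_corners(1)[OF e] by blast
  have Z: "finite (acoords c g V)" "card (acoords c g V) \<le> 8"
    using fin(2) k(1) g(1) by (simp_all add: finite_acoords card_acoords)
  have main: "card (edges A B V) \<le> 14"
    if X: "X \<subseteq> coords c g A" "card X = 3" and b: "card (ledges X unit_sq (acoords c g V)) \<le> 10" for X
  proof -
    let ?A = "coords c g A"
    have f: "finite ?A" "card ?A = 4" using finite_coords[OF g(1) fin(1)] card_coords[OF g(1)] A by simp_all
    have fX: "finite X" using X f finite_subset by blast
    have "card (?A - X) = 1" using card_Diff_subset[OF fX X(1)] f X(2) by simp
    moreover have "?A = X \<union> (?A - X)" using X(1) by blast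
    moreover have "card unit_sq = 4" by simp
    ultimately have "card (ledges ?A unit_sq (acoords c g V)) \<le> 14"
      using ledges_Un[of X "?A - X" unit_sq "acoords c g V"] fX f(1) b by simp
    then show ?thesis using edges_fit[OF g(1,2) refl] by simp
  qed
  from g(5) show ?thesis
  proof
    assume "Complex 1 (-1) \<in> coords c g A"
    then show ?thesis using g bound_73a[OF Z] by (intro main[of "{Complex 0 0, Complex 1 1, Complex 1 (-1)}"]) auto
  next
    assume "Complex (-1) (-1) \<in> coords c g A"
    then show ?thesis using g bound_73b[OF Z] by (intro main[of "{Complex 0 0, Complex 1 1, Complex (-1) (-1)}"]) auto
  qed
qed

text \<open>Fifteen edges leave a complete 3 + 5 split or a 4 + 4 split lacking at most one pair. In
  the second, a subclass that is a square is ruled out by \<open>bound_73_corners\<close>; without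
  one, all three squares are mixed and \<open>near_complete_K44\<close> asks for nine points in
  \<open>V\<close>.\<close>

lemma side_8_14:
  assumes sp: "parity_split P U V" "finite P" and U: "card U = 8" "3 \<le> nsq U" and V: "card V \<le> 8"
  shows "card (mixed U V) \<le> 14"
proof (rule ccontr)
  assume "\<not> card (mixed U V) \<le> 14"
  then have m: "15 \<le> card (mixed U V)" by simp
  obtain A B where AB: "parity_split U A B" "card (mixed U V) \<le> card (edges A B V)"
    "card A + card B = card U" "card A \<le> card B" "card (edges A B V) \<le> card A * card B"
    "4 * card (mixed A B) \<le> card A * card A" "nsq U \<le> nsq A + nsq B + card (mixed A B)"
    "finite U" "finite V" "finite A" "finite B" "A \<inter> B = {}"
    by (rule class_bounds[OF sp])
  have E: "15 \<le> card (edges A B V)" using m AB(2) by simp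
  have "card A \<le> 4" using AB(3,4) U by simp
  then consider "card A = 0" | "card A = 1" "card B = 7" | "card A = 2" "card B = 6" | "card A = 3" "card B = 5"
    | "card A = 4" "card B = 4"
    using AB(3) U by (auto simp: numeral_eq_Suc le_Suc_eq)
  then show False
  proof cases
    case 4
    then have "A \<times> B \<subseteq> edges A B V" using E by (intro edges_full AB(10,11)) simp
    moreover have "1 \<le> card (mixed A B)"
      using AB(7) U 4 nsq_small[OF AB(10)] nsq_le_square_bound_7[OF AB(11)] by (simp add: square_bound_def)
    then obtain c e where "e \<noteq> 0" "c + e \<in> A" "c - e \<in> A" "c + \<i> * e \<in> B" "c - \<i> * e \<in> B" by (rule mixed_seed)
    ultimately have "9 \<le> card V" using complete_K34[OF _ AB(12)] AB 4 by simp
    then show False using V by simp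
  next
    case 5
    have aux: "1 \<le> nsq B \<Longrightarrow> False"
      if sp: "parity_split U A B" and c: "card A = 4" "card B = 4" and E: "15 \<le> card (edges A B V)"
        and S: "3 \<le> nsq A + nsq B + card (mixed A B)" and disj: "A \<inter> B = {}" and fin: "finite A" "finite B" for A B
    proof -
      assume SB: "1 \<le> nsq B"
      have SA: "nsq A \<le> 1" "nsq B \<le> 1" using card4_nsq(1) fin c by auto
      then have m1: "1 \<le> card (mixed A B)" using S by linarith
      obtain c' e where e: "e \<noteq> 0" "coords c' e B = unit_sq" "Complex 0 0 \<in> coords c' e A"
        "card (mixed A B) \<le> card (coords c' e A \<inter> corners)"
        by (rule square_class[OF sp AB(8) c(2) SB m1])
      have "2 \<le> card (coords c' e A \<inter> corners)"
      proof (cases "2 \<le> card (mixed A B)")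
        case True then show ?thesis using e(4) by simp
      next
        case False
        then have "1 \<le> nsq A" using S SA by linarith
        then obtain d f where "f \<noteq> 0" "A = sq d f" using card4_nsq(2)[OF fin(1) c(1)] by blast
        then show ?thesis using two_corners[OF e(1-3) disj] e(4) m1 by simp
      qed
      then have "card (edges A B V) \<le> 14" by (rule bound_73_corners[OF fin(1) AB(9) c(1) V e(1-3)])
      then show False using E by simp
    qed
    have S: "3 \<le> nsq A + nsq B + card (mixed A B)" using AB(7) U(2) by simp
    have "\<not> 1 \<le> nsq B" using aux[OF AB(1) 5 E S AB(12,10,11)] by blast
    moreover have "1 \<le> nsq A \<Longrightarrow> False"
      using aux[OF parity_split_sym[OF AB(1)] 5(2,1)] E S AB(10-12)
      by (simp add: card_edges_swap[of A B V] mixed_sym[of B A] Int_commute)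
    then have "\<not> 1 \<le> nsq A" by blast
    ultimately have "3 \<le> card (mixed A B)" using S by simp
    then have "9 \<le> card V" using near_complete_K44[OF AB(12,10,11,9) 5 _ E] by simp
    then show False using V by simp
  qed (use E AB(5) in simp_all)
qed

lemma side_8_15:
  assumes sp: "parity_split P U V" "finite P" and U: "card U = 8" "3 \<le> nsq U" and V: "card V \<le> 9"
  shows "card (mixed U V) \<le> 15"
proof (rule ccontr)
  assume "\<not> card (mixed U V) \<le> 15"
  then have m: "16 \<le> card (mixed U V)" by simp
  obtain A B where AB: "parity_split U A B" "card (mixed U V) \<le> card (edges A B V)"
    "card A + card B = card U" "card A \<le> card B" "card (edges A B V) \<le> card A * card B"
    "4 * card (mixed A B) \<le> card A * card A" "nsq U \<le> nsq A + nsq B + card (mixed A B)"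
    "finite U" "finite V" "finite A" "finite B" "A \<inter> B = {}"
    by (rule class_bounds[OF sp])
  have E: "16 \<le> card (edges A B V)" using m AB(2) by simp
  have "card A \<le> 4" using AB(3,4) U by simp
  then consider "card A = 0" | "card A = 1" "card B = 7" | "card A = 2" "card B = 6" | "card A = 3" "card B = 5"
    | "card A = 4" "card B = 4"
    using AB(3) U by (auto simp: numeral_eq_Suc le_Suc_eq)
  then show False
  proof cases
    case 5
    then have "A \<times> B \<subseteq> edges A B V" using E by (intro edges_full AB(10,11)) simp
    moreover have "1 \<le> card (mixed A B)"
      using AB(7) U card4_nsq(1)[OF AB(10) 5(1)] card4_nsq(1)[OF AB(11) 5(2)] by linarith
    then obtain c e where "e \<noteq> 0" "c + e \<in> A" "c - e \<in> A" "c + \<i> * e \<in> B" "c - \<i> * e \<in> B" by (rule mixed_seed)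
    ultimately have "10 \<le> card V" using complete_K44[OF _ AB(12)] AB 5 by simp
    then show False using V by simp
  qed (use E AB(5) in simp_all)
qed

lemma side_7_11:
  assumes sp: "parity_split P U V" "finite P" and U: "card U = 7" "2 \<le> nsq U" and V: "card V \<le> 7"
  shows "card (mixed U V) \<le> 11"
proof (rule ccontr)
  assume "\<not> card (mixed U V) \<le> 11"
  then have m: "12 \<le> card (mixed U V)" by simp
  obtain A B where AB: "parity_split U A B" "card (mixed U V) \<le> card (edges A B V)"
    "card A + card B = card U" "card A \<le> card B" "card (edges A B V) \<le> card A * card B"
    "4 * card (mixed A B) \<le> card A * card A" "nsq U \<le> nsq A + nsq B + card (mixed A B)"
    "finite U" "finite V" "finite A" "finite B" "A \<inter> B = {}"
    by (rule class_bounds[OF sp])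
  have E: "12 \<le> card (edges A B V)" using m AB(2) by simp
  have "card A \<le> 3" using AB(3,4) U by simp
  then consider "card A = 0" | "card A = 1" "card B = 6" | "card A = 2" "card B = 5" | "card A = 3" "card B = 4"
    using AB(3) U by (auto simp: numeral_eq_Suc le_Suc_eq)
  then show False
  proof cases
    case 4
    then have "A \<times> B \<subseteq> edges A B V" using E by (intro edges_full AB(10,11)) simp
    moreover have "1 \<le> card (mixed A B)"
      using AB(7) U 4 nsq_small[OF AB(10)] card4_nsq(1)[OF AB(11)] by simp
    then obtain c e where "e \<noteq> 0" "c + e \<in> A" "c - e \<in> A" "c + \<i> * e \<in> B" "c - \<i> * e \<in> B" by (rule mixed_seed)
    ultimately have "9 \<le> card V" using complete_K34[OF _ AB(12)] AB 4 by simp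
    then show False using V by simp
  qed (use E AB(5) in simp_all)
qed

text \<open>Six edges make the 2 + 3 split complete, so in scaled coordinates \<open>V\<close> is
  exactly \<open>core\<close>. Then \<open>y + \<i>\<close> and \<open>y - \<i>\<close> both lie in
  \<open>core\<close> for the third point \<open>y\<close> of \<open>B\<close>, which is possible
  only on \<open>unit_sq\<close>.\<close>

lemma side_5:
  assumes sp: "parity_split P U V" "finite P" and U: "card U = 5" "1 \<le> nsq U" and V: "card V = 5"
  shows "card (mixed U V) \<le> 5"
proof (rule ccontr)
  assume "\<not> card (mixed U V) \<le> 5"
  then have m: "6 \<le> card (mixed U V)" by simp
  obtain A B where AB: "parity_split U A B" "card (mixed U V) \<le> card (edges A B V)"
    "card A + card B = card U" "card A \<le> card B" "card (edges A B V) \<le> card A * card B"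
    "4 * card (mixed A B) \<le> card A * card A" "nsq U \<le> nsq A + nsq B + card (mixed A B)"
    "finite U" "finite V" "finite A" "finite B" "A \<inter> B = {}"
    by (rule class_bounds[OF sp])
  have E: "6 \<le> card (edges A B V)" using m AB(2) by simp
  have "card A \<le> 2" using AB(3,4) U by simp
  then consider "card A = 0" | "card A = 1" "card B = 4" | "card A = 2" "card B = 3"
    using AB(3) U by (auto simp: numeral_eq_Suc le_Suc_eq)
  then show False
  proof cases
    case 3
    then have full: "A \<times> B \<subseteq> edges A B V" using E by (intro edges_full AB(10,11)) simp
    have "1 \<le> card (mixed A B)"
      using AB(7) U 3 nsq_small[OF AB(10)] nsq_small[OF AB(11)] by simp
    then obtain c e where e: "e \<noteq> 0" "c + e \<in> A" "c - e \<in> A" "c + \<i> * e \<in> B" "c - \<i> * e \<in> B" by (rule mixed_seed)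
    let ?Z = "acoords c e V"
    have Z: "finite ?Z" "card ?Z = 5" using e(1) AB(9) V by (simp_all add: finite_acoords card_acoords)
    note * = complete_seed[OF e(1) AB(12) full e(2-5)]
    have mem: "Complex 1 0 \<in> coords c e A" "Complex (-1) 0 \<in> coords c e A" "Complex 0 1 \<in> coords c e B" "Complex 0 (-1) \<in> coords c e B"
      using e by (simp_all add: coords_def mult_units)
    have lk: "lk s t \<in> ?Z \<and> lk t s \<in> ?Z" if "s \<in> coords c e A" "t \<in> coords c e B" for s t
    proof -
      have "(c + e * s, c + e * t) \<in> edges A B V" using that full by (auto simp: coords_def)
      then show ?thesis unfolding edges_coords_iff by (simp add: ledges_def)
    qed
    have "core \<subseteq> ?Z"
      using lk[OF mem(1,3)] lk[OF mem(1,4)] lk[OF mem(2,3)] lk[OF mem(2,4)] by (simp add: core_def)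
    then have Zc: "?Z = core" using Z card_core by (metis card_subset_eq)
    have "card (coords c e B - {Complex 0 1, Complex 0 (-1)}) = 1" using *(2)[OF AB(11)] 3 by simp
    then obtain y where y: "y \<in> coords c e B - {Complex 0 1, Complex 0 (-1)}" by (metis card_1_singletonE singletonI)
    have "y + \<i> \<in> core" "y - \<i> \<in> core"
      using lk[OF mem(1), of y] lk[OF mem(2), of y] y Zc by (simp_all add: lk_def complex_units)
    moreover have "y \<notin> unit_sq" using *(4)[OF y] .
    ultimately show False by (cases y) (auto simp: core_def complex_eq_iff)
  qed (use E AB(5) in simp_all)
qed

text \<open>If \<open>V\<close> is a square with mixed squares attached, \<open>U\<close> contains
  its centre, hence at most three corners; and with three corners \<open>U\<close> is not a square.
  If neither class is a square, only the at most four mixed squares count.\<close>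

lemma hard_4_4:
  assumes sp: "parity_split P U V" "finite P" and c: "card U = 4" "card V = 4"
  shows "nsq P \<le> 4"
proof -
  have aux: "nsq U + card (mixed U V) \<le> 3"
    if sp: "parity_split P U V" and c: "card U = 4" "card V = 4" and SV: "1 \<le> nsq V" for U V
  proof (cases "1 \<le> card (mixed U V)")
    case False
    then show ?thesis using card4_nsq(1)[OF _ c(1)] parity_split_finite[OF sp assms(2)] by fastforce
  next
    case True
    have fin: "finite U" "finite V" using parity_split_finite[OF sp assms(2)] by auto
    obtain d e where e: "e \<noteq> 0" "coords d e V = unit_sq" "Complex 0 0 \<in> coords d e U"
        "card (mixed U V) \<le> card (coords d e U \<inter> corners)"
      by (rule square_class[OF sp assms(2) c(2) SV True])
    have f: "finite (coords d e U)" "card (coords d e U) = 4"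
      using finite_coords[OF e(1) fin(1)] card_coords[OF e(1)] c by simp_all
    have "coords d e U \<inter> corners \<subseteq> coords d e U - {Complex 0 0}" by auto
    then have "card (coords d e U \<inter> corners) \<le> 3"
      using card_mono[of "coords d e U - {Complex 0 0}" "coords d e U \<inter> corners"] f e(3) by simp
    then have m3: "card (mixed U V) \<le> 3" using e(4) by simp
    have "nsq U = 0" if m3': "3 \<le> card (mixed U V)"
    proof (rule ccontr)
      assume "nsq U \<noteq> 0"
      then obtain p h where U: "h \<noteq> 0" "U = sq p h" using card4_nsq(2)[OF fin(1) c(1)] by auto
      obtain g where g: "g \<noteq> 0" "coords d g V = unit_sq" "Complex 0 0 \<in> coords d g U"
        "Complex 1 1 \<in> coords d g U" "Complex 1 (-1) \<in> coords d g U" "Complex (-1) 1 \<in> coords d g U"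
        using normal_corners(2)[OF e(1-3)] e(4) m3' by (meson order_trans)
      have "coords d g U = {Complex (-1) 1, Complex 0 0, Complex 1 1, Complex 1 (-1)}"
        using g c by (intro coords_eqI[OF g(1) fin(1)]) auto
      then have sqX: "sq ((p - d) / g) (h / g) = insert (Complex (-1) 1) {Complex 0 0, Complex 1 1, Complex 1 (-1)}"
        unfolding U(2) coords_sq_gen[OF g(1)] .
      have "h / g \<noteq> 0" using U g by simp
      then have "Complex (-1) 1 = Complex 2 0" by (rule fourth_vertex_cases(1)[OF _ sqX _ refl]) simp
      then show False by simp
    qed
    then show ?thesis using m3 card4_nsq(1)[OF fin(1) c(1)] by linarith
  qed
  have fin: "finite U" "finite V" using parity_split_finite[OF sp] by auto
  have S: "nsq P \<le> nsq U + nsq V + card (mixed U V)" by (rule nsq_split[OF sp])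
  have SS: "nsq U \<le> 1" "nsq V \<le> 1" using card4_nsq(1) fin c by auto
  have m: "card (mixed U V) \<le> 4" using mixed_le(1)[OF sp] c by simp
  consider "1 \<le> nsq V" | "1 \<le> nsq U" | "nsq U = 0" "nsq V = 0" by linarith
  then show ?thesis
  proof cases
    case 1 then show ?thesis using aux[OF sp(1) c] S SS by simp
  next
    case 2 then show ?thesis using aux[OF parity_split_sym[OF sp(1)] c(2,1)] S SS by (simp add: mixed_sym[of V U])
  next
    case 3 then show ?thesis using S m by simp
  qed
qed

text \<open>The entries for 11, 12 and 13 come from crude estimates, which suffice for the later ones.\<close>

theorem nsq_le_square_bound: "finite P \<Longrightarrow> card P \<le> 17 \<Longrightarrow> nsq P \<le> square_bound (card P)"
proof (induction "card P" arbitrary: P rule: less_induct)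
  case less
  show ?case
  proof (cases "card P \<le> 7")
    case True
    then show ?thesis by (rule nsq_le_square_bound_7[OF less.prems(1)])
  next
    case False
    then obtain U V where UV: "parity_split P U V" "1 \<le> card V" "card V \<le> card U" "card U + card V = card P"
      using ordered_split[OF less.prems(1)] by auto
    have fin: "finite U" "finite V" using parity_split_finite[OF UV(1) less.prems(1)] by auto
    have IH: "nsq U \<le> square_bound (card U)" "nsq V \<le> square_bound (card V)"
      using less.hyps[of U] less.hyps[of V] fin UV less.prems(2) by auto
    have n: "nsq P \<le> nsq U + nsq V + card (mixed U V)" by (rule nsq_split[OF UV(1) less.prems(1)])
    have m: "4 * card (mixed U V) \<le> card V * card V" by (rule mixed_le(2)[OF UV(1) less.prems(1)])
    note sp = UV(1) less.prems(1)
    have swap: "parity_split P V U" "mixed V U = mixed U V" using parity_split_sym[OF UV(1)] mixed_sym by auto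
    have eight: "nsq Q \<le> 4" if "9 \<le> card U" "finite Q" "card Q = 8" for Q
      using less.hyps[of Q] that less.prems(2) UV(4) by (simp add: square_bound_def)
    consider "card U = 4 \<and> card V = 4" | "card U = 5 \<and> card V = 5" | "card U = 7 \<and> card V = 7" | "card U = 8 \<and> card V = 7"
      | "card U = 8 \<and> card V = 8" | "card U = 9 \<and> card V = 7" | "card U = 9 \<and> card V = 8"
      | "square_bound (card U) + square_bound (card V) + card V * card V div 4 \<le> square_bound (card U + card V)"
    proof -
      have "card V \<in> {1, 2, 3, 4, 5, 6, 7, 8}" using UV(2-4) less.prems(2) by auto
      moreover have "card U \<in> {4..16}" using UV(2-4) less.prems(2) False by auto
      then have "card U \<in> {4, 5, 6, 7, 8, 9, 10, 11, 12, 13, 14, 15, 16}"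
        by (simp add: numeral_eq_Suc atLeastAtMostSuc_conv) auto
      moreover have "card U + card V \<in> {8..17}" "card V \<le> card U" using UV(3,4) less.prems(2) False by auto
      ultimately show ?thesis using that
        by (simp only: insert_iff empty_iff) (elim disjE; simp add: square_bound_def)
    qed
    then show ?thesis
    proof cases
      case 1
      then show ?thesis using hard_4_4[OF sp] UV(4) by (simp add: square_bound_def flip: UV(4))
    next
      case 2
      then have "nsq U = 0 \<or> card (mixed U V) \<le> 5"
        using side_5[OF sp] by (cases "nsq U = 0") (simp_all add: Suc_le_eq)
      moreover have "nsq U \<le> 1" "nsq V \<le> 1" "card (mixed U V) \<le> 6"
        using 2 IH m by (simp_all add: square_bound_def)
      ultimately have "nsq P \<le> 7" using n by linarith
      then show ?thesis using 2 by (simp add: square_bound_def flip: UV(4))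
    next
      case 3
      \<comment> \<open>Up to 9 mixed squares give 3 + 3 + 9, then 10 or 11 give at most 2 + 2 + 11,
        and 12 give 1 + 2 + 12: each sum is 15.\<close>
      have "nsq U \<le> 2 \<or> card (mixed U V) \<le> 9" using side_7[OF sp, of 7] 3 by (cases "3 \<le> nsq U") auto
      moreover have "nsq V \<le> 2 \<or> card (mixed U V) \<le> 9" using side_7[OF swap(1) less.prems(1), of 7, unfolded swap(2)] 3 by (cases "3 \<le> nsq V") auto
      moreover have "nsq U \<le> 1 \<or> card (mixed U V) \<le> 11" using side_7_11[OF sp] 3 by (cases "2 \<le> nsq U") auto
      moreover have "nsq U \<le> 3" "nsq V \<le> 3" "card (mixed U V) \<le> 12" using 3 IH m by (simp_all add: square_bound_def)
      ultimately have "nsq P \<le> 15" using n by linarith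
      then show ?thesis using 3 by (simp add: square_bound_def flip: UV(4))
    next
      case 4
      \<comment> \<open>The extreme sums 4 + 3 + 10, 4 + 2 + 11 and 3 + 2 + 12 are all 17.\<close>
      have "nsq V \<le> 2 \<or> card (mixed U V) \<le> 10" using side_7[OF swap(1) less.prems(1), of 8, unfolded swap(2)] 4 by (cases "3 \<le> nsq V") auto
      moreover have "nsq U \<le> 3 \<or> card (mixed U V) \<le> 11" using side_8[OF sp, of 7] 4 by (cases "4 \<le> nsq U") auto
      moreover have "nsq U \<le> 4" "nsq V \<le> 3" "card (mixed U V) \<le> 12" using 4 IH m by (simp_all add: square_bound_def)
      ultimately have "nsq P \<le> 17" using n by linarith
      then show ?thesis using 4 by (simp add: square_bound_def flip: UV(4))
    next
      case 5
      \<comment> \<open>The extreme sums 4 + 4 + 12, 3 + 3 + 14 and 2 + 2 + 16 are all 20.\<close>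
      have "nsq U \<le> 3 \<or> card (mixed U V) \<le> 12" using side_8[OF sp, of 8] 5 by (cases "4 \<le> nsq U") auto
      moreover have "nsq V \<le> 3 \<or> card (mixed U V) \<le> 12" using side_8[OF swap(1) less.prems(1), of 8, unfolded swap(2)] 5 by (cases "4 \<le> nsq V") auto
      moreover have "nsq U \<le> 2 \<or> card (mixed U V) \<le> 14" using side_8_14[OF sp] 5 by (cases "3 \<le> nsq U") auto
      moreover have "nsq V \<le> 2 \<or> card (mixed U V) \<le> 14" using side_8_14[OF swap(1) less.prems(1), unfolded swap(2)] 5 by (cases "3 \<le> nsq V") auto
      moreover have "nsq U \<le> 4" "nsq V \<le> 4" "card (mixed U V) \<le> 16" using 5 IH m by (simp_all add: square_bound_def)
      ultimately have "nsq P \<le> 20" using n by linarith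
      then show ?thesis using 5 by (simp add: square_bound_def flip: UV(4))
    next
      case 6
      then have e8: "\<And>Q. finite Q \<Longrightarrow> card Q = 8 \<Longrightarrow> nsq Q \<le> 4" using eight by simp
      have b17: "5 \<le> nsq U \<Longrightarrow> card (mixed U V) \<le> 2 * 7 - 3"
        by (rule side_9(1)[OF sp]) (use 6 e8 in simp_all)
      have "nsq U \<le> 4 \<or> card (mixed U V) \<le> 11" using b17 by (cases "5 \<le> nsq U") simp_all
      moreover have "nsq U \<le> 6" "nsq V \<le> 3" "card (mixed U V) \<le> 12" using 6 IH m by (simp_all add: square_bound_def)
      ultimately have "nsq P \<le> 20" using n by linarith
      then show ?thesis using 6 by (simp add: square_bound_def flip: UV(4))
    next
      case 7
      then have e8: "\<And>Q. finite Q \<Longrightarrow> card Q = 8 \<Longrightarrow> nsq Q \<le> 4" using eight by simp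
      have b18: "5 \<le> nsq U \<Longrightarrow> card (mixed U V) \<le> 2 * 8 - 3"
        by (rule side_9(1)[OF sp]) (use 7 e8 in simp_all)
      have b28: "6 \<le> nsq U \<Longrightarrow> card (mixed U V) \<le> 8 + 4"
        by (rule side_9(2)[OF sp]) (use 7 e8 in simp_all)
      \<comment> \<open>The extreme sums 6 + 4 + 12, 5 + 4 + 13, 4 + 3 + 15 and 4 + 2 + 16 are all
        22.\<close>
      have "nsq U \<le> 4 \<or> card (mixed U V) \<le> 13" using b18 by (cases "5 \<le> nsq U") simp_all
      moreover have "nsq U \<le> 5 \<or> card (mixed U V) \<le> 12" using b28 by (cases "6 \<le> nsq U") simp_all
      moreover have "nsq V \<le> 3 \<or> card (mixed U V) \<le> 13" using side_8[OF swap(1) less.prems(1), of 9, unfolded swap(2)] 7 by (cases "4 \<le> nsq V") auto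
      moreover have "nsq V \<le> 2 \<or> card (mixed U V) \<le> 15" using side_8_15[OF swap(1) less.prems(1), unfolded swap(2)] 7 by (cases "3 \<le> nsq V") auto
      moreover have "nsq U \<le> 6" "nsq V \<le> 4" "card (mixed U V) \<le> 16" using 7 IH m by (simp_all add: square_bound_def)
      ultimately have "nsq P \<le> 22" using n by linarith
      then show ?thesis using 7 by (simp add: square_bound_def flip: UV(4))
    next
      case 8
      moreover have "card (mixed U V) \<le> card V * card V div 4"
        using m by (simp add: less_eq_div_iff_mult_less_eq mult.commute)
      ultimately have "nsq P \<le> square_bound (card U + card V)" using n IH by linarith
      then show ?thesis by (simp only: UV(4))
    qed
  qed
qed

section \<open>The maximum in the real plane\<close>

definition to_complex :: "real^2 \<Rightarrow> complex" where
  "to_complex p = Complex (p $ 1) (p $ 2)"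

lemma inj_to_complex: "inj to_complex"
  by (auto simp: inj_def to_complex_def vec_eq_iff forall_2)

lemma perpendicular_complex:
  fixes v w :: complex
  assumes "Re v * Re w + Im v * Im w = 0" "(Re v)\<^sup>2 + (Im v)\<^sup>2 = (Re w)\<^sup>2 + (Im w)\<^sup>2"
  shows "w = \<i> * v \<or> w = - (\<i> * v)"
proof -
  have "(w - \<i> * v) * (w + \<i> * v) = w\<^sup>2 + v\<^sup>2" by (simp add: algebra_simps power2_eq_square)
  also have "\<dots> = 0"
  proof -
    define p q r s where pqrs: "p = Re v" "q = Im v" "r = Re w" "s = Im w"
    have a: "p * r + q * s = 0" "p\<^sup>2 + q\<^sup>2 = r\<^sup>2 + s\<^sup>2" using assms by (simp_all add: pqrs)
    \<comment> \<open>The left side is the squared modulus of \<open>v\<^sup>2 + w\<^sup>2\<close>.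
      The right side combines the difference of the squared lengths and the inner product, which
      both vanish.\<close>
    have "(p\<^sup>2 - q\<^sup>2 + r\<^sup>2 - s\<^sup>2)\<^sup>2 + (2 * (p * q + r * s))\<^sup>2 = 
        (p\<^sup>2 + q\<^sup>2 - (r\<^sup>2 + s\<^sup>2))\<^sup>2 + 4 * (p * r + q * s)\<^sup>2"
      by (simp add: power2_eq_square algebra_simps)
    also have "\<dots> = 0" using a by simp
    finally have "p\<^sup>2 - q\<^sup>2 + r\<^sup>2 - s\<^sup>2 = 0" "p * q + r * s = 0"
      by (simp_all add: sum_power2_eq_zero_iff)
    then show ?thesis by (simp add: complex_eq_iff pqrs power2_eq_square algebra_simps)
  qed
  finally show ?thesis by (auto simp: eq_neg_iff_add_eq_0)
qed

lemma is_square_complex: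
  assumes "is_square a b c d"
  shows "\<exists>m e. e \<noteq> 0 \<and> to_complex ` {a, b, c, d} = sq m e"
proof -
  define v where "v = to_complex b - to_complex a"
  define w where "w = to_complex d - to_complex a"
  have sq: "a \<noteq> b" "b - a = c - d" "(b - a) \<bullet> (d - a) = 0" "dist a b = dist a d"
    using assms by (auto simp: is_square_def)
  have c: "to_complex c = to_complex a + v + w"
    using arg_cong[OF sq(2), of to_complex] by (simp add: v_def w_def to_complex_def complex_eq_iff algebra_simps)
  have "(b - a) \<bullet> (b - a) = (d - a) \<bullet> (d - a)"
    using sq(4) by (simp add: dist_norm norm_minus_commute power2_norm_eq_inner[symmetric])
  then have "Re v * Re w + Im v * Im w = 0" "(Re v)\<^sup>2 + (Im v)\<^sup>2 = (Re w)\<^sup>2 + (Im w)\<^sup>2"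
    using sq(3) by (simp_all add: v_def w_def to_complex_def inner_vec_def sum_2 power2_eq_square)
  then have w: "w = \<i> * v \<or> w = - (\<i> * v)" by (rule perpendicular_complex)
  have v0: "v \<noteq> 0" using sq(1) inj_to_complex by (auto simp: v_def inj_eq)
  \<comment> \<open>Half the diagonal, directed from the centre to \<open>a\<close>; this makes
    \<open>m\<close> the centre.\<close>
  define e where "e = - (v + w) / 2"
  define m where "m = to_complex a - e"
  have "to_complex a = m + e" "to_complex c = m - e" by (simp_all add: m_def c e_def)
  moreover have "to_complex b = to_complex a + v" "to_complex d = to_complex a + w" by (simp_all add: v_def w_def)
  moreover have "m + \<i> * e = to_complex a + v \<and> m - \<i> * e = to_complex a + w \<or>
      m + \<i> * e = to_complex a + w \<and> m - \<i> * e = to_complex a + v"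
    using w by (elim disjE) (simp_all add: m_def e_def field_simps)
  ultimately have "to_complex ` {a, b, c, d} = sq m e"
    unfolding sq_def by auto
  moreover have "e \<noteq> 0"
  proof
    assume "e = 0"
    then have "w = - v" by (simp add: e_def eq_neg_iff_add_eq_0 add.commute)
    then show False using w v0 by (auto simp: complex_eq_iff)
  qed
  ultimately show ?thesis by blast
qed

lemma num_squares_le_nsq:
  assumes "finite P"
  shows "num_squares P \<le> nsq (to_complex ` P)"
proof -
  have "(`) to_complex ` squares_in P \<subseteq> sqs (to_complex ` P)"
    using is_square_complex by (fastforce simp: squares_in_def sqs_def)
  moreover have "finite (sqs (to_complex ` P))" using assms by (simp add: finite_sqs)
  moreover have "inj_on ((`) to_complex) (squares_in P)"
    using inj_to_complex by (simp add: inj_on_def inj_image_eq_iff)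
  ultimately show ?thesis unfolding num_squares_def nsq_def by (metis card_image card_mono)
qed

lemma max_squares_le:
  assumes "n \<le> 17"
  shows "max_squares n \<le> square_bound n"
proof -
  have "num_squares P \<le> square_bound n" if "finite P" "card P = n" for P
  proof -
    have "card (to_complex ` P) = n" using that inj_to_complex by (simp add: card_image inj_on_subset)
    then show ?thesis
      using num_squares_le_nsq[OF that(1)] nsq_le_square_bound[of "to_complex ` P"] that(1) assms by simp
  qed
  then show ?thesis
    unfolding max_squares_def using max_squares_well_defined[of n] by (subst Max_le_iff) auto
qed

section \<open>Lattice configurations attaining the bounds\<close>

definition lattice_point :: "int \<times> int \<Rightarrow> real^2" where
  "lattice_point p = vector [of_int (fst p), of_int (snd p)]"

text \<open>A square is encoded by a base vertex and a side vector, the next side being its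
  counterclockwise quarter turn. Integer coordinates let distinctness be decided by
  evaluation.\<close>

fun lattice_square :: "(int \<times> int) \<times> (int \<times> int) \<Rightarrow> (int \<times> int) set" where
  "lattice_square ((x, y), (u, v)) = {(x, y), (x + u, y + v), (x + u - v, y + v + u), (x - v, y + u)}"

lemma inj_lattice_point: "inj lattice_point"
  by (auto simp: inj_def lattice_point_def vec_eq_iff forall_2 vector_2)

lemma card_lattice_square:
  assumes "(u, v) \<noteq> (0, 0)"
  shows "card (lattice_square ((x, y), (u, v))) = 4"
proof -
  have uv: "u \<noteq> 0 \<or> v \<noteq> 0" using assms by simp
  have "(x, y) \<noteq> (x + u, y + v)" "(x, y) \<noteq> (x + u - v, y + v + u)" "(x, y) \<noteq> (x - v, y + u)"
    "(x + u, y + v) \<noteq> (x + u - v, y + v + u)" "(x + u, y + v) \<noteq> (x - v, y + u)"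
    "(x + u - v, y + v + u) \<noteq> (x - v, y + u)"
    unfolding prod.inject using uv by - (smt (verit))+
  then have "distinct [(x, y), (x + u, y + v), (x + u - v, y + v + u), (x - v, y + u)]"
    by (simp only: distinct.simps list.set insert_iff empty_iff simp_thms de_Morgan_disj)
  from distinct_card[OF this] show ?thesis by (simp only: list.set lattice_square.simps list.size)
qed

lemma is_square_lattice:
  assumes "(u, v) \<noteq> (0, 0)"
  shows "is_square (lattice_point (x, y)) (lattice_point (x + u, y + v)) (lattice_point (x + u - v, y + v + u)) (lattice_point (x - v, y + u))"
  using assms
  by (auto simp: is_square_def lattice_point_def vec_eq_iff forall_2 vector_2 inner_vec_def sum_2 dist_vec_def L2_set_def
      dist_real_def power2_eq_square algebra_simps)

lemma max_squares_lattice: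
  assumes S: "finite S" "card S = n" and K: "\<forall>k\<in>K. snd k \<noteq> (0, 0) \<and> lattice_square k \<subseteq> S"
    and N: "card (lattice_square ` K) = N"
  shows "N \<le> max_squares n"
proof -
  let ?P = "lattice_point ` S"
  have "(`) lattice_point ` lattice_square ` K \<subseteq> squares_in ?P"
  proof clarify
    fix x y u v assume "((x, y), (u, v)) \<in> K"
    then have k: "(u, v) \<noteq> (0, 0)" "lattice_square ((x, y), (u, v)) \<subseteq> S" using K by force+
    have "card (lattice_point ` lattice_square ((x, y), (u, v))) = 4"
      using card_lattice_square[OF k(1)] inj_lattice_point by (metis card_image inj_on_subset subset_UNIV)
    moreover have "lattice_point ` lattice_square ((x, y), (u, v)) \<subseteq> ?P" using k(2) by blast
    ultimately show "lattice_point ` lattice_square ((x, y), (u, v)) \<in> squares_in ?P"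
      using is_square_lattice[OF k(1), of x y] unfolding squares_in_def by (fastforce simp: image_insert)
  qed
  moreover have "finite (squares_in ?P)"
    by (rule finite_subset[of _ "Pow ?P"]) (auto simp: squares_in_def S)
  moreover have "card ((`) lattice_point ` lattice_square ` K) = N"
    using N inj_lattice_point by (simp add: card_image inj_on_def inj_image_eq_iff)
  ultimately have "N \<le> num_squares ?P" unfolding num_squares_def by (metis card_mono)
  moreover have "card ?P = n" using S inj_lattice_point by (simp add: card_image inj_on_subset)
  then have "num_squares ?P \<in> {num_squares P | P. finite P \<and> card P = n}" using S by blast
  then have "num_squares ?P \<le> max_squares n"
    unfolding max_squares_def by (rule Max_ge[OF max_squares_well_defined(1)])
  ultimately show ?thesis by simp
qed

text \<open>The 4 by 4 grid without two opposite corners. Each corner lies on three of the 20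
  squares of the grid and the largest is shared, so 20 - 3 - 3 + 1 remain. All side vectors have a
  positive first and a nonnegative second coordinate, so no square is listed twice.\<close>

lemma lower_14: "15 \<le> max_squares 14"
proof -
  let ?S = "{(0, 1), (0, 2), (0, 3), (1, 0), (1, 1), (1, 2), (1, 3), (2, 0), (2, 1), (2, 2), (2, 3), (3, 0), (3, 1), (3, 2)} :: (int \<times> int) set"
  let ?K = "{((0, 1), (1, 0)), ((0, 1), (2, 0)), ((0, 2), (1, 0)), ((1, 0), (1, 0)), ((1, 0), (1, 1)), ((1, 0), (2, 0)), ((1, 0), (2, 1)), ((1, 1), (1, 0)), ((1, 1), (1, 1)), ((1, 2), (1, 0)), ((2, 0), (1, 0)), ((2, 0), (1, 1)), ((2, 0), (1, 2)), ((2, 1), (1, 0)), ((2, 1), (1, 1))} :: ((int \<times> int) \<times> (int \<times> int)) set"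
  have "card ?S = 14" by simp
  moreover have "card ?K = 15" by simp
  moreover have "card (lattice_square ` ?K) = 15"
    by (simp add: card_insert_if set_eq_subset)
  ultimately show ?thesis
    using max_squares_lattice[of ?S 14 ?K 15] by simp
qed

text \<open>The grid without the corner \<open>(3, 3)\<close>, which costs three squares.\<close>

lemma lower_15: "17 \<le> max_squares 15"
proof -
  let ?S = "{(0, 0), (0, 1), (0, 2), (0, 3), (1, 0), (1, 1), (1, 2), (1, 3), (2, 0), (2, 1), (2, 2), (2, 3), (3, 0), (3, 1), (3, 2)} :: (int \<times> int) set"
  let ?K = "{((0, 0), (1, 0)), ((0, 0), (2, 0)), ((0, 1), (1, 0)), ((0, 1), (2, 0)), ((0, 2), (1, 0)), ((1, 0), (1, 0)), ((1, 0), (1, 1)), ((1, 0), (2, 0)), ((1, 0), (2, 1)), ((1, 1), (1, 0)), ((1, 1), (1, 1)), ((1, 2), (1, 0)), ((2, 0), (1, 0)), ((2, 0), (1, 1)), ((2, 0), (1, 2)), ((2, 1), (1, 0)), ((2, 1), (1, 1))} :: ((int \<times> int) \<times> (int \<times> int)) set"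
  have "card ?S = 15" by simp
  moreover have "card ?K = 17" by simp
  moreover have "card (lattice_square ` ?K) = 17"
    by (simp add: card_insert_if set_eq_subset)
  ultimately show ?thesis
    using max_squares_lattice[of ?S 15 ?K 17] by simp
qed

text \<open>By the side of the bounding box, 1, 2 or 3, the full grid has 9 + 4 * 2 + 1 * 3
  squares.\<close>

lemma lower_16: "20 \<le> max_squares 16"
proof -
  let ?S = "{(0, 0), (0, 1), (0, 2), (0, 3), (1, 0), (1, 1), (1, 2), (1, 3), (2, 0), (2, 1), (2, 2), (2, 3), (3, 0), (3, 1), (3, 2), (3, 3)} :: (int \<times> int) set"
  let ?K = "{((0, 0), (1, 0)), ((0, 0), (2, 0)), ((0, 0), (3, 0)), ((0, 1), (1, 0)), ((0, 1), (2, 0)), ((0, 2), (1, 0)), ((1, 0), (1, 0)), ((1, 0), (1, 1)), ((1, 0), (2, 0)), ((1, 0), (2, 1)), ((1, 1), (1, 0)), ((1, 1), (1, 1)), ((1, 1), (2, 0)), ((1, 2), (1, 0)), ((2, 0), (1, 0)), ((2, 0), (1, 1)), ((2, 0), (1, 2)), ((2, 1), (1, 0)), ((2, 1), (1, 1)), ((2, 2), (1, 0))} :: ((int \<times> int) \<times> (int \<times> int)) set"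
  have "card ?S = 16" by simp
  moreover have "card ?K = 20" by simp
  moreover have "card (lattice_square ` ?K) = 20"
    by (simp add: card_insert_if set_eq_subset)
  ultimately show ?thesis
    using max_squares_lattice[of ?S 16 ?K 20] by simp
qed

text \<open>The extra point \<open>(-1, 1)\<close> closes two more squares, one with
  \<open>(0, 0)\<close>, \<open>(1, 1)\<close>, \<open>(0, 2)\<close> and one with
  \<open>(1, 0)\<close>, \<open>(2, 2)\<close>, \<open>(0, 3)\<close>.\<close>

lemma lower_17: "22 \<le> max_squares 17"
proof -
  let ?S = "{(0, 0), (0, 1), (0, 2), (0, 3), (1, 0), (1, 1), (1, 2), (1, 3), (2, 0), (2, 1), (2, 2), (2, 3), (3, 0), (3, 1), (3, 2), (3, 3), (-1, 1)} :: (int \<times> int) set"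
  let ?K = "{((0, 0), (1, 0)), ((0, 0), (1, 1)), ((0, 0), (2, 0)), ((0, 0), (3, 0)), ((0, 1), (1, 0)), ((0, 1), (2, 0)), ((0, 2), (1, 0)), ((1, 0), (1, 0)), ((1, 0), (1, 1)), ((1, 0), (1, 2)), ((1, 0), (2, 0)), ((1, 0), (2, 1)), ((1, 1), (1, 0)), ((1, 1), (1, 1)), ((1, 1), (2, 0)), ((1, 2), (1, 0)), ((2, 0), (1, 0)), ((2, 0), (1, 1)), ((2, 0), (1, 2)), ((2, 1), (1, 0)), ((2, 1), (1, 1)), ((2, 2), (1, 0))} :: ((int \<times> int) \<times> (int \<times> int)) set"
  have "card ?S = 17" by simp
  moreover have "card ?K = 22" by simp
  moreover have "card (lattice_square ` ?K) = 22"
    by (simp add: card_insert_if set_eq_subset)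
  ultimately show ?thesis
    using max_squares_lattice[of ?S 17 ?K 22] by simp
qed

theorem theorem51:
  "max_squares 14 = 15 \<and> max_squares 15 = 17 \<and> max_squares 16 = 20 \<and> max_squares 17 = 22"
  using max_squares_le[of 14] max_squares_le[of 15] max_squares_le[of 16] max_squares_le[of 17]
    lower_14 lower_15 lower_16 lower_17
  by (simp add: square_bound_def)

end
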